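(* Let $\mathcal{C}=(V,\mathcal{R})$ be a coherent configuration with exactly two fibers $X$ and $Y$, and suppose that $|X|=|Y|$ is a prime, $|\mathcal{R}_{X,X}|>2$ and $|\mathcal{R}_{X,Y}|>1$. Put $k=\frac{|X|-1}{|\mathcal{R}_{X,X}|-1}$. Then there exists $R\in\mathcal{R}_{X,Y}$ with $|R|=|X|=|Y|$ provided one of the following holds: (i) $|\mathcal{R}_{X,X}|>k^2(k+e-2)$, where $e$ is the number of distinct prime divisors of $k$; (ii) $k\in\{q,2q,3q\}$ for some prime power $q$; (iii) $k=4q$ for some prime power $q$ with $3\nmid q+1$.
   Context: A coherent configuration is a pair $\mathcal{C}=(V,\mathcal{R})$ where $V$ is a finite set and $\mathcal{R}$ is a partition of $V\times V$ into nonempty sets such that: (1) the diagonal $\Delta_V=\{(v,v)\mid v\in V\}$ is a union of members of $\mathcal{R}$; (2) for each $R\in\mathcal{R}$ its transpose $R^t=\{(u,v)\mid (v,u)\in R\}$ belongs to $\mathcal{R}$; (3) for all $R,S,T\in\mathcal{R}$ there is a constant $c_{RS}^T$ with $c_{RS}^T=|R(u)\cap S^t(v)|$ for all $(u,v)\in T$, where $T(w)=\{z\in V\mid (w,z)\in T\}$. A subset $X\subseteq V$ is a fiber if $\Delta_X=\{(x,x)\mid x\in X\}\in\mathcal{R}$. For fibers $X,Y$, $\mathcal{R}_{X,Y}=\{R\in\mathcal{R}\mid R\subseteq X\times Y\}$. *)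

theory Defs
  imports Main "HOL-Computational_Algebra.Primes" "HOL-Number_Theory.Prime_Powers"
begin

definition coherent_configuration :: "'a set \<Rightarrow> ('a \<times> 'a) set set \<Rightarrow> bool" where
  "coherent_configuration V RR \<longleftrightarrow>
     finite V \<and>
     (\<forall>S\<in>RR. S \<noteq> {}) \<and>
     \<Union>RR = V \<times> V \<and>
     (\<forall>S\<in>RR. \<forall>T\<in>RR. S \<noteq> T \<longrightarrow> S \<inter> T = {}) \<and>
     (\<exists>D\<subseteq>RR. \<Union>D = Id_on V) \<and>
     (\<forall>S\<in>RR. converse S \<in> RR) \<and>
     (\<forall>S\<in>RR. \<forall>T\<in>RR. \<forall>U\<in>RR. \<exists>c::nat. \<forall>(u,v)\<in>U.
        card {w. (u,w) \<in> S \<and> (w,v) \<in> T} = c)"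

definition fiber :: "'a set \<Rightarrow> ('a \<times> 'a) set set \<Rightarrow> 'a set \<Rightarrow> bool" where
  "fiber V RR X \<longleftrightarrow> X \<subseteq> V \<and> Id_on X \<in> RR"

definition rels_between :: "('a \<times> 'a) set set \<Rightarrow> 'a set \<Rightarrow> 'a set \<Rightarrow> ('a \<times> 'a) set set" where
  "rels_between RR X Y = {S\<in>RR. S \<subseteq> X \<times> Y}"

end

theory Submission
  imports Defs "HOL-Computational_Algebra.Fundamental_Theorem_Algebra" "HOL-Number_Theory.Cong"
    "HOL-Library.FuncSet"
begin

text \<open>
  Let \<open>p = |X| = |Y|\<close> and write \<open>d\<^sub>R\<close> for the valency \<open>|R| / p\<close>. For a fiber \<open>F \<in> {X, Y}\<close> the matrix
  \<open>z = \<Sum> A\<^sub>R A\<^sub>R\<^sup>T / (p d\<^sub>R)\<close>, with \<open>R\<close> ranging over the basis relations from \<open>X\<close> to \<open>F\<close>, is central in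
  the adjacency algebra of \<open>X\<close>, and \<open>tr (A z)\<close> is the trace of left multiplication by \<open>A\<close> on the span of
  the \<open>A\<^sub>R\<close>. Applied to the spectral idempotents of \<open>z\<close> this shows that the eigenvalues of \<open>z\<close> are
  quotients of ranks, so these idempotents are rational. Modulo \<open>p\<close> the adjacency algebra is local, which
  leaves no rational central idempotents except \<open>0\<close>, \<open>I\<close>, \<open>J / p\<close> and \<open>I - J / p\<close>; hence
  \<open>z = \<alpha> I + \<beta> J\<close>. Comparing entries, all nontrivial valencies on \<open>X\<close> are equal to \<open>k\<close>, and a double
  count gives as many relations from \<open>X\<close> to \<open>Y\<close> as from \<open>X\<close> to \<open>X\<close>, say \<open>m + 1\<close>.

  Expanding \<open>A\<^sub>R A\<^sub>S\<^sup>T\<close> yields \<open>d\<^sub>R d\<^sub>R \<equiv> d\<^sub>R\<close> and \<open>d\<^sub>R d\<^sub>S \<equiv> 0\<close> modulo \<open>k\<close> for \<open>R \<noteq> S\<close>, while the \<open>m + 1\<close>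
  valencies add up to \<open>p = 1 + k m\<close>. If at most one of them is not divisible by \<open>k\<close>, that one equals 1.
  The number of valencies not divisible by \<open>k\<close> is at most the number of prime divisors of \<open>k\<close>. For
  large \<open>m\<close>, averaging \<open>|A\<^sub>R A\<^sub>S\<^sup>T|\<^sup>2\<close> over \<open>S\<close> forces every valency to divide \<open>k\<close>, and the sum is then too
  small. If \<open>k = a b\<close> for coprime prime powers, two exceptional valencies are \<open>a a'\<close> and \<open>b b'\<close> with
  \<open>a a' + b b' = a b + 1\<close>; for coprime \<open>a'\<close> and \<open>b'\<close> the products of the two relations are supported on
  single relations \<open>T\<close> and \<open>U\<close>, and an estimate by the Cauchy--Schwarz inequality makes \<open>T\<close> together with the
  diagonal an equivalence relation, which is impossible as \<open>p\<close> is prime. The remaining case \<open>b = 3\<close>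
  makes \<open>T\<close> symmetric of odd size.
\<close>

section \<open>Factoring matrices through a minimal set of columns\<close>

text \<open>The obstacle is integrality: idempotents of the adjacency algebra usually exist only
  over an extension of the rationals, where reduction modulo \<open>p\<close> is awkward. The
  eigenvalues of \<open>z\<close> are rational, so everything can be reduced inside the rationals
  localized at \<open>p\<close>. Reduction is effective because the diagonal of a fiber is one basis
  relation: every trace is \<open>p\<close> times a diagonal entry, while the trace of an idempotent
  is its rank. An idempotent modulo \<open>p\<close> thus has rank 0 or \<open>p\<close>.

  Conditions (ii) and (iii) act through two exceptional valencies \<open>a a'\<close> and
  \<open>b b'\<close> with \<open>a = q\<close> and \<open>b \<le> 4\<close>. Since
  \<open>a' < b\<close>, a common factor of \<open>a'\<close> and \<open>b'\<close> leaves three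
  cases. For \<open>b = 3\<close>, \<open>a' = 2\<close> the equation \<open>3 b' = q + 1\<close>
  with \<open>b'\<close> even makes \<open>k\<close> odd, and parity decides. For
  \<open>b = 4\<close>, \<open>a' = 2\<close> the sum of the valencies has the wrong parity. For
  \<open>b = 4\<close>, \<open>a' = 3\<close> one gets \<open>4 b' = q + 1\<close> with 3 dividing
  \<open>b'\<close>, which is what condition (iii) forbids. Condition (i) is used only through
  \<open>m \<ge> 2 e k\<close>, where \<open>e\<close> is the number of prime divisors of
  \<open>k\<close>.\<close>

definition mmul :: "'b set \<Rightarrow> ('a \<Rightarrow> 'b \<Rightarrow> 'f::semiring_0) \<Rightarrow> ('b \<Rightarrow> 'c \<Rightarrow> 'f) \<Rightarrow> 'a \<Rightarrow> 'c \<Rightarrow> 'f" where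
  "mmul J A B = (\<lambda>i k. \<Sum>j\<in>J. A i j * B j k)"

definition mtrace :: "'a set \<Rightarrow> ('a \<Rightarrow> 'a \<Rightarrow> 'f::comm_monoid_add) \<Rightarrow> 'f" where
  "mtrace X A = (\<Sum>x\<in>X. A x x)"

text \<open>Matrices are total functions and only the summation index is restricted. Associativity
  is therefore an identity of functions, while the unit laws for this truncated identity need
  entries that vanish outside \<open>X\<close>.\<close>

definition mid :: "'a set \<Rightarrow> 'a \<Rightarrow> 'a \<Rightarrow> 'f::zero_neq_one" where
  "mid X = (\<lambda>x y. of_bool (x = y \<and> x \<in> X))"

primrec mpow :: "'a set \<Rightarrow> ('a \<Rightarrow> 'a \<Rightarrow> 'f::semiring_1) \<Rightarrow> nat \<Rightarrow> 'a \<Rightarrow> 'a \<Rightarrow> 'f" where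
  "mpow X A 0 = mid X"
| "mpow X A (Suc n) = mmul X A (mpow X A n)"

lemma mmul_assoc: "mmul K (mmul J A B) C = mmul J A (mmul K B C)"
proof (intro ext)
  fix i l
  have "mmul K (mmul J A B) C i l = (\<Sum>k\<in>K. \<Sum>j\<in>J. A i j * B j k * C k l)"
    by (simp add: mmul_def sum_distrib_right)
  also have "\<dots> = (\<Sum>j\<in>J. \<Sum>k\<in>K. A i j * (B j k * C k l))"
    by (subst sum.swap) (simp add: mult.assoc)
  also have "\<dots> = mmul J A (mmul K B C) i l"
    by (simp add: mmul_def sum_distrib_left)
  finally show "mmul K (mmul J A B) C i l = mmul J A (mmul K B C) i l" .
qed

lemma mtrace_mmul_commute:
  fixes A :: "'a \<Rightarrow> 'b \<Rightarrow> 'f::comm_semiring_0"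
  shows "mtrace I (mmul J A B) = mtrace J (mmul I B A)"
  unfolding mtrace_def mmul_def by (subst sum.swap) (simp add: mult.commute)

lemma mmul_cong:
  assumes "\<And>j. j \<in> J \<Longrightarrow> A i j = A' i j" "\<And>j. j \<in> J \<Longrightarrow> B j k = B' j k"
  shows "mmul J A B i k = mmul J A' B' i k"
  unfolding mmul_def using assms by (auto intro: sum.cong)

lemma mmul_mid_left:
  fixes A :: "'a \<Rightarrow> 'b \<Rightarrow> 'f::semiring_1"
  assumes "finite X" "\<And>y. x \<notin> X \<Longrightarrow> A x y = 0"
  shows "mmul X (mid X) A x y = A x y"
proof (cases "x \<in> X")
  case True
  have "mmul X (mid X) A x y = (\<Sum>j\<in>X. if x = j then A j y else 0)"
    unfolding mmul_def mid_def by (rule sum.cong) (auto simp: True)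
  then show ?thesis using assms(1) True by simp
next
  case False
  then show ?thesis using assms(2) by (simp add: mmul_def mid_def)
qed

lemma mmul_mid_right:
  fixes A :: "'b \<Rightarrow> 'a \<Rightarrow> 'f::semiring_1"
  assumes "finite X" "\<And>x. y \<notin> X \<Longrightarrow> A x y = 0"
  shows "mmul X A (mid X) x y = A x y"
proof (cases "y \<in> X")
  case True
  have "mmul X A (mid X) x y = (\<Sum>j\<in>X. if j = y then A x j else 0)"
    unfolding mmul_def mid_def by (rule sum.cong) (auto simp: True)
  then show ?thesis using assms(1) True by simp
next
  case False
  then show ?thesis using assms(2) by (auto simp: mmul_def mid_def intro!: sum.neutral)
qed

text \<open>\<open>R\<close> is the ring of admissible coefficients and \<open>Z\<close> an
  \<open>R\<close>-module of elements that count as zero: \<open>{0}\<close> gives exact statements,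
  the multiples of \<open>p\<close> give congruences.\<close>

locale coeff_ring =
  fixes R Z :: "'f::field set"
  assumes R0: "0 \<in> R" and R1: "1 \<in> R"
    and Radd: "a \<in> R \<Longrightarrow> b \<in> R \<Longrightarrow> a + b \<in> R"
    and Rmult: "a \<in> R \<Longrightarrow> b \<in> R \<Longrightarrow> a * b \<in> R"
    and Rminus: "a \<in> R \<Longrightarrow> - a \<in> R"
    and Z0: "0 \<in> Z"
    and Zadd: "a \<in> Z \<Longrightarrow> b \<in> Z \<Longrightarrow> a + b \<in> Z"
    and Zmult: "a \<in> R \<Longrightarrow> b \<in> Z \<Longrightarrow> a * b \<in> Z"
begin

lemma Zminus: "a \<in> Z \<Longrightarrow> - a \<in> Z"
  using Zmult[OF Rminus[OF R1]] by fastforce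

lemma Zmult2: "b \<in> Z \<Longrightarrow> a \<in> R \<Longrightarrow> b * a \<in> Z"
  using Zmult by (simp add: mult.commute)

lemma Rdiff: "a \<in> R \<Longrightarrow> b \<in> R \<Longrightarrow> a - b \<in> R"
  using Radd[OF _ Rminus] by fastforce

lemma Rsum: "(\<And>x. x \<in> S \<Longrightarrow> f x \<in> R) \<Longrightarrow> sum f S \<in> R"
  by (induction S rule: infinite_finite_induct) (auto simp: R0 Radd)

lemma Zsum: "(\<And>x. x \<in> S \<Longrightarrow> f x \<in> Z) \<Longrightarrow> sum f S \<in> Z"
  by (induction S rule: infinite_finite_induct) (auto simp: Z0 Zadd)

lemma Zsum_diff: "(\<And>x. x \<in> S \<Longrightarrow> f x - g x \<in> Z) \<Longrightarrow> sum f S - sum g S \<in> Z"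
  unfolding sum_subtractf[symmetric] by (rule Zsum)

lemma Ztrans: "a - b \<in> Z \<Longrightarrow> b - c \<in> Z \<Longrightarrow> a - c \<in> Z"
  using Zadd[of "a - b" "b - c"] by simp

text \<open>\<open>Y\<close> is a smallest set of columns that generates all columns modulo
  \<open>Z\<close> with coefficients in \<open>R\<close>. A relation with an invertible coefficient
  would express one column by the others and allow a smaller set.\<close>

lemma irredundant_columns:
  fixes N :: "'i \<Rightarrow> 'j \<Rightarrow> 'f"
  assumes "finite J"
  obtains Y M where "Y \<subseteq> J" "\<And>y j. y \<in> Y \<Longrightarrow> j \<in> J \<Longrightarrow> M y j \<in> R"
    "\<And>i j. i \<in> I \<Longrightarrow> j \<in> J \<Longrightarrow> N i j - (\<Sum>y\<in>Y. N i y * M y j) \<in> Z"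
    "\<And>q y. (\<And>y. y \<in> Y \<Longrightarrow> q y \<in> R) \<Longrightarrow> (\<And>i. i \<in> I \<Longrightarrow> (\<Sum>y\<in>Y. N i y * q y) \<in> Z) \<Longrightarrow>
       y \<in> Y \<Longrightarrow> q y \<noteq> 0 \<Longrightarrow> inverse (q y) \<notin> R"
proof -
  define gen where "gen Y M \<longleftrightarrow> Y \<subseteq> J \<and> (\<forall>y\<in>Y. \<forall>j\<in>J. M y j \<in> R) \<and>
    (\<forall>i\<in>I. \<forall>j\<in>J. N i j - (\<Sum>y\<in>Y. N i y * M y j) \<in> Z)" for Y M
  have "gen J (\<lambda>y j. of_bool (y = j))"
    unfolding gen_def using assms by (auto simp: R0 R1 Z0 of_bool_def if_distrib cong: if_cong)
  then have "\<exists>Y. \<exists>M. gen Y M" by blast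
  then obtain Y where Y: "\<exists>M. gen Y M" and min: "\<And>Y'. \<exists>M. gen Y' M \<Longrightarrow> card Y \<le> card Y'"
    using ex_has_least_nat[of "\<lambda>Y. \<exists>M. gen Y M" _ card] by blast
  from Y obtain M where M: "gen Y M" by blast
  have fY: "finite Y" using M assms finite_subset unfolding gen_def by blast
  have "inverse (q y0) \<notin> R" if q: "\<And>y. y \<in> Y \<Longrightarrow> q y \<in> R"
    "\<And>i. i \<in> I \<Longrightarrow> (\<Sum>y\<in>Y. N i y * q y) \<in> Z" and y0: "y0 \<in> Y" "q y0 \<noteq> 0" for q y0
  proof
    assume inv: "inverse (q y0) \<in> R"
    define M' where "M' = (\<lambda>y j. M y j - q y * inverse (q y0) * M y0 j)"
    have "N i j - (\<Sum>y\<in>Y - {y0}. N i y * M' y j) \<in> Z" if ij: "i \<in> I" "j \<in> J" for i j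
    proof -
      let ?c = "inverse (q y0) * M y0 j"
      have "(\<Sum>y\<in>Y - {y0}. N i y * M' y j) = (\<Sum>y\<in>Y. N i y * M' y j)"
        using y0 fY by (subst sum.remove[of Y y0]) (auto simp: M'_def)
      also have "\<dots> = (\<Sum>y\<in>Y. N i y * M y j - ?c * (N i y * q y))"
        by (rule sum.cong) (auto simp: M'_def algebra_simps)
      also have "\<dots> = (\<Sum>y\<in>Y. N i y * M y j) - ?c * (\<Sum>y\<in>Y. N i y * q y)"
        by (simp add: sum_subtractf sum_distrib_left)
      finally have "N i j - (\<Sum>y\<in>Y - {y0}. N i y * M' y j) =
        (N i j - (\<Sum>y\<in>Y. N i y * M y j)) + ?c * (\<Sum>y\<in>Y. N i y * q y)" by simp
      moreover have "?c \<in> R" using M y0 ij inv by (auto simp: gen_def intro: Rmult)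
      moreover have "N i j - (\<Sum>y\<in>Y. N i y * M y j) \<in> Z" using M ij by (auto simp: gen_def)
      ultimately show ?thesis using Zadd Zmult q(2)[OF ij(1)] by presburger
    qed
    moreover have "M' y j \<in> R" if "y \<in> Y" "j \<in> J" for y j
      using M that y0 inv q(1) unfolding M'_def gen_def by (auto intro!: Rdiff Rmult)
    ultimately have "gen (Y - {y0}) M'" using M unfolding gen_def by auto
    then have "card Y \<le> card (Y - {y0})" using min by blast
    then show False using fY y0 by (metis card_Diff1_less not_less)
  qed
  then show ?thesis using that[of Y M] M unfolding gen_def by blast
qed

text \<open>Independence allows cancelling the columns \<open>Y\<close> of \<open>E\<close> on the
  left. From \<open>E E \<equiv> E\<close> this gives \<open>M E \<equiv> M\<close>, and from
  \<open>E \<equiv> E M\<close> at the columns in \<open>Y\<close> it gives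
  \<open>M \<equiv> I\<close> there. The trace of \<open>E M\<close> is that of \<open>M E\<close>
  on \<open>Y\<close>, hence the rank.\<close>

lemma idempotent_columns:
  fixes E :: "'j \<Rightarrow> 'j \<Rightarrow> 'f"
  assumes fin: "finite J" and ER: "\<And>x y. x \<in> J \<Longrightarrow> y \<in> J \<Longrightarrow> E x y \<in> R"
    and idem: "\<And>x y. x \<in> J \<Longrightarrow> y \<in> J \<Longrightarrow> mmul J E E x y - E x y \<in> Z"
    and sub: "Y \<subseteq> J" and MR: "\<And>y j. y \<in> Y \<Longrightarrow> j \<in> J \<Longrightarrow> M y j \<in> R"
    and EM: "\<And>x z. x \<in> J \<Longrightarrow> z \<in> J \<Longrightarrow> E x z - mmul Y E M x z \<in> Z"
    and ind: "\<forall>q. (\<forall>y\<in>Y. q y \<in> R) \<longrightarrow> (\<forall>i\<in>J. (\<Sum>y\<in>Y. E i y * q y) \<in> Z) \<longrightarrow> (\<forall>y\<in>Y. q y \<in> Z)"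
  shows "\<And>y z. y \<in> Y \<Longrightarrow> z \<in> J \<Longrightarrow> mmul J M E y z - M y z \<in> Z"
    and "\<And>y z. y \<in> Y \<Longrightarrow> z \<in> Y \<Longrightarrow> M y z - of_bool (y = z) \<in> Z"
    and "mtrace J E - of_nat (card Y) \<in> Z"
    and "\<And>x y. Y = J \<Longrightarrow> x \<in> J \<Longrightarrow> y \<in> J \<Longrightarrow> E x y - of_bool (x = y) \<in> Z"
proof -
  have fY: "finite Y" using sub fin finite_subset by blast
  have indep: "q y \<in> Z" if "\<And>y. y \<in> Y \<Longrightarrow> q y \<in> R" "\<And>i. i \<in> J \<Longrightarrow> (\<Sum>y\<in>Y. E i y * q y) \<in> Z" "y \<in> Y" for q y
    using ind that by blast
  have MER: "mmul J M E y z \<in> R" if "y \<in> Y" "z \<in> J" for y z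
    unfolding mmul_def using that MR ER by (auto intro!: Rsum Rmult)
  show ME: "mmul J M E y z - M y z \<in> Z" if "y \<in> Y" "z \<in> J" for y z
  proof (rule indep[of "\<lambda>y. mmul J M E y z - M y z", OF _ _ that(1)])
    show "mmul J M E y z - M y z \<in> R" if "y \<in> Y" for y
      using MER MR that \<open>z \<in> J\<close> by (auto intro: Rdiff)
    fix i assume i: "i \<in> J"
    have "(\<Sum>y\<in>Y. E i y * (mmul J M E y z - M y z)) = mmul Y E (mmul J M E) i z - mmul Y E M i z"
      by (simp add: mmul_def[of Y] right_diff_distrib sum_subtractf)
    moreover have "mmul Y E (mmul J M E) i z - mmul J E E i z \<in> Z"
    proof -
      have "mmul J (mmul Y E M) E i z - mmul J E E i z \<in> Z"
        unfolding mmul_def[of J]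
      proof (rule Zsum_diff)
        fix x assume x: "x \<in> J"
        have "mmul Y E M i x - E i x \<in> Z" using Zminus[OF EM[OF i x]] by simp
        then show "mmul Y E M i x * E x z - E i x * E x z \<in> Z"
          using Zmult2 ER[OF x that(2)] by (simp flip: left_diff_distrib)
      qed
      then show ?thesis by (simp add: mmul_assoc)
    qed
    ultimately show "(\<Sum>y\<in>Y. E i y * (mmul J M E y z - M y z)) \<in> Z"
      using Ztrans[OF Ztrans] idem[OF i that(2)] EM[OF i that(2)] by metis
  qed
  show Mid: "M y z - of_bool (y = z) \<in> Z" if "y \<in> Y" "z \<in> Y" for y z
  proof (rule indep[of "\<lambda>y. M y z - of_bool (y = z)", OF _ _ that(1)])
    show "M y z - of_bool (y = z) \<in> R" if "y \<in> Y" for y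
      using that \<open>z \<in> Y\<close> sub MR R0 R1 by (auto intro!: Rdiff)
    fix i assume i: "i \<in> J"
    have "(\<Sum>y\<in>Y. E i y * of_bool (y = z)) = (\<Sum>y\<in>Y. if y = z then E i y else 0)"
      by (rule sum.cong) auto
    also have "\<dots> = E i z" using fY that by simp
    finally show "(\<Sum>y\<in>Y. E i y * (M y z - of_bool (y = z))) \<in> Z"
      using Zminus[OF EM[of i z]] i that sub by (auto simp: mmul_def right_diff_distrib sum_subtractf subset_iff)
  qed
  have MEY: "mmul J M E y z - of_bool (y = z) \<in> Z" if "y \<in> Y" "z \<in> Y" for y z
    by (rule Ztrans[OF ME Mid]) (use that sub in auto)
  have "mtrace J E - mtrace J (mmul Y E M) \<in> Z"
    unfolding mtrace_def by (rule Zsum_diff) (auto simp: EM)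
  moreover have "mtrace Y (mmul J M E) - (\<Sum>y\<in>Y. 1) \<in> Z"
    unfolding mtrace_def by (rule Zsum_diff) (use MEY in force)
  ultimately show "mtrace J E - of_nat (card Y) \<in> Z"
    using Ztrans by (simp add: mtrace_mmul_commute[of J Y])
  show "E x y - of_bool (x = y) \<in> Z" if YJ: "Y = J" and xy: "x \<in> J" "y \<in> J" for x y
  proof -
    have "mmul J M E x y - (\<Sum>j\<in>J. of_bool (x = j) * E j y) \<in> Z"
      unfolding mmul_def
    proof (rule Zsum_diff)
      fix j assume j: "j \<in> J"
      show "M x j * E j y - of_bool (x = j) * E j y \<in> Z"
        using Zmult2[OF Mid[of x j] ER[OF j xy(2)]] YJ xy j by (simp add: left_diff_distrib)
    qed
    moreover have "(\<Sum>j\<in>J. of_bool (x = j) * E j y) = (\<Sum>j\<in>J. if x = j then E j y else 0)"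
      by (rule sum.cong) auto
    ultimately have "mmul J M E x y - E x y \<in> Z" using fin xy by simp
    from Zminus[OF this] have "E x y - mmul J M E x y \<in> Z" by simp
    then show ?thesis using Ztrans MEY xy YJ by blast
  qed
qed

end

section \<open>Valuation rings: independence over the field with coefficients kept in the
  ring\<close>

locale valuation_ring = coeff_ring R "{0}" for R :: "'f::field set" +
  assumes val: "x \<in> R \<or> inverse x \<in> R"
begin

lemma finite_has_dominating:
  assumes "finite S" "S \<noteq> {}" "0 \<notin> S"
  shows "\<exists>a\<in>S. \<forall>b\<in>S. b * inverse a \<in> R"
  using assms
proof (induction S rule: finite_ne_induct)
  case (singleton x)
  then show ?case using R1 by auto
next
  case (insert x S)
  then obtain a where a: "a \<in> S" "\<forall>b\<in>S. b * inverse a \<in> R" by auto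
  then have a0: "a \<noteq> 0" and x0: "x \<noteq> 0" using insert by auto
  show ?case
  proof (cases "x * inverse a \<in> R")
    case True
    then show ?thesis using a by auto
  next
    case False
    then have *: "a * inverse x \<in> R" using val[of "x * inverse a"] by (simp add: mult.commute)
    have "b * inverse x \<in> R" if "b \<in> S" for b
      using Rmult[OF _ *, of "b * inverse a"] a that a0 by (simp add: field_simps)
    then show ?thesis using x0 R1 by auto
  qed
qed

text \<open>Dividing a linear dependence by a dominating coefficient moves all coefficients into
  \<open>R\<close> and makes one of them 1, against irredundancy. So the columns are independent
  over the whole field although \<open>M\<close> stays in \<open>R\<close>.\<close>

lemma independent_columns:
  fixes N :: "'i \<Rightarrow> 'j \<Rightarrow> 'f"
  assumes "finite J"
  obtains Y M where "Y \<subseteq> J" "\<And>y j. y \<in> Y \<Longrightarrow> j \<in> J \<Longrightarrow> M y j \<in> R"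
    "\<And>i j. i \<in> I \<Longrightarrow> j \<in> J \<Longrightarrow> N i j = (\<Sum>y\<in>Y. N i y * M y j)"
    "\<And>q y. (\<And>i. i \<in> I \<Longrightarrow> (\<Sum>y\<in>Y. N i y * q y) = 0) \<Longrightarrow> y \<in> Y \<Longrightarrow> q y = 0"
proof -
  obtain Y M where Y: "Y \<subseteq> J" "\<And>y j. y \<in> Y \<Longrightarrow> j \<in> J \<Longrightarrow> M y j \<in> R"
    "\<And>i j. i \<in> I \<Longrightarrow> j \<in> J \<Longrightarrow> N i j - (\<Sum>y\<in>Y. N i y * M y j) \<in> {0}"
    "\<And>q y. (\<And>y. y \<in> Y \<Longrightarrow> q y \<in> R) \<Longrightarrow> (\<And>i. i \<in> I \<Longrightarrow> (\<Sum>y\<in>Y. N i y * q y) \<in> {0}) \<Longrightarrow>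
       y \<in> Y \<Longrightarrow> q y \<noteq> 0 \<Longrightarrow> inverse (q y) \<notin> R"
    using irredundant_columns[OF assms, of I N] by blast
  have "q y = 0" if q: "\<And>i. i \<in> I \<Longrightarrow> (\<Sum>y\<in>Y. N i y * q y) = 0" and y: "y \<in> Y" for q y
  proof (rule ccontr)
    assume "q y \<noteq> 0"
    define S where "S = q ` Y - {0}"
    have "finite S" "S \<noteq> {}" "0 \<notin> S"
      using \<open>q y \<noteq> 0\<close> y finite_subset[OF Y(1) assms] by (auto simp: S_def)
    then obtain a where a: "a \<in> S" "\<forall>b\<in>S. b * inverse a \<in> R" using finite_has_dominating by blast
    then obtain y0 where y0: "y0 \<in> Y" "a = q y0" "a \<noteq> 0" by (auto simp: S_def)
    define r where "r = (\<lambda>y. q y * inverse a)"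
    have "r y \<in> R" if "y \<in> Y" for y
      using a that R0 by (cases "q y = 0") (auto simp: r_def S_def)
    moreover have "(\<Sum>y\<in>Y. N i y * r y) \<in> {0}" if "i \<in> I" for i
    proof -
      have "(\<Sum>y\<in>Y. N i y * r y) = (\<Sum>y\<in>Y. N i y * q y) * inverse a"
        by (simp add: r_def sum_distrib_right mult.assoc)
      then show ?thesis using q[OF that] by simp
    qed
    ultimately have "inverse (r y0) \<notin> R" using Y(4)[of r y0] y0 by (auto simp: r_def)
    then show False using y0 R1 by (simp add: r_def)
  qed
  then show ?thesis using that[of Y M] Y by auto
qed

lemma idempotent_factorization:
  fixes e :: "'j \<Rightarrow> 'j \<Rightarrow> 'f"
  assumes fin: "finite J" and idem: "\<And>x y. x \<in> J \<Longrightarrow> y \<in> J \<Longrightarrow> mmul J e e x y = e x y"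
  obtains Y M where "Y \<subseteq> J" "\<And>y j. y \<in> Y \<Longrightarrow> j \<in> J \<Longrightarrow> M y j \<in> R"
    "\<And>x z. x \<in> J \<Longrightarrow> z \<in> J \<Longrightarrow> e x z = mmul Y e M x z"
    "\<And>y z. y \<in> Y \<Longrightarrow> z \<in> J \<Longrightarrow> mmul J M e y z = M y z"
    "\<And>y z. y \<in> Y \<Longrightarrow> z \<in> Y \<Longrightarrow> M y z = of_bool (y = z)"
    "mtrace J e = of_nat (card Y)"
    "\<And>x y. Y = J \<Longrightarrow> x \<in> J \<Longrightarrow> y \<in> J \<Longrightarrow> e x y = of_bool (x = y)"
proof -
  obtain Y M where Y: "Y \<subseteq> J" "\<And>y j. y \<in> Y \<Longrightarrow> j \<in> J \<Longrightarrow> M y j \<in> R"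
    "\<And>i j. i \<in> J \<Longrightarrow> j \<in> J \<Longrightarrow> e i j = (\<Sum>y\<in>Y. e i y * M y j)"
    "\<And>q y. (\<And>i. i \<in> J \<Longrightarrow> (\<Sum>y\<in>Y. e i y * q y) = 0) \<Longrightarrow> y \<in> Y \<Longrightarrow> q y = 0"
    using independent_columns[OF fin, of J e] by blast
  \<comment> \<open>The entries of \<open>e\<close> need not lie in \<open>R\<close>, so the
    cancellation is done over the full field; only \<open>M\<close> is known to be in
    \<open>R\<close>.\<close>
  interpret U: coeff_ring "UNIV :: 'f set" "{0}" by unfold_locales auto
  have eM: "e x z - mmul Y e M x z \<in> {0}" if "x \<in> J" "z \<in> J" for x z
    using Y(3)[OF that] by (simp add: mmul_def)
  have id: "mmul J e e x y - e x y \<in> {0}" if "x \<in> J" "y \<in> J" for x y using idem[OF that] by simp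
  have ind: "\<forall>q. (\<forall>y\<in>Y. q y \<in> UNIV) \<longrightarrow> (\<forall>i\<in>J. (\<Sum>y\<in>Y. e i y * q y) \<in> {0}) \<longrightarrow> (\<forall>y\<in>Y. q y \<in> {0})"
    using Y(4) by blast
  note cols = U.idempotent_columns[where E = e and Y = Y and M = M, OF fin UNIV_I id Y(1) UNIV_I eM ind]
  show ?thesis
    by (rule that[OF Y(1,2)]) (use eM cols in auto)
qed

end

text \<open>Ordinary linear algebra: the trace of an idempotent is a natural number, at most the
  size of the index set.\<close>

interpretation field_val: valuation_ring "UNIV :: 'f::field set"
  by unfold_locales auto

text \<open>The ideal \<open>Z\<close> consists of the nonunits of \<open>R\<close>, so congruence modulo \<open>Z\<close> behaves like
  equality in the residue field.\<close>

locale local_ring = coeff_ring R Z for R Z :: "'f::field set" +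
  assumes ZR: "Z \<subseteq> R" and unit: "x \<in> R \<Longrightarrow> x \<notin> Z \<Longrightarrow> inverse x \<in> R" and Z1: "1 \<notin> Z"
begin

lemma independent_columns_mod:
  fixes N :: "'i \<Rightarrow> 'j \<Rightarrow> 'f"
  assumes "finite J"
  obtains Y M where "Y \<subseteq> J" "\<And>y j. y \<in> Y \<Longrightarrow> j \<in> J \<Longrightarrow> M y j \<in> R"
    "\<And>i j. i \<in> I \<Longrightarrow> j \<in> J \<Longrightarrow> N i j - (\<Sum>y\<in>Y. N i y * M y j) \<in> Z"
    "\<And>q y. (\<And>y. y \<in> Y \<Longrightarrow> q y \<in> R) \<Longrightarrow> (\<And>i. i \<in> I \<Longrightarrow> (\<Sum>y\<in>Y. N i y * q y) \<in> Z) \<Longrightarrow>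
       y \<in> Y \<Longrightarrow> q y \<in> Z"
proof -
  obtain Y M where Y: "Y \<subseteq> J" "\<And>y j. y \<in> Y \<Longrightarrow> j \<in> J \<Longrightarrow> M y j \<in> R"
    "\<And>i j. i \<in> I \<Longrightarrow> j \<in> J \<Longrightarrow> N i j - (\<Sum>y\<in>Y. N i y * M y j) \<in> Z"
    "\<And>q y. (\<And>y. y \<in> Y \<Longrightarrow> q y \<in> R) \<Longrightarrow> (\<And>i. i \<in> I \<Longrightarrow> (\<Sum>y\<in>Y. N i y * q y) \<in> Z) \<Longrightarrow>
       y \<in> Y \<Longrightarrow> q y \<noteq> 0 \<Longrightarrow> inverse (q y) \<notin> R"
    using irredundant_columns[OF assms, of I N] by blast
  have "q y \<in> Z" if q: "\<And>y. y \<in> Y \<Longrightarrow> q y \<in> R" "\<And>i. i \<in> I \<Longrightarrow> (\<Sum>y\<in>Y. N i y * q y) \<in> Z"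
    and y: "y \<in> Y" for q y
    using Y(4)[OF q y] unit[OF q(1)[OF y]] Z0 by (cases "q y = 0") auto
  then show ?thesis using that[of Y M] Y by blast
qed

text \<open>Modulo \<open>Z\<close> the trace of an idempotent is still its rank
  \<open>card Y\<close>. The extreme ranks determine \<open>E\<close>, and these are the ranks that
  survive when the trace is divisible by the prime size of the index set.\<close>

lemma idempotent_mod_trace:
  fixes E :: "'j \<Rightarrow> 'j \<Rightarrow> 'f"
  assumes fin: "finite J" and ER: "\<And>x y. x \<in> J \<Longrightarrow> y \<in> J \<Longrightarrow> E x y \<in> R"
    and idem: "\<And>x y. x \<in> J \<Longrightarrow> y \<in> J \<Longrightarrow> mmul J E E x y - E x y \<in> Z"
  obtains Y where "Y \<subseteq> J" "mtrace J E - of_nat (card Y) \<in> Z"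
    "\<And>x y. Y = {} \<Longrightarrow> x \<in> J \<Longrightarrow> y \<in> J \<Longrightarrow> E x y \<in> Z"
    "\<And>x y. Y = J \<Longrightarrow> x \<in> J \<Longrightarrow> y \<in> J \<Longrightarrow> E x y - of_bool (x = y) \<in> Z"
proof -
  obtain Y M where Y: "Y \<subseteq> J" "\<And>y j. y \<in> Y \<Longrightarrow> j \<in> J \<Longrightarrow> M y j \<in> R"
    "\<And>i j. i \<in> J \<Longrightarrow> j \<in> J \<Longrightarrow> E i j - (\<Sum>y\<in>Y. E i y * M y j) \<in> Z"
    "\<And>q y. (\<And>y. y \<in> Y \<Longrightarrow> q y \<in> R) \<Longrightarrow> (\<And>i. i \<in> J \<Longrightarrow> (\<Sum>y\<in>Y. E i y * q y) \<in> Z) \<Longrightarrow>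
       y \<in> Y \<Longrightarrow> q y \<in> Z"
    using independent_columns_mod[OF fin, of J E] by blast
  have EM: "E x z - mmul Y E M x z \<in> Z" if "x \<in> J" "z \<in> J" for x z
    using Y(3)[OF that] by (simp add: mmul_def)
  have ind: "\<forall>q. (\<forall>y\<in>Y. q y \<in> R) \<longrightarrow> (\<forall>i\<in>J. (\<Sum>y\<in>Y. E i y * q y) \<in> Z) \<longrightarrow> (\<forall>y\<in>Y. q y \<in> Z)"
    using Y(4) by blast
  note cols = idempotent_columns[where E = E and Y = Y and M = M, OF fin ER idem Y(1,2) EM ind]
  show ?thesis
  proof (rule that[OF Y(1) cols(3)])
    show "E x y \<in> Z" if "Y = {}" "x \<in> J" "y \<in> J" for x y
      using EM[OF that(2,3)] that(1) by (simp add: mmul_def)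
  qed (use cols(4) in auto)
qed

text \<open>Induction on the size: \<open>N \<equiv> N M\<close> with \<open>N\<close> on the right
  cut down to the columns \<open>Y\<close>, and \<open>M N\<close> on \<open>Y\<close> has the same
  trace and is again nilpotent modulo \<open>Z\<close>. The set \<open>Y\<close> is smaller than
  \<open>J\<close>, because an invertible \<open>N\<close> cannot be nilpotent.\<close>

lemma nilpotent_mod_trace:
  fixes N :: "'j \<Rightarrow> 'j \<Rightarrow> 'f"
  assumes "finite J" "\<And>x y. x \<in> J \<Longrightarrow> y \<in> J \<Longrightarrow> N x y \<in> R"
    "\<And>x y. x \<in> J \<Longrightarrow> y \<in> J \<Longrightarrow> mpow J N n x y \<in> Z"
  shows "mtrace J N \<in> Z"
  using assms
proof (induction "card J" arbitrary: J N n rule: less_induct)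
  case less
  note fin = less.prems(1) and NR = less.prems(2)
  obtain Y M where Y: "Y \<subseteq> J" "\<And>y j. y \<in> Y \<Longrightarrow> j \<in> J \<Longrightarrow> M y j \<in> R"
    "\<And>i j. i \<in> J \<Longrightarrow> j \<in> J \<Longrightarrow> N i j - (\<Sum>y\<in>Y. N i y * M y j) \<in> Z"
    "\<And>q y. (\<And>y. y \<in> Y \<Longrightarrow> q y \<in> R) \<Longrightarrow> (\<And>i. i \<in> J \<Longrightarrow> (\<Sum>y\<in>Y. N i y * q y) \<in> Z) \<Longrightarrow>
       y \<in> Y \<Longrightarrow> q y \<in> Z"
    using independent_columns_mod[OF fin, of J N] by blast
  have fY: "finite Y" using Y(1) fin finite_subset by blast
  have NM: "N x z - mmul Y N M x z \<in> Z" if "x \<in> J" "z \<in> J" for x z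
    using Y(3)[OF that] by (simp add: mmul_def)
  have powR: "mpow J N i x y \<in> R" if "x \<in> J" "y \<in> J" for i x y
    using that by (induction i arbitrary: x) (auto simp: mid_def R0 R1 mmul_def NR intro!: Rsum Rmult)
  show ?case
  proof (cases "J = {}")
    case True
    then show ?thesis by (simp add: mtrace_def Z0)
  next
    case False
    have "Y \<noteq> J"
    proof
      assume YJ: "Y = J"
      \<comment> \<open>If all columns were independent, \<open>N\<close> could be cancelled from
        \<open>N^(i+1)\<close>, descending from the vanishing power to the identity.\<close>
      have "\<forall>x\<in>J. \<forall>y\<in>J. mpow J N i x y \<in> Z" if "i \<le> n" for i
        using that
      proof (induction rule: inc_induct)
        case base
        then show ?case using less.prems(3) by blast
      next
        case (step i)
        have "mpow J N i x y \<in> Z" if "x \<in> J" "y \<in> J" for x y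
        proof (rule Y(4)[of "\<lambda>w. mpow J N i w y"])
          show "x \<in> Y" "\<And>w. w \<in> Y \<Longrightarrow> mpow J N i w y \<in> R" using powR that YJ by auto
          fix u assume "u \<in> J"
          then show "(\<Sum>w\<in>Y. N u w * mpow J N i w y) \<in> Z"
            using step that YJ by (simp add: mmul_def)
        qed
        then show ?case by blast
      qed
      from False obtain x where "x \<in> J" by blast
      with \<open>\<And>i. i \<le> n \<Longrightarrow> \<forall>x\<in>J. \<forall>y\<in>J. mpow J N i x y \<in> Z\<close>[of 0] Z1
      show False by (force simp: mid_def)
    qed
    then have sm: "card Y < card J" using Y(1) fin by (simp add: psubsetI psubset_card_mono)
    define N' where "N' = mmul J M N"
    have N'R: "N' x y \<in> R" if "x \<in> Y" "y \<in> Y" for x y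
      unfolding N'_def mmul_def using that Y(1,2) NR by (auto intro!: Rsum Rmult)
    have N'powR: "mpow Y N' i x y \<in> R" if "x \<in> Y" "y \<in> Y" for i x y
      using that by (induction i arbitrary: x) (auto simp: mid_def R0 R1 mmul_def N'R intro!: Rsum Rmult)
    \<comment> \<open>With \<open>N\<close> cut down to the columns in \<open>Y\<close>, this is
      \<open>N (M N)^i \<equiv> (N M)^i N \<equiv> N^(i+1)\<close>.\<close>
    have key: "mmul Y N (mpow Y N' i) x y - mpow J N (Suc i) x y \<in> Z" if "x \<in> J" "y \<in> Y" for i x y
      using that(1)
    proof (induction i arbitrary: x)
      case 0
      have "mmul Y N (mid Y) x y = N x y"
        using mmul_mid_right[of Y y "\<lambda>a b. if b \<in> Y then N a b else 0" x] fY that(2)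
        by (simp add: mmul_def)
      moreover have "mmul J N (mid J) x y = N x y"
        using mmul_mid_right[of J y "\<lambda>a b. if b \<in> J then N a b else 0" x] fin that(2) Y(1)
        by (auto simp: mmul_def)
      ultimately show ?case by (simp add: Z0)
    next
      case (Suc i)
      have "mmul Y N (mpow Y N' (Suc i)) x y = mmul J (mmul Y N M) (mmul Y N (mpow Y N' i)) x y"
        by (simp add: N'_def mmul_assoc)
      moreover have "mmul J (mmul Y N M) (mmul Y N (mpow Y N' i)) x y
          - mmul J N (mmul Y N (mpow Y N' i)) x y \<in> Z"
        unfolding mmul_def[of J]
      proof (rule Zsum_diff)
        fix j assume j: "j \<in> J"
        have "mmul Y N (mpow Y N' i) j y \<in> R"
          unfolding mmul_def using j that(2) Y(1) NR N'powR by (auto intro!: Rsum Rmult)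
        moreover have "mmul Y N M x j - N x j \<in> Z" using Zminus[OF NM[OF Suc.prems j]] by simp
        ultimately show "mmul Y N M x j * mmul Y N (mpow Y N' i) j y - N x j * mmul Y N (mpow Y N' i) j y \<in> Z"
          using Zmult2 by (simp flip: left_diff_distrib)
      qed
      moreover have "mmul J N (mmul Y N (mpow Y N' i)) x y - mmul J N (mpow J N (Suc i)) x y \<in> Z"
        unfolding mmul_def[of J N]
      proof (rule Zsum_diff)
        fix j assume j: "j \<in> J"
        from Zmult[OF NR[OF Suc.prems j] Suc.IH[OF j]]
        show "N x j * mmul Y N (mpow Y N' i) j y - N x j * mpow J N (Suc i) j y \<in> Z"
          by (simp only: right_diff_distrib)
      qed
      ultimately show ?case using Ztrans by (metis mpow.simps(2))
    qed
    have big: "mpow J N (Suc n) x y \<in> Z" if "x \<in> J" "y \<in> J" for x y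
      using less.prems(3) NR that by (auto simp: mmul_def intro!: Zsum Zmult)
    have "mpow Y N' (Suc n) x y \<in> Z" if "x \<in> Y" "y \<in> Y" for x y
    proof -
      have "mpow Y N' (Suc n) x y = mmul J M (mmul Y N (mpow Y N' n)) x y"
        by (simp add: N'_def mmul_assoc)
      also have "\<dots> \<in> Z" unfolding mmul_def[of J]
      proof (rule Zsum)
        fix j assume j: "j \<in> J"
        have "mmul Y N (mpow Y N' n) j y \<in> Z"
          using Zadd[OF key[OF j that(2), of n] big[OF j, of y]] that(2) Y(1) by auto
        then show "M x j * mmul Y N (mpow Y N' n) j y \<in> Z" using Zmult Y(2)[OF that(1) j] by blast
      qed
      finally show ?thesis .
    qed
    then have "mtrace Y N' \<in> Z" using less.hyps[OF sm fY, of N' "Suc n"] N'R by blast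
    moreover have "mtrace J N - mtrace J (mmul Y N M) \<in> Z"
      unfolding mtrace_def by (rule Zsum_diff) (auto simp: NM)
    ultimately have "(mtrace J N - mtrace Y N') + mtrace Y N' \<in> Z"
      unfolding N'_def by (intro Zadd) (simp_all add: mtrace_mmul_commute[of J Y])
    then show ?thesis by simp
  qed
qed

end

section \<open>Rationals localized at a prime\<close>

definition ploc :: "nat \<Rightarrow> rat set" where
  "ploc p = {x. \<exists>a b. \<not> int p dvd b \<and> x = of_int a / of_int b}"

definition pmax :: "nat \<Rightarrow> rat set" where
  "pmax p = (\<lambda>x. of_nat p * x) ` ploc p"

lemma plocI: "\<not> int p dvd b \<Longrightarrow> x = of_int a / of_int b \<Longrightarrow> x \<in> ploc p"
  unfolding ploc_def by blast

lemma ploc_of_int: "p \<noteq> 1 \<Longrightarrow> of_int n \<in> ploc p"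
  by (rule plocI[of p 1 _ n]) auto

lemma coeff_ring_ploc:
  assumes p: "prime p"
  shows "coeff_ring (ploc p) (pmax p)" "coeff_ring (ploc p) {0}"
proof -
  have int_prime: "prime (int p)" using p by simp
  have p1: "p \<noteq> 1" using p by auto
  have add: "x + y \<in> ploc p" if xy: "x \<in> ploc p" "y \<in> ploc p" for x y
  proof -
    obtain a b where x: "\<not> int p dvd b" "x = of_int a / of_int b" using xy(1) unfolding ploc_def by blast
    obtain c d where y: "\<not> int p dvd d" "y = of_int c / of_int d" using xy(2) unfolding ploc_def by blast
    have "b \<noteq> 0" "d \<noteq> 0" using x y by auto
    then have "x + y = of_int (a * d + c * b) / of_int (b * d)" using x y by (simp add: field_simps)
    then show ?thesis using plocI x y int_prime prime_dvd_mult_iff by blast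
  qed
  have mult: "x * y \<in> ploc p" if xy: "x \<in> ploc p" "y \<in> ploc p" for x y
  proof -
    obtain a b where x: "\<not> int p dvd b" "x = of_int a / of_int b" using xy(1) unfolding ploc_def by blast
    obtain c d where y: "\<not> int p dvd d" "y = of_int c / of_int d" using xy(2) unfolding ploc_def by blast
    have "x * y = of_int (a * c) / of_int (b * d)" using x y by simp
    then show ?thesis using plocI x y int_prime prime_dvd_mult_iff by blast
  qed
  have minus: "- x \<in> ploc p" if "x \<in> ploc p" for x
    using mult[OF ploc_of_int[OF p1, of "-1"] that] by simp
  have zo: "0 \<in> ploc p" "1 \<in> ploc p" using ploc_of_int[OF p1, of 0] ploc_of_int[OF p1, of 1] by auto
  show "coeff_ring (ploc p) {0}" by unfold_locales (use add mult minus zo in auto)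
  show "coeff_ring (ploc p) (pmax p)"
  proof unfold_locales
    fix a b assume "a \<in> pmax p" "b \<in> pmax p"
    then obtain c d where "a = of_nat p * c" "b = of_nat p * d" "c \<in> ploc p" "d \<in> ploc p"
      by (auto simp: pmax_def)
    then show "a + b \<in> pmax p" using add[of c d] by (auto simp: pmax_def simp flip: distrib_left)
  next
    fix a b assume "a \<in> ploc p" "b \<in> pmax p"
    then obtain d where "b = of_nat p * d" "d \<in> ploc p" by (auto simp: pmax_def)
    then show "a * b \<in> pmax p" using mult[OF \<open>a \<in> ploc p\<close>, of d]
      unfolding pmax_def by (intro image_eqI[of _ _ "a * d"]) auto
  qed (use add mult minus zo in \<open>auto simp: pmax_def\<close>)
qed

lemma valuation_ring_ploc:
  assumes p: "prime p"
  shows "valuation_ring (ploc p)"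
proof -
  interpret coeff_ring "ploc p" "{0}" by (rule coeff_ring_ploc(2)[OF p])
  show ?thesis
  proof
    fix x :: rat
    obtain a b where ab: "quotient_of x = (a, b)" by fastforce
    have x: "x = of_int a / of_int b" and cop: "coprime a b" using ab
      by (auto simp: quotient_of_div quotient_of_coprime)
    show "x \<in> ploc p \<or> inverse x \<in> ploc p"
    proof (cases "int p dvd b")
      case True
      have "\<not> int p dvd a"
      proof
        assume "int p dvd a"
        then have "is_unit (int p)" using coprime_common_divisor[OF cop _ True] by blast
        moreover have "prime (int p)" using p by simp
        ultimately show False using not_prime_unit by blast
      qed
      moreover have "inverse x = of_int b / of_int a" using x by simp
      ultimately show ?thesis using plocI by blast
    next
      case False
      then show ?thesis using x plocI by blast
    qed
  qed
qed

lemma local_ring_ploc: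
  assumes p: "prime p"
  shows "local_ring (ploc p) (pmax p)"
proof -
  interpret coeff_ring "ploc p" "pmax p" by (rule coeff_ring_ploc(1)[OF p])
  have p1: "p \<noteq> 1" using p by auto
  have pR: "of_nat p \<in> ploc p" using ploc_of_int[OF p1, of "int p"] by simp
  show ?thesis
  proof
    show "pmax p \<subseteq> ploc p" using Rmult[OF pR] by (auto simp: pmax_def)
  next
    fix x assume x: "x \<in> ploc p" "x \<notin> pmax p"
    then obtain a b where ab: "\<not> int p dvd b" "x = of_int a / of_int b" by (auto simp: ploc_def)
    have "\<not> int p dvd a"
    proof
      assume "int p dvd a"
      then obtain c where "a = int p * c" by blast
      then have "x = of_nat p * (of_int c / of_int b)" using ab by simp
      then have "x \<in> pmax p" using plocI[OF ab(1)] unfolding pmax_def by blast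
      then show False using x by simp
    qed
    moreover have "inverse x = of_int b / of_int a" using ab by simp
    ultimately show "inverse x \<in> ploc p" using plocI by blast
  next
    show "1 \<notin> pmax p"
    proof
      assume "1 \<in> pmax p"
      then obtain a b where "\<not> int p dvd b" "(1::rat) = of_nat p * (of_int a / of_int b)"
        unfolding pmax_def ploc_def by blast
      moreover from this have "b \<noteq> 0" by auto
      ultimately have "(of_int b :: rat) = of_int (int p * a)" by (simp add: field_simps)
      then have "b = int p * a" using of_int_eq_iff by blast
      then show False using \<open>\<not> int p dvd b\<close> by simp
    qed
  qed
qed

lemma of_int_pmax_iff:
  assumes p: "prime p"
  shows "of_int n \<in> pmax p \<longleftrightarrow> int p dvd n"
proof
  interpret local_ring "ploc p" "pmax p" by (rule local_ring_ploc[OF p])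
  assume "of_int n \<in> pmax p"
  then obtain a b where ab: "\<not> int p dvd b" "of_int n = of_nat p * ((of_int a / of_int b) :: rat)"
    unfolding pmax_def ploc_def by blast
  then have "b \<noteq> 0" by auto
  then have "(of_int (n * b) :: rat) = of_int (int p * a)" using ab by (simp add: field_simps)
  then have "n * b = int p * a" using of_int_eq_iff by blast
  then have "int p dvd n * b" by simp
  then show "int p dvd n" using ab p by (simp add: prime_dvd_mult_iff)
next
  assume "int p dvd n"
  then obtain c where "n = int p * c" by blast
  then have "(of_int n :: rat) = of_nat p * of_int c" by simp
  moreover have "of_int c \<in> ploc p" using p by (intro ploc_of_int) auto
  ultimately show "of_int n \<in> pmax p" unfolding pmax_def by blast
qed

section \<open>Matrices constant on the basis relations\<close>

text \<open>Membership in the adjacency algebra, for values of any type. Boolean values are used as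
  well, to state that membership of an endpoint in a fiber depends only on the relation.\<close>

definition cst :: "('a \<times> 'a) set set \<Rightarrow> ('a \<Rightarrow> 'a \<Rightarrow> 'f) \<Rightarrow> bool" where
  "cst RR A \<longleftrightarrow> (\<forall>R\<in>RR. \<forall>u v u' v'. (u, v) \<in> R \<longrightarrow> (u', v') \<in> R \<longrightarrow> A u v = A u' v')"

definition adj :: "('a \<times> 'b) set \<Rightarrow> 'a \<Rightarrow> 'b \<Rightarrow> 'f::zero_neq_one" where
  "adj R = (\<lambda>u v. of_bool ((u, v) \<in> R))"

lemma cstD: "cst RR A \<Longrightarrow> R \<in> RR \<Longrightarrow> (u, v) \<in> R \<Longrightarrow> (u', v') \<in> R \<Longrightarrow> A u v = A u' v'"
  unfolding cst_def by blast

lemma cst_map2: "cst RR A \<Longrightarrow> cst RR B \<Longrightarrow> cst RR (\<lambda>u v. f (A u v) (B u v))"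
  unfolding cst_def[of _ "\<lambda>u v. f (A u v) (B u v)"]
  by (intro ballI allI impI arg_cong2[where f = f]) (erule (3) cstD)+

lemma cst_map: "cst RR A \<Longrightarrow> cst RR (\<lambda>u v. f (A u v))"
  unfolding cst_def[of _ "\<lambda>u v. f (A u v)"]
  by (intro ballI allI impI arg_cong[where f = f]) (erule (3) cstD)

lemma cst_const: "cst RR (\<lambda>u v. c)"
  unfolding cst_def by simp

lemma cst_sum: "(\<And>i. i \<in> I \<Longrightarrow> cst RR (A i)) \<Longrightarrow> cst RR (\<lambda>u v. \<Sum>i\<in>I. A i u v)"
  by (induction I rule: infinite_finite_induct) (auto simp: cst_const intro: cst_map2)

locale coherent =
  fixes V :: "'a set" and RR :: "('a \<times> 'a) set set"
  assumes cc: "coherent_configuration V RR"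
begin

lemma finite_V: "finite V" and rel_ne: "S \<in> RR \<Longrightarrow> S \<noteq> {}" and Union_RR: "\<Union>RR = V \<times> V"
  and conv_RR: "S \<in> RR \<Longrightarrow> converse S \<in> RR"
  using cc unfolding coherent_configuration_def by auto

lemma rel_unique: "S \<in> RR \<Longrightarrow> T \<in> RR \<Longrightarrow> (u, v) \<in> S \<Longrightarrow> (u, v) \<in> T \<Longrightarrow> S = T"
proof -
  have "\<forall>S\<in>RR. \<forall>T\<in>RR. S \<noteq> T \<longrightarrow> S \<inter> T = {}"
    using cc unfolding coherent_configuration_def by (elim conjE)
  then show "S \<in> RR \<Longrightarrow> T \<in> RR \<Longrightarrow> (u, v) \<in> S \<Longrightarrow> (u, v) \<in> T \<Longrightarrow> S = T" by blast
qed

lemma rel_sub: "S \<in> RR \<Longrightarrow> S \<subseteq> V \<times> V" using Union_RR by blast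

lemma finite_RR: "finite RR"
  using finite_V Union_RR by (intro finite_UnionD) auto

lemma finite_rel: "S \<in> RR \<Longrightarrow> finite S"
  using rel_sub finite_V finite_subset by (metis finite_cartesian_product)

lemma rel_ex: "u \<in> V \<Longrightarrow> v \<in> V \<Longrightarrow> \<exists>S\<in>RR. (u, v) \<in> S"
  using Union_RR by blast

lemma intersection_number:
  assumes "S \<in> RR" "T \<in> RR" "U \<in> RR" "(u, v) \<in> U" "(u', v') \<in> U"
  shows "card {w. (u, w) \<in> S \<and> (w, v) \<in> T} = card {w. (u', w) \<in> S \<and> (w, v') \<in> T}"
proof -
  have "\<forall>S\<in>RR. \<forall>T\<in>RR. \<forall>U\<in>RR. \<exists>c::nat. \<forall>(u,v)\<in>U. card {w. (u,w) \<in> S \<and> (w,v) \<in> T} = c"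
    using cc unfolding coherent_configuration_def by (elim conjE)
  then obtain c where "\<forall>(u,v)\<in>U. card {w. (u,w) \<in> S \<and> (w,v) \<in> T} = c" using assms by blast
  then have "\<And>u v. (u, v) \<in> U \<Longrightarrow> card {w. (u,w) \<in> S \<and> (w,v) \<in> T} = c" by blast
  then show ?thesis using assms(4,5) by simp
qed

lemma cst_adj: "R \<in> RR \<Longrightarrow> cst RR (adj R)"
  unfolding cst_def adj_def
proof (intro ballI allI impI)
  fix S u v u' v' assume "R \<in> RR" "S \<in> RR" "(u, v) \<in> S" "(u', v') \<in> S"
  then have "(u, v) \<in> R \<longleftrightarrow> (u', v') \<in> R" using rel_unique by blast
  then show "(of_bool ((u, v) \<in> R) :: 'b) = of_bool ((u', v') \<in> R)" by simp
qed

text \<open>The form in which the third axiom is used: after expanding both factors in adjacency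
  matrices, the entries of the product are combinations of intersection numbers.\<close>

lemma cst_mmul_V:
  fixes A B :: "'a \<Rightarrow> 'a \<Rightarrow> 'f::comm_semiring_1"
  assumes A: "cst RR A" and B: "cst RR B"
  shows "cst RR (mmul V A B)"
proof -
  \<comment> \<open>The coefficient of \<open>adj S\<close> in \<open>A\<close>, read off at an
    arbitrary pair of \<open>S\<close>.\<close>
  define a where "a S = (case SOME x. x \<in> S of (u, v) \<Rightarrow> A u v)" for S
  define b where "b S = (case SOME x. x \<in> S of (u, v) \<Rightarrow> B u v)" for S
  have pick: "\<exists>u v. (u, v) \<in> S \<and> (SOME x. x \<in> S) = (u, v)" if "S \<in> RR" for S
    using rel_ne[OF that] by (metis some_in_eq surj_pair)
  have a: "a S = A u v" if "S \<in> RR" "(u, v) \<in> S" for S u v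
    using pick[OF that(1)] cstD[OF A that(1) _ that(2)] by (auto simp: a_def)
  have b: "b S = B u v" if "S \<in> RR" "(u, v) \<in> S" for S u v
    using pick[OF that(1)] cstD[OF B that(1) _ that(2)] by (auto simp: b_def)
  have expA: "A u w = (\<Sum>S\<in>RR. a S * of_bool ((u, w) \<in> S))" if uw: "u \<in> V" "w \<in> V" for u w
  proof -
    obtain S where S: "S \<in> RR" "(u, w) \<in> S" using rel_ex uw by blast
    have "(\<Sum>T\<in>RR. a T * of_bool ((u, w) \<in> T)) = (\<Sum>T\<in>RR. if T = S then a T else 0)"
      by (rule sum.cong) (use rel_unique S in auto)
    then show ?thesis using a S finite_RR by simp
  qed
  have expB: "B u w = (\<Sum>S\<in>RR. b S * of_bool ((u, w) \<in> S))" if uw: "u \<in> V" "w \<in> V" for u w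
  proof -
    obtain S where S: "S \<in> RR" "(u, w) \<in> S" using rel_ex uw by blast
    have "(\<Sum>T\<in>RR. b T * of_bool ((u, w) \<in> T)) = (\<Sum>T\<in>RR. if T = S then b T else 0)"
      by (rule sum.cong) (use rel_unique S in auto)
    then show ?thesis using b S finite_RR by simp
  qed
  have main: "mmul V A B u v = (\<Sum>S\<in>RR. \<Sum>T\<in>RR. a S * b T * of_nat (card {w. (u,w) \<in> S \<and> (w,v) \<in> T}))"
    if uv: "u \<in> V" "v \<in> V" for u v
  proof -
    have "mmul V A B u v = (\<Sum>w\<in>V. (\<Sum>S\<in>RR. a S * of_bool ((u, w) \<in> S)) * (\<Sum>T\<in>RR. b T * of_bool ((w, v) \<in> T)))"
      unfolding mmul_def by (rule sum.cong) (use expA expB uv in auto)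
    also have "\<dots> = (\<Sum>w\<in>V. \<Sum>S\<in>RR. \<Sum>T\<in>RR. a S * b T * of_bool ((u, w) \<in> S \<and> (w, v) \<in> T))"
      by (simp add: sum_product of_bool_conj mult_ac)
    also have "\<dots> = (\<Sum>S\<in>RR. \<Sum>T\<in>RR. \<Sum>w\<in>V. a S * b T * of_bool ((u, w) \<in> S \<and> (w, v) \<in> T))"
      by (subst sum.swap, rule sum.cong, simp, subst sum.swap, rule sum.cong) auto
    also have "\<dots> = (\<Sum>S\<in>RR. \<Sum>T\<in>RR. a S * b T * of_nat (card {w. (u,w) \<in> S \<and> (w,v) \<in> T}))"
    proof (intro sum.cong refl)
      fix S T assume ST: "S \<in> RR" "T \<in> RR"
      have "V \<inter> {w. (u, w) \<in> S \<and> (w, v) \<in> T} = {w. (u, w) \<in> S \<and> (w, v) \<in> T}"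
        using rel_sub ST by blast
      then show "(\<Sum>w\<in>V. a S * b T * of_bool ((u, w) \<in> S \<and> (w, v) \<in> T)) =
          a S * b T * of_nat (card {w. (u,w) \<in> S \<and> (w,v) \<in> T})"
        using finite_V by (simp add: sum_distrib_left[symmetric] flip: sum.inter_restrict)
    qed
    finally show ?thesis .
  qed
  show ?thesis unfolding cst_def
  proof (intro ballI allI impI)
    fix U u v u' v' assume U: "U \<in> RR" "(u, v) \<in> U" "(u', v') \<in> U"
    then have "u \<in> V" "v \<in> V" "u' \<in> V" "v' \<in> V" using rel_sub by blast+
    then show "mmul V A B u v = mmul V A B u' v'"
      by (simp only: main, intro sum.cong refl) (simp add: intersection_number[OF _ _ U])
  qed
qed

lemma cst_transpose: "cst RR A \<Longrightarrow> cst RR (\<lambda>u v. A v u)"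
  unfolding cst_def
proof (intro ballI allI impI)
  fix S u v u' v' assume *: "\<forall>R\<in>RR. \<forall>u v u' v'. (u, v) \<in> R \<longrightarrow> (u', v') \<in> R \<longrightarrow> A u v = A u' v'"
    and "S \<in> RR" "(u, v) \<in> S" "(u', v') \<in> S"
  then have "S\<inverse> \<in> RR" "(v, u) \<in> S\<inverse>" "(v', u') \<in> S\<inverse>" using conv_RR by auto
  then show "A v u = A v' u'" using * by blast
qed

text \<open>The intersection number of \<open>S\<close> with the diagonal of \<open>G\<close> is 1
  or 0 according to whether the endpoint lies in \<open>G\<close>.\<close>

lemma cst_fiber_right:
  assumes "fiber V RR G"
  shows "cst RR (\<lambda>u w. w \<in> G)"
  unfolding cst_def
proof (intro ballI allI impI)
  fix S u v u' v' assume S: "S \<in> RR" "(u, v) \<in> S" "(u', v') \<in> S"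
  have I: "Id_on G \<in> RR" using assms by (simp add: fiber_def)
  have *: "card {w. (u, w) \<in> S \<and> (w, v) \<in> Id_on G} = of_bool (v \<in> G)" if "(u, v) \<in> S" for u v
  proof -
    have "{w. (u, w) \<in> S \<and> (w, v) \<in> Id_on G} = (if v \<in> G then {v} else {})" using that by auto
    then show ?thesis by simp
  qed
  show "(v \<in> G) = (v' \<in> G)"
    using intersection_number[OF S(1) I S] *[OF S(2)] *[OF S(3)] by (cases "v \<in> G"; cases "v' \<in> G") auto
qed

lemma cst_fiber_left: "fiber V RR G \<Longrightarrow> cst RR (\<lambda>u w. u \<in> G)"
  using cst_transpose[OF cst_fiber_right] by blast

lemma cst_mmul:
  fixes A B :: "'a \<Rightarrow> 'a \<Rightarrow> 'f::comm_semiring_1"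
  assumes "fiber V RR G" "cst RR A" "cst RR B"
  shows "cst RR (mmul G A B)"
proof -
  have "cst RR (\<lambda>u w. A u w * of_bool (w \<in> G))"
    using cst_map2[OF assms(2) cst_fiber_right[OF assms(1)], of "\<lambda>a b. a * of_bool b"] .
  then have *: "cst RR (mmul V (\<lambda>u w. A u w * of_bool (w \<in> G)) B)" using cst_mmul_V assms(3) by blast
  have "mmul V (\<lambda>u w. A u w * of_bool (w \<in> G)) B = mmul G A B"
  proof (intro ext)
    fix x y
    have GV: "G \<subseteq> V" using assms(1) by (simp add: fiber_def)
    have "mmul V (\<lambda>u w. A u w * of_bool (w \<in> G)) B x y = (\<Sum>j\<in>V. if j \<in> G then A x j * B j y else 0)"
      unfolding mmul_def by (rule sum.cong) auto
    also have "\<dots> = (\<Sum>j\<in>V \<inter> G. A x j * B j y)" using finite_V by (simp add: sum.inter_restrict)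
    also have "V \<inter> G = G" using GV by blast
    finally show "mmul V (\<lambda>u w. A u w * of_bool (w \<in> G)) B x y = mmul G A B x y" by (simp add: mmul_def)
  qed
  then show ?thesis using * by simp
qed

lemma cst_mid: "fiber V RR G \<Longrightarrow> cst RR (mid G :: 'a \<Rightarrow> 'a \<Rightarrow> 'f::zero_neq_one)"
proof -
  assume "fiber V RR G"
  then have "cst RR (adj (Id_on G) :: 'a \<Rightarrow> 'a \<Rightarrow> 'f)" by (intro cst_adj) (simp add: fiber_def)
  moreover have "(adj (Id_on G) :: 'a \<Rightarrow> 'a \<Rightarrow> 'f) = mid G" by (auto simp: adj_def mid_def fun_eq_iff)
  ultimately show ?thesis by simp
qed

lemma cst_mpow: "fiber V RR G \<Longrightarrow> cst RR A \<Longrightarrow> cst RR (mpow G A n)" for A :: "'a \<Rightarrow> 'a \<Rightarrow> 'f::comm_semiring_1"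
  by (induction n) (auto intro: cst_mid cst_mmul)

lemma cst_diag: "fiber V RR G \<Longrightarrow> cst RR A \<Longrightarrow> x \<in> G \<Longrightarrow> x' \<in> G \<Longrightarrow> A x x = A x' x'"
  unfolding fiber_def by (rule cstD[of RR A "Id_on G"]) auto

text \<open>A row sum is a diagonal entry of the product with the all-ones matrix, and the diagonal
  of a fiber is a single basis relation.\<close>

lemma cst_row_sum:
  fixes A :: "'a \<Rightarrow> 'a \<Rightarrow> 'f::comm_semiring_1"
  assumes "fiber V RR G" "fiber V RR H" "cst RR A" "x \<in> G" "x' \<in> G"
  shows "(\<Sum>y\<in>H. A x y) = (\<Sum>y\<in>H. A x' y)"
  using cst_diag[OF assms(1) cst_mmul[OF assms(2,3) cst_const[of RR 1]] assms(4,5)]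
  by (simp add: mmul_def)

end

lemma mpow_add:
  assumes "finite X" "x \<in> X"
  shows "mmul X (mpow X A i) (mpow X A j) x y = mpow X A (i + j) x y"
  using assms(2)
proof (induction i arbitrary: x)
  case 0
  then show ?case using mmul_mid_left[OF assms(1), of x "mpow X A j"] by simp
next
  case (Suc i)
  then show ?case using assms(1) by (auto simp: mmul_assoc intro: mmul_cong)
qed

lemma mpow_of_int: "mpow X (\<lambda>x y. of_int (B x y)) n x y = of_int (mpow X B n x y)"
  by (induction n arbitrary: x) (auto simp: mid_def mmul_def)

text \<open>By the pigeonhole principle the powers of \<open>B\<close> modulo \<open>p\<close>
  become periodic; a positive multiple of the period beyond the preperiod gives an
  idempotent.\<close>

lemma ex_idempotent_power_mod:
  fixes B :: "'a \<Rightarrow> 'a \<Rightarrow> int" and p :: nat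
  assumes fin: "finite X" and p: "p > 0"
  obtains n where "n > 0"
    "\<And>x y. x \<in> X \<Longrightarrow> y \<in> X \<Longrightarrow> [mpow X B (n + n) x y = mpow X B n x y] (mod int p)"
proof -
  define f where "f n = (\<lambda>(x,y)\<in>X \<times> X. mpow X B n x y mod int p)" for n
  have "range f \<subseteq> (X \<times> X) \<rightarrow>\<^sub>E {0..<int p}" using p by (auto simp: f_def split: if_splits)
  then have "finite (range f)" using fin by (meson finite_PiE finite_SigmaI finite_atLeastLessThan_int finite_subset)
  then have "\<not> inj f" using finite_imageD infinite_UNIV_nat by blast
  then obtain i j where ij: "f i = f j" "i < j" unfolding inj_def by (metis linorder_neqE_nat)
  define l where "l = j - i"
  have l: "l > 0" "j = i + l" using ij by (auto simp: l_def)
  have base: "[mpow X B i x y = mpow X B (i + l) x y] (mod int p)" if "x \<in> X" "y \<in> X" for x y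
    using fun_cong[OF ij(1), of "(x, y)"] that l by (simp add: f_def cong_def)
  have shift: "[mpow X B (t + i) x y = mpow X B (t + i + l) x y] (mod int p)" if "x \<in> X" "y \<in> X" for x y t
    using that(1)
  proof (induction t arbitrary: x)
    case 0
    then show ?case using base that by simp
  next
    case (Suc t)
    then show ?case by (auto simp: mmul_def intro!: cong_sum cong_mult)
  qed
  have rep: "[mpow X B (t + i) x y = mpow X B (t + i + c * l) x y] (mod int p)" if "x \<in> X" "y \<in> X" for x y t c
  proof (induction c)
    case (Suc c)
    have "[mpow X B ((t + c * l) + i) x y = mpow X B ((t + c * l) + i + l) x y] (mod int p)"
      using shift that by blast
    then show ?case using cong_trans[OF Suc] by (simp add: algebra_simps)
  qed simp
  \<comment> \<open>A positive multiple of the period \<open>l\<close> that is at least the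
    preperiod \<open>i\<close>.\<close>
  define n where "n = (i + 1) * l"
  have "n > 0" using l by (simp add: n_def)
  have "i \<le> (i + 1) * 1" by simp
  also have "\<dots> \<le> n" unfolding n_def using l by (intro mult_left_mono) auto
  finally have "i \<le> n" .
  then have "n = (n - i) + i" by simp
  moreover have "n + n = (n - i) + i + (i + 1) * l" using \<open>i \<le> n\<close> by (simp add: n_def)
  ultimately have "[mpow X B (n + n) x y = mpow X B n x y] (mod int p)" if "x \<in> X" "y \<in> X" for x y
    using rep[OF that, of "n - i" "i + 1"] cong_sym by metis
  then show ?thesis using that \<open>n > 0\<close> by blast
qed

section \<open>Rational idempotents in the adjacency algebra of a fiber of prime size\<close>

locale prime_fiber = coherent V RR for V :: "'a set" and RR +
  fixes X :: "'a set" and p :: nat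
  assumes fibX: "fiber V RR X" and cardX: "card X = p" and prime_p: "prime p"
begin

lemma finite_X: "finite X"
  using cardX prime_p by (metis card.infinite not_prime_0)

lemma p_gt_1: "p > 1" using prime_p prime_gt_1_nat by blast

lemma X_ne: "X \<noteq> {}" using cardX p_gt_1 by auto

text \<open>The source of all divisibility by \<open>p\<close>: the diagonal is constant on the
  fiber.\<close>

lemma cst_trace:
  fixes A :: "'a \<Rightarrow> 'a \<Rightarrow> 'f::comm_semiring_1"
  assumes "cst RR A" "x \<in> X"
  shows "mtrace X A = of_nat p * A x x"
proof -
  have "mtrace X A = (\<Sum>y\<in>X. A x x)"
    unfolding mtrace_def by (rule sum.cong) (auto intro: cst_diag[OF fibX assms(1) _ assms(2)])
  then show ?thesis by (simp add: cardX)
qed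

sublocale L: local_ring "ploc p" "pmax p" by (rule local_ring_ploc[OF prime_p])
sublocale Val: valuation_ring "ploc p" by (rule valuation_ring_ploc[OF prime_p])

lemma int_in_ploc: "of_int n \<in> ploc p"
  using p_gt_1 by (intro ploc_of_int) auto

text \<open>This is the locality modulo \<open>p\<close>. An idempotent power of \<open>B\<close>
  has trace divisible by \<open>p\<close>, so its rank is 0 or \<open>p\<close>. Rank
  \<open>p\<close> would make it the identity modulo \<open>p\<close>, whose row sums are 1 instead
  of 0.\<close>

lemma nilpotent_mod_p:
  fixes B :: "'a \<Rightarrow> 'a \<Rightarrow> int"
  assumes B: "cst RR B" and row: "\<And>x. x \<in> X \<Longrightarrow> (\<Sum>y\<in>X. B x y) = 0"
  obtains n where "\<And>x y. x \<in> X \<Longrightarrow> y \<in> X \<Longrightarrow> int p dvd mpow X B n x y"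
proof -
  obtain n where n: "n > 0"
    "\<And>x y. x \<in> X \<Longrightarrow> y \<in> X \<Longrightarrow> [mpow X B (n + n) x y = mpow X B n x y] (mod int p)"
    using ex_idempotent_power_mod[OF finite_X, of p B] p_gt_1 by auto
  define E where "E = (\<lambda>x y. of_int (mpow X B n x y) :: rat)"
  have "mmul X E E x y - E x y \<in> pmax p" if "x \<in> X" "y \<in> X" for x y
  proof -
    have "mmul X E E x y = of_int (mmul X (mpow X B n) (mpow X B n) x y)" by (simp add: mmul_def E_def)
    also have "\<dots> = of_int (mpow X B (n + n) x y)" using mpow_add[OF finite_X that(1)] by metis
    finally have "mmul X E E x y - E x y = of_int (mpow X B (n + n) x y - mpow X B n x y)"
      by (simp add: E_def)
    also have "\<dots> \<in> pmax p" using n(2)[OF that] unfolding of_int_pmax_iff[OF prime_p] by (simp add: cong_iff_dvd_diff)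
    finally show ?thesis .
  qed
  note E_idem = this
  have ER: "E x y \<in> ploc p" for x y using int_in_ploc by (simp add: E_def)
  obtain Y where Y: "Y \<subseteq> X" "mtrace X E - of_nat (card Y) \<in> pmax p"
    "\<And>x y. Y = {} \<Longrightarrow> x \<in> X \<Longrightarrow> y \<in> X \<Longrightarrow> E x y \<in> pmax p"
    "\<And>x y. Y = X \<Longrightarrow> x \<in> X \<Longrightarrow> y \<in> X \<Longrightarrow> E x y - of_bool (x = y) \<in> pmax p"
    by (rule L.idempotent_mod_trace[OF finite_X ER E_idem], assumption+) (rule that)
  obtain x where x: "x \<in> X" using X_ne by blast
  have "mtrace X E = of_int (mtrace X (mpow X B n))" by (simp add: E_def mtrace_def)
  also have "\<dots> = of_int (int p * mpow X B n x x)"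
    using cst_trace[OF cst_mpow[OF fibX B] x, of n] by simp
  finally have "of_int (int p * mpow X B n x x - int (card Y)) \<in> pmax p" using Y(2) by simp
  then have "int p dvd int p * mpow X B n x x - int (card Y)" using of_int_pmax_iff[OF prime_p] by blast
  then have "int p dvd int (card Y)" by (simp add: dvd_diff_right_iff)
  then have "p dvd card Y" by simp
  moreover have cY: "card Y \<le> p" using Y(1) cardX card_mono finite_X by blast
  ultimately have "card Y = 0 \<or> card Y = p" using dvd_imp_le[of p "card Y"] by linarith
  moreover have "card Y \<noteq> p"
  proof
    assume "card Y = p"
    then have YX: "Y = X" using card_subset_eq[OF finite_X Y(1)] cardX by simp
    obtain n' where n': "n = Suc n'" using n(1) gr0_conv_Suc by blast
    have rs: "(\<Sum>y\<in>X. mpow X B (Suc i) x y) = 0" if "x \<in> X" for i x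
      using that
    proof (induction i arbitrary: x)
      case 0
      have "mmul X B (mid X) x y = B x y" if "y \<in> X" for y
        using mmul_mid_right[of X y "\<lambda>a b. if b \<in> X then B a b else 0" x] finite_X that
        by (auto simp: mmul_def)
      then show ?case using row[OF 0] by simp
    next
      case (Suc i)
      have "(\<Sum>y\<in>X. mpow X B (Suc (Suc i)) x y) = (\<Sum>w\<in>X. B x w * (\<Sum>y\<in>X. mpow X B (Suc i) w y))"
        unfolding mpow.simps(2)[of X B "Suc i"] mmul_def[of X B "mpow X B (Suc i)"] sum_distrib_left
        by (rule sum.swap)
      also have "\<dots> = 0" using Suc.IH by (intro sum.neutral) auto
      finally show ?case .
    qed
    have "(\<Sum>y\<in>X. E x y) - (\<Sum>y\<in>X. of_bool (x = y)) \<in> pmax p"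
      by (rule L.Zsum_diff) (use Y(4)[OF YX x] in blast)
    moreover have "(\<Sum>y\<in>X. E x y) = of_int (\<Sum>y\<in>X. mpow X B n x y)" by (simp add: E_def)
    moreover have "(\<Sum>y\<in>X. mpow X B n x y) = 0" using rs[OF x, of n'] n' by blast
    moreover have "(\<Sum>y\<in>X. of_bool (x = y) :: rat) = 1" using finite_X x by (simp add: of_bool_def)
    ultimately have "- 1 \<in> pmax p" by simp
    then show False using L.Zminus[of "-1"] L.Z1 by simp
  qed
  ultimately have "Y = {}" using Y(1) finite_X finite_subset by (metis card_0_eq)
  then have "of_int (mpow X B n x y) \<in> pmax p" if "x \<in> X" "y \<in> X" for x y
    using Y(3) that by (simp add: E_def)
  then show ?thesis using that of_int_pmax_iff[OF prime_p] by blast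
qed

text \<open>The entries of \<open>e\<close> may have \<open>p\<close> in the denominator, so
  \<open>B e\<close> cannot be reduced modulo \<open>p\<close> directly. Factoring \<open>e\<close>
  through a \<open>p\<close>-integral \<open>M\<close> replaces it by \<open>B' = M B\<close> on
  \<open>Y\<close>, which has the same trace, is \<open>p\<close>-integral and inherits the
  nilpotency of \<open>B\<close>.\<close>

lemma trace_on_image:
  fixes B :: "'a \<Rightarrow> 'a \<Rightarrow> int" and e :: "'a \<Rightarrow> 'a \<Rightarrow> rat"
  assumes B: "cst RR B" and row: "\<And>x. x \<in> X \<Longrightarrow> (\<Sum>y\<in>X. B x y) = 0"
    and idem: "\<And>x y. x \<in> X \<Longrightarrow> y \<in> X \<Longrightarrow> mmul X e e x y = e x y"
    and comm: "\<And>x y. x \<in> X \<Longrightarrow> y \<in> X \<Longrightarrow>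
       mmul X e (\<lambda>x y. of_int (B x y)) x y = mmul X (\<lambda>x y. of_int (B x y)) e x y"
  shows "mtrace X (mmul X (\<lambda>x y. of_int (B x y)) e) \<in> pmax p"
proof -
  let ?B = "\<lambda>x y. of_int (B x y) :: rat"
  obtain Y M where Y: "Y \<subseteq> X" "\<And>y j. y \<in> Y \<Longrightarrow> j \<in> X \<Longrightarrow> M y j \<in> ploc p"
    "\<And>x z. x \<in> X \<Longrightarrow> z \<in> X \<Longrightarrow> e x z = mmul Y e M x z"
    "\<And>y z. y \<in> Y \<Longrightarrow> z \<in> X \<Longrightarrow> mmul X M e y z = M y z"
    "\<And>y z. y \<in> Y \<Longrightarrow> z \<in> Y \<Longrightarrow> M y z = of_bool (y = z)"
    by (rule Val.idempotent_factorization[OF finite_X idem], assumption+) (rule that)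
  have fY: "finite Y" using Y(1) finite_X finite_subset by blast
  define B' where "B' = mmul X M ?B"
  \<comment> \<open>The image of \<open>e\<close> is invariant under \<open>B\<close>:
    \<open>M B e = M e B = M B\<close>.\<close>
  have MBe: "mmul X B' e y z = B' y z" if "y \<in> Y" "z \<in> X" for y z
  proof -
    have "mmul X B' e y z = mmul X M (mmul X ?B e) y z" by (simp add: B'_def mmul_assoc)
    also have "\<dots> = mmul X M (mmul X e ?B) y z" by (rule mmul_cong) (use comm that in auto)
    also have "\<dots> = mmul X (mmul X M e) ?B y z" by (simp add: mmul_assoc)
    also have "\<dots> = B' y z" unfolding B'_def by (rule mmul_cong) (use Y(4) that in auto)
    finally show ?thesis .
  qed
  have trace: "mtrace X (mmul X ?B e) = mtrace Y B'"
  proof -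
    have "mtrace X (mmul X ?B e) = mtrace X (mmul X ?B (mmul Y e M))"
      unfolding mtrace_def by (intro sum.cong refl mmul_cong) (use Y(3) in auto)
    also have "\<dots> = mtrace Y (mmul X M (mmul X ?B e))"
      unfolding mmul_assoc[symmetric] using mtrace_mmul_commute[of X Y "mmul X ?B e" M]
      by (simp add: mmul_assoc)
    also have "\<dots> = mtrace Y B'"
      unfolding mtrace_def mmul_assoc[symmetric] B'_def[symmetric]
      by (intro sum.cong refl) (use MBe Y(1) in auto)
    finally show ?thesis .
  qed
  \<comment> \<open>Invariance makes compression to \<open>Y\<close> multiplicative, so
    \<open>B'^i\<close> is the compression of \<open>B^i\<close>.\<close>
  have pw: "mpow Y B' i y z = mmul X M (mpow X ?B i) y z" if "y \<in> Y" "z \<in> Y" for i y z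
    using that(1)
  proof (induction i arbitrary: y)
    case 0
    have "mmul X M (mid X) y z = M y z"
      using mmul_mid_right[of X z "\<lambda>a b. if b \<in> X then M a b else 0" y] finite_X that(2) Y(1)
      by (auto simp: mmul_def)
    then show ?case using Y(5)[OF 0 that(2)] 0 by (simp add: mid_def)
  next
    case (Suc i)
    have "mpow Y B' (Suc i) y z = mmul Y (mmul X B' e) (mmul X M (mpow X ?B i)) y z"
      unfolding mpow.simps(2) by (rule mmul_cong) (use MBe Suc Y(1) in auto)
    also have "\<dots> = mmul X B' (mmul X (mmul Y e M) (mpow X ?B i)) y z" by (simp add: mmul_assoc)
    also have "\<dots> = mmul X B' (mmul X e (mpow X ?B i)) y z"
      by (intro mmul_cong refl) (use Y(3) in auto)
    also have "\<dots> = mmul X (mmul X B' e) (mpow X ?B i) y z" by (simp add: mmul_assoc)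
    also have "\<dots> = mmul X B' (mpow X ?B i) y z" by (rule mmul_cong) (use MBe Suc in auto)
    finally show ?case by (simp add: B'_def mmul_assoc)
  qed
  obtain n where n: "\<And>x y. x \<in> X \<Longrightarrow> y \<in> X \<Longrightarrow> int p dvd mpow X B n x y"
    using nilpotent_mod_p[OF B row] by blast
  have "mtrace Y B' \<in> pmax p"
  proof (rule L.nilpotent_mod_trace[OF fY, of _ n])
    show "B' x y \<in> ploc p" if "x \<in> Y" "y \<in> Y" for x y
      unfolding B'_def mmul_def using that Y(2) int_in_ploc by (auto intro!: L.Rsum L.Rmult)
    show "mpow Y B' n x y \<in> pmax p" if xy: "x \<in> Y" "y \<in> Y" for x y
    proof -
      have "mmul X M (mpow X ?B n) x y \<in> pmax p"
        unfolding mmul_def mpow_of_int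
      proof (intro L.Zsum L.Zmult)
        show "M x j \<in> ploc p" if "j \<in> X" for j using Y(2) that xy by blast
        show "of_int (mpow X B n j y) \<in> pmax p" if "j \<in> X" for j
          using n[OF that, of y] xy(2) Y(1) of_int_pmax_iff[OF prime_p] by blast
      qed
      then show ?thesis using pw[OF xy] by simp
    qed
  qed
  then show ?thesis using trace by simp
qed

text \<open>A further idempotent \<open>e\<close> of rank \<open>\<rho>\<close> would make \<open>y = (p - 1) e - \<rho> (I - J / p)\<close> a
  \<open>p\<close>-integral member of the adjacency algebra whose square has a trace prime to \<open>p\<close>, whereas every
  trace is \<open>p\<close> times a diagonal entry.\<close>

lemma central_idempotent_trivial:
  fixes e :: "'a \<Rightarrow> 'a \<Rightarrow> rat"
  assumes e: "cst RR e" and idem: "\<And>x y. x \<in> X \<Longrightarrow> y \<in> X \<Longrightarrow> mmul X e e x y = e x y"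
    and comm: "\<And>A x y. cst RR A \<Longrightarrow> x \<in> X \<Longrightarrow> y \<in> X \<Longrightarrow> mmul X e A x y = mmul X A e x y"
    and row: "\<And>x. x \<in> X \<Longrightarrow> (\<Sum>y\<in>X. e x y) = 0"
  shows "(\<forall>x\<in>X. \<forall>y\<in>X. e x y = 0) \<or> (\<forall>x\<in>X. \<forall>y\<in>X. e x y = of_bool (x = y) - 1 / of_nat p)"
proof -
  have p0: "(of_nat p :: rat) \<noteq> 0" using p_gt_1 by simp
  have col: "(\<Sum>x\<in>X. e x y) = 0" if "y \<in> X" for y
    using comm[OF cst_const[of RR 1], of y y] that row[OF that] by (simp add: mmul_def)
  obtain Y M where Y: "Y \<subseteq> X" "\<And>x z. x \<in> X \<Longrightarrow> z \<in> X \<Longrightarrow> e x z = mmul Y e M x z"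
    "mtrace X e = of_nat (card Y)"
    by (rule field_val.idempotent_factorization[OF finite_X idem], assumption+) (rule that)
  define r where "r = card Y"
  \<comment> \<open>Rows and columns of \<open>e\<close> sum to 0, so adding the idempotent
    \<open>J / p\<close> gives an idempotent of rank \<open>r + 1\<close>. Hence
    \<open>r + 1 \<le> p\<close>, and equality means \<open>e1 = I\<close>.\<close>
  define e1 where "e1 = (\<lambda>x y. e x y + 1 / of_nat p)"
  have "mmul X e1 e1 x y = e1 x y" if "x \<in> X" "y \<in> X" for x y
  proof -
    have "mmul X e1 e1 x y = mmul X e e x y + (\<Sum>w\<in>X. e x w) / of_nat p + (\<Sum>w\<in>X. e w y) / of_nat p
        + (\<Sum>w\<in>X. 1 / of_nat p * (1 / of_nat p))"
      by (simp add: mmul_def e1_def algebra_simps sum.distrib sum_divide_distrib)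
    also have "\<dots> = e1 x y" using p0 idem that row col by (simp add: cardX e1_def)
    finally show ?thesis .
  qed
  note e1_idem = this
  obtain Y1 where Y1: "Y1 \<subseteq> X" "mtrace X e1 = of_nat (card Y1)"
    "\<And>x y. Y1 = X \<Longrightarrow> x \<in> X \<Longrightarrow> y \<in> X \<Longrightarrow> e1 x y = of_bool (x = y)"
    by (rule field_val.idempotent_factorization[OF finite_X e1_idem], assumption+) (rule that)
  have "mtrace X e1 = mtrace X e + 1" using p0 by (simp add: mtrace_def e1_def sum.distrib cardX)
  then have "(of_nat (card Y1) :: rat) = of_nat (r + 1)" using Y1(2) Y(3) by (simp add: r_def)
  then have cY1: "card Y1 = r + 1" using of_nat_eq_iff by blast
  then have rp: "r + 1 \<le> p" using Y1(1) cardX card_mono finite_X by metis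
  consider "r = 0" | "r + 1 = p" | "0 < r" "r < p - 1" using rp by linarith
  then show ?thesis
  proof cases
    case 1
    then have "Y = {}" using Y(1) finite_X finite_subset by (metis card_0_eq r_def)
    then show ?thesis using Y(2) by (simp add: mmul_def)
  next
    case 2
    then have "Y1 = X" using cY1 Y1(1) cardX finite_X card_subset_eq by metis
    then have "e x y = of_bool (x = y) - 1 / of_nat p" if "x \<in> X" "y \<in> X" for x y
      using Y1(3)[OF _ that] by (simp add: e1_def algebra_simps)
    then show ?thesis by blast
  next
    case 3
    define P :: rat where "P = of_nat p"
    define \<rho> :: rat where "\<rho> = of_nat r"
    have P0: "P \<noteq> 0" using p0 by (simp add: P_def)
    have \<rho>: "\<rho> \<in> ploc p" using int_in_ploc[of "int r"] by (simp add: \<rho>_def)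
    have PR: "P - 1 \<in> ploc p" using int_in_ploc[of "int p - 1"] by (simp add: P_def)
    \<comment> \<open>The weights cancel the diagonal, since \<open>e x x = \<rho> / P\<close>. Off
      the diagonal the denominators cancel because \<open>P * e x u - \<rho>\<close> turns out to be
      a multiple of \<open>p\<close> in the localization.\<close>
    define y where "y = (\<lambda>x u. (P - 1) * e x u - \<rho> * (mid X x u - 1 / P))"
    have ycst: "cst RR y"
      unfolding y_def by (rule cst_map2[OF e cst_mid[OF fibX], where f = "\<lambda>a b. (P - 1) * a - \<rho> * (b - 1 / P)"])
    have yR: "y x u \<in> ploc p" if xu: "x \<in> X" "u \<in> X" for x u
    proof (cases "x = u")
      case True
      have "\<rho> = P * e x x" using cst_trace[OF e xu(1)] Y(3) by (simp add: r_def \<rho>_def P_def)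
      then have "y x u = 0" using True P0 xu by (simp add: y_def mid_def field_simps)
      then show ?thesis using L.R0 by simp
    next
      case False
      have "x \<in> V" "u \<in> V" using xu fibX by (auto simp: fiber_def)
      then obtain T where T: "T \<in> RR" "(x, u) \<in> T" using rel_ex by blast
      \<comment> \<open>The transpose of \<open>T\<close>, so that the trace of \<open>A e\<close>
        reads off the value of \<open>e\<close> on \<open>T\<close>.\<close>
      define A :: "'a \<Rightarrow> 'a \<Rightarrow> int" where "A = adj (T\<inverse>)"
      have Acst: "cst RR A" unfolding A_def using T conv_RR cst_adj by blast
      define d where "d = (\<Sum>w\<in>X. A x w)"
      have rowA: "(\<Sum>w\<in>X. A v w) = d" if "v \<in> X" for v
        unfolding d_def by (rule cst_row_sum[OF fibX fibX Acst that xu(1)])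
      have dcard: "d = int (card {w\<in>X. (w, v) \<in> T})" if "v \<in> X" for v
        using rowA[OF that] finite_X by (simp add: A_def adj_def Int_def flip: sum.inter_filter)
      have "x \<in> {w\<in>X. (w, u) \<in> T}" using T xu by simp
      then have d0: "d > 0" using dcard[OF xu(2)] finite_X by (auto simp: card_gt_0_iff)
      have "{w\<in>X. (w, x) \<in> T} \<subset> X"
      proof -
        have "(x, x) \<notin> T"
        proof
          assume "(x, x) \<in> T"
          then have "T = Id_on X" using fibX T xu rel_unique[of T "Id_on X" x x] by (auto simp: fiber_def)
          then show False using T False by auto
        qed
        then show ?thesis using xu by blast
      qed
      then have "card {w\<in>X. (w, x) \<in> T} < p" using cardX finite_X psubset_card_mono by blast
      then have dp: "d < int p" using dcard[OF xu(1)] by simp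
      \<comment> \<open>Subtracting the valency from the diagonal makes the row sums vanish, as
        \<open>trace_on_image\<close> requires. Since \<open>0 < d < p\<close>, the factor
        \<open>d\<close> can be divided out afterwards.\<close>
      define B where "B = (\<lambda>v w. A v w - d * mid X v w)"
      have Bcst: "cst RR B" unfolding B_def
        by (rule cst_map2[OF Acst cst_mid[OF fibX], where f = "\<lambda>a b. a - d * b"])
      have midsum: "(\<Sum>w\<in>X. mid X v w * g w) = g v" if "v \<in> X" for v and g :: "'a \<Rightarrow> 'b::comm_semiring_1"
      proof -
        have "(\<Sum>w\<in>X. mid X v w * g w) = (\<Sum>w\<in>X. if v = w then g w else 0)"
          by (rule sum.cong) (auto simp: mid_def)
        then show ?thesis using finite_X that by simp
      qed
      have Brow: "(\<Sum>w\<in>X. B v w) = 0" if "v \<in> X" for v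
        using rowA[OF that] midsum[OF that, of "\<lambda>_. 1 :: int"]
        by (simp add: B_def sum_subtractf flip: sum_distrib_left)
      have cB: "cst RR (\<lambda>v w. of_int (B v w) :: rat)" by (rule cst_map[OF Bcst])
      have tr: "mtrace X (mmul X (\<lambda>v w. of_int (B v w)) e) \<in> pmax p"
        using trace_on_image[OF Bcst Brow idem] comm[OF cB] by blast
      have "mtrace X (mmul X (\<lambda>v w. of_int (B v w)) e) = of_int d * (P * e x u - \<rho>)"
      proof -
        have "mmul X (\<lambda>v w. of_int (B v w)) e v v = of_int d * e x u - of_int d * e v v" if v: "v \<in> X" for v
        proof -
          have "mmul X (\<lambda>v w. of_int (B v w)) e v v
            = (\<Sum>w\<in>X. of_int (A v w) * e w v) - of_int d * (\<Sum>w\<in>X. mid X v w * e w v)"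
            by (simp add: mmul_def B_def left_diff_distrib sum_subtractf sum_distrib_left mult.assoc mid_def)
          also have "(\<Sum>w\<in>X. mid X v w * e w v) = e v v" by (rule midsum[OF v])
          also have "(\<Sum>w\<in>X. of_int (A v w) * e w v) = (\<Sum>w\<in>X. of_int (A v w) * e x u)"
            by (rule sum.cong) (use cstD[OF e T(1) _ T(2)] in \<open>auto simp: A_def adj_def\<close>)
          also have "\<dots> = of_int d * e x u" using rowA[OF v] by (simp flip: sum_distrib_right of_int_sum)
          finally show ?thesis .
        qed
        then have "mtrace X (mmul X (\<lambda>v w. of_int (B v w)) e) = of_nat (card X) * (of_int d * e x u) - of_int d * mtrace X e"
          by (simp add: mtrace_def sum_subtractf flip: sum_distrib_left)
        then show ?thesis using Y(3) by (simp add: cardX P_def \<rho>_def r_def algebra_simps)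
      qed
      then have "of_int d * (P * e x u - \<rho>) \<in> pmax p" using tr by simp
      moreover have "inverse (of_int d) \<in> ploc p"
      proof (rule L.unit[OF int_in_ploc])
        have "\<not> int p dvd d" using d0 dp zdvd_imp_le by fastforce
        then show "of_int d \<notin> pmax p" using of_int_pmax_iff[OF prime_p] by blast
      qed
      ultimately have "inverse (of_int d) * (of_int d * (P * e x u - \<rho>)) \<in> pmax p" using L.Zmult by blast
      moreover have "inverse (of_int d) * (of_int d * (P * e x u - \<rho>)) = P * e x u - \<rho>" using d0 by simp
      ultimately have "P * e x u - \<rho> \<in> pmax p" by metis
      then obtain i where i: "i \<in> ploc p" "P * e x u - \<rho> = P * i" unfolding pmax_def P_def by blast
      then have "e x u = \<rho> / P + i" using P0 by (simp add: field_simps)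
      then have "y x u = \<rho> + (P - 1) * i" using False P0 by (simp add: y_def mid_def field_simps)
      then show ?thesis using i \<rho> PR by (auto intro: L.Radd L.Rmult)
    qed
    obtain x where x: "x \<in> X" using X_ne by blast
    have "mmul X y y x x \<in> ploc p" unfolding mmul_def by (intro L.Rsum L.Rmult) (auto simp: yR x)
    moreover have "mtrace X (mmul X y y) = of_nat p * mmul X y y x x"
      by (rule cst_trace[OF cst_mmul[OF fibX ycst ycst] x])
    ultimately have tin: "mtrace X (mmul X y y) \<in> pmax p" unfolding pmax_def by blast
    have yy: "mmul X y y v v = (P - 1)^2 * e v v - 2 * (P - 1) * \<rho> * e v v + \<rho>^2 * (1 - 1 / P)" if v: "v \<in> X" for v
    proof -
      have m1: "(\<Sum>w\<in>X. mid X v w * g w) = g v" for g :: "'a \<Rightarrow> rat"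
      proof -
        have "(\<Sum>w\<in>X. mid X v w * g w) = (\<Sum>w\<in>X. if v = w then g w else 0)"
          by (rule sum.cong) (auto simp: mid_def)
        then show ?thesis using finite_X v by simp
      qed
      have ms: "mid X w v = mid X v w" for w using v by (auto simp: mid_def)
      have mm: "mid X v w * (mid X v w :: rat) = mid X v w * 1" for w by (simp add: mid_def)
      have "mmul X y y v v = (\<Sum>w\<in>X. (P - 1)^2 * (e v w * e w v) - (P - 1) * \<rho> * (mid X v w * e v w)
          - (P - 1) * \<rho> * (mid X v w * e w v) + (P - 1) * \<rho> / P * e v w + (P - 1) * \<rho> / P * e w v
          + (\<rho>^2 * (mid X v w * mid X v w) - 2 * \<rho>^2 / P * (mid X v w * 1) + \<rho>^2 / P^2))"
        unfolding mmul_def y_def ms by (rule sum.cong) (auto simp: power2_eq_square field_simps)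
      also have "\<dots> = (P - 1)^2 * mmul X e e v v - (P - 1) * \<rho> * e v v - (P - 1) * \<rho> * e v v
          + (P - 1) * \<rho> / P * (\<Sum>w\<in>X. e v w) + (P - 1) * \<rho> / P * (\<Sum>w\<in>X. e w v)
          + (\<rho>^2 * 1 - 2 * \<rho>^2 / P * 1 + P * (\<rho>^2 / P^2))"
        unfolding mm sum.distrib sum_subtractf sum_distrib_left[symmetric] m1
        by (simp add: mmul_def cardX P_def)
      also have "\<dots> = (P - 1)^2 * e v v - 2 * (P - 1) * \<rho> * e v v + \<rho>^2 * (1 - 1 / P)"
        unfolding idem[OF v v] row[OF v] col[OF v] using P0 by (simp add: field_simps power2_eq_square)
      finally show ?thesis .
    qed
    have "mtrace X (mmul X y y) = (P - 1)^2 * mtrace X e - 2 * (P - 1) * \<rho> * mtrace X e + P * (\<rho>^2 * (1 - 1 / P))"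
      unfolding mtrace_def by (simp add: yy sum.distrib sum_subtractf cardX P_def flip: sum_distrib_left)
    also have "\<dots> = (P - 1) * \<rho> * (P - 1 - \<rho>)"
      using Y(3) P0 by (simp add: r_def[symmetric] \<rho>_def[symmetric] field_simps power2_eq_square)
    \<comment> \<open>For \<open>0 < r < p - 1\<close> none of the three factors is divisible by
      \<open>p\<close>.\<close>
    also have "\<dots> = of_int ((int p - 1) * int r * (int p - 1 - int r))" by (simp add: P_def \<rho>_def)
    finally have "int p dvd (int p - 1) * int r * (int p - 1 - int r)"
      using tin of_int_pmax_iff[OF prime_p] by metis
    moreover have "prime (int p)" using prime_p by simp
    ultimately consider "int p dvd int p - 1" | "int p dvd int r" | "int p dvd int p - 1 - int r"
      using prime_dvd_mult_iff by blast
    then show ?thesis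
    proof cases
      case 1
      then show ?thesis using zdvd_imp_le[of "int p" "int p - 1"] p_gt_1 by auto
    next
      case 2
      then show ?thesis using zdvd_imp_le[of "int p" "int r"] 3 by auto
    next
      case c: 3
      have "int r < int p - 1" using 3 by linarith
      then show ?thesis using zdvd_imp_le[OF c] 3 by linarith
    qed
  qed
qed

end

section \<open>Polynomials in a real symmetric matrix\<close>

lemma linear_dependence:
  fixes c :: "'i \<Rightarrow> 'd \<Rightarrow> 'f::field"
  assumes "finite D" "finite I" "card D < card I"
  shows "\<exists>a. (\<exists>i\<in>I. a i \<noteq> 0) \<and> (\<forall>d\<in>D. (\<Sum>i\<in>I. a i * c i d) = 0)"
  using assms
proof (induction D arbitrary: I c rule: finite_induct)
  case empty
  then have "I \<noteq> {}" by auto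
  then show ?case by (intro exI[of _ "\<lambda>_. 1"]) auto
next
  case (insert d D)
  show ?case
  proof (cases "\<forall>i\<in>I. c i d = 0")
    case True
    have "card D < card I" using insert by simp
    then obtain a where "\<exists>i\<in>I. a i \<noteq> 0" "\<forall>d\<in>D. (\<Sum>i\<in>I. a i * c i d) = 0"
      using insert.IH[of I c] insert.prems by blast
    then show ?thesis using True by (intro exI[of _ a]) auto
  next
    case False
    then obtain j where j: "j \<in> I" "c j d \<noteq> 0" by blast
    define c' where "c' = (\<lambda>i e. c i e - c i d / c j d * c j e)"
    have "card D < card (I - {j})" using insert j by simp
    then obtain a where a: "\<exists>i\<in>I-{j}. a i \<noteq> 0" "\<forall>e\<in>D. (\<Sum>i\<in>I-{j}. a i * c' i e) = 0"
      using insert.IH[of "I - {j}" c'] insert.prems by blast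
    define b where "b = a(j := - (\<Sum>i\<in>I-{j}. a i * (c i d / c j d)))"
    have ab: "(\<Sum>i\<in>I-{j}. b i * g i) = (\<Sum>i\<in>I-{j}. a i * g i)" for g
      by (rule sum.cong) (auto simp: b_def)
    have "(\<Sum>i\<in>I. b i * c i e) = (\<Sum>i\<in>I-{j}. a i * c' i e)" for e
    proof -
      have "(\<Sum>i\<in>I. b i * c i e) = b j * c j e + (\<Sum>i\<in>I-{j}. a i * c i e)"
        using insert.prems j by (simp add: sum.remove ab)
      also have "\<dots> = (\<Sum>i\<in>I-{j}. a i * c i e - a i * (c i d / c j d) * c j e)"
        by (simp add: b_def sum_subtractf sum_distrib_right)
      also have "\<dots> = (\<Sum>i\<in>I-{j}. a i * c' i e)"
        by (rule sum.cong) (auto simp: c'_def algebra_simps)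
      finally show ?thesis .
    qed
    moreover have "(\<Sum>i\<in>I-{j}. a i * c' i d) = 0" using j by (intro sum.neutral) (auto simp: c'_def)
    ultimately have "\<forall>e\<in>insert d D. (\<Sum>i\<in>I. b i * c i e) = 0" using a by auto
    moreover have "\<exists>i\<in>I. b i \<noteq> 0" using a by (auto simp: b_def)
    ultimately show ?thesis by blast
  qed
qed

definition peval :: "'a set \<Rightarrow> ('a \<Rightarrow> 'a \<Rightarrow> 'f::comm_ring_1) \<Rightarrow> 'f poly \<Rightarrow> 'a \<Rightarrow> 'a \<Rightarrow> 'f" where
  "peval X z f = (\<lambda>x y. \<Sum>i\<le>degree f. coeff f i * mpow X z i x y)"

lemma peval_bound: "degree f \<le> n \<Longrightarrow> peval X z f x y = (\<Sum>i\<le>n. coeff f i * mpow X z i x y)"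
  unfolding peval_def by (rule sum.mono_neutral_left) (auto simp: coeff_eq_0)

lemma peval_0 [simp]: "peval X z 0 x y = 0"
  by (simp add: peval_def)

lemma peval_add: "peval X z (f + g) x y = peval X z f x y + peval X z g x y"
proof -
  define n where "n = max (degree f) (degree g)"
  have "degree (f + g) \<le> n" by (simp add: n_def degree_add_le_max)
  then show ?thesis using peval_bound[of f n X z x y] peval_bound[of g n X z x y] peval_bound[of "f + g" n X z x y]
    by (simp add: n_def sum.distrib distrib_right)
qed

lemma peval_smult: "peval X z (smult a f) x y = a * peval X z f x y"
  using peval_bound[OF degree_smult_le[of a f]] by (simp add: peval_def sum_distrib_left mult.assoc)

lemma peval_pCons: "peval X z (pCons a f) x y = a * mid X x y + mmul X z (peval X z f) x y"
proof -
  have "peval X z (pCons a f) x y = (\<Sum>i\<le>Suc (degree f). coeff (pCons a f) i * mpow X z i x y)"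
    by (rule peval_bound) (simp add: degree_pCons_le)
  also have "\<dots> = a * mid X x y + (\<Sum>i\<le>degree f. coeff f i * mmul X z (mpow X z i) x y)"
    by (subst sum.atMost_Suc_shift) simp
  also have "(\<Sum>i\<le>degree f. coeff f i * mmul X z (mpow X z i) x y) = mmul X z (peval X z f) x y"
    by (simp add: mmul_def peval_def sum_distrib_left mult_ac sum.swap[of _ X])
  finally show ?thesis .
qed

lemma peval_mult:
  assumes "finite X" and supp: "\<And>x y. x \<notin> X \<Longrightarrow> z x y = 0"
  shows "peval X z (f * g) = mmul X (peval X z f) (peval X z g)"
proof (induction f rule: pCons_induct)
  case 0
  then show ?case by (intro ext) (simp add: mmul_def)
next
  case (pCons a f)
  have sp: "mpow X z i x y = 0" if "x \<notin> X" for i x y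
    using that by (cases i) (auto simp: mid_def mmul_def supp)
  have m: "mmul X (mid X) (peval X z g) x y = peval X z g x y" for x y
    by (rule mmul_mid_left[OF assms(1)]) (simp add: peval_def sp)
  show ?case
  proof (intro ext)
    fix x y
    have "peval X z (pCons a f * g) x y = a * peval X z g x y + mmul X z (peval X z (f * g)) x y"
      by (simp add: peval_add peval_smult peval_pCons)
    also have "mmul X z (peval X z (f * g)) = mmul X (mmul X z (peval X z f)) (peval X z g)"
      by (simp add: pCons.IH mmul_assoc)
    also have "a * peval X z g x y + \<dots> x y = mmul X (peval X z (pCons a f)) (peval X z g) x y"
      by (subst m[symmetric], unfold mmul_def[of X _ "peval X z g"] peval_pCons)
        (simp add: distrib_right sum.distrib sum_distrib_left mult.assoc)
    finally show "peval X z (pCons a f * g) x y = mmul X (peval X z (pCons a f)) (peval X z g) x y" .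
  qed
qed

lemma mpow_commute:
  fixes A z :: "'a \<Rightarrow> 'a \<Rightarrow> 'f::comm_ring_1"
  assumes fin: "finite X"
    and comm: "\<And>x y. x \<in> X \<Longrightarrow> y \<in> X \<Longrightarrow> mmul X A z x y = mmul X z A x y"
    and xy: "x \<in> X" "y \<in> X"
  shows "mmul X A (mpow X z i) x y = mmul X (mpow X z i) A x y"
  using xy(1)
proof (induction i arbitrary: x)
  case 0
  have "mmul X A (mid X) x y = A x y"
    using mmul_mid_right[of X y "\<lambda>a b. if b \<in> X then A a b else 0" x] fin xy by (auto simp: mmul_def)
  moreover have "mmul X (mid X) A x y = A x y" using mmul_mid_left[of X x A y] fin 0 by auto
  ultimately show ?case by simp
next
  case (Suc i)
  have "mmul X A (mpow X z (Suc i)) x y = mmul X (mmul X A z) (mpow X z i) x y" by (simp add: mmul_assoc)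
  also have "\<dots> = mmul X (mmul X z A) (mpow X z i) x y" by (rule mmul_cong) (use comm Suc in auto)
  also have "\<dots> = mmul X z (mmul X A (mpow X z i)) x y" by (simp add: mmul_assoc)
  also have "\<dots> = mmul X z (mmul X (mpow X z i) A) x y" by (rule mmul_cong) (use Suc in auto)
  also have "\<dots> = mmul X (mpow X z (Suc i)) A x y" by (simp add: mmul_assoc)
  finally show ?case .
qed

lemma peval_commute:
  fixes A z :: "'a \<Rightarrow> 'a \<Rightarrow> 'f::comm_ring_1"
  assumes fin: "finite X"
    and comm: "\<And>x y. x \<in> X \<Longrightarrow> y \<in> X \<Longrightarrow> mmul X A z x y = mmul X z A x y"
    and xy: "x \<in> X" "y \<in> X"
  shows "mmul X A (peval X z f) x y = mmul X (peval X z f) A x y"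
proof -
  have "mmul X A (peval X z f) x y = (\<Sum>i\<le>degree f. coeff f i * mmul X A (mpow X z i) x y)"
    unfolding mmul_def peval_def sum_distrib_left by (subst sum.swap) (simp add: mult_ac)
  also have "\<dots> = (\<Sum>i\<le>degree f. coeff f i * mmul X (mpow X z i) A x y)"
    by (intro sum.cong refl) (simp add: mpow_commute[OF fin comm xy])
  also have "\<dots> = mmul X (peval X z f) A x y"
    unfolding mmul_def peval_def sum_distrib_left sum_distrib_right by (subst sum.swap) (simp add: mult_ac)
  finally show ?thesis .
qed

text \<open>A double root of the minimal polynomial would yield a nonzero nilpotent normal matrix.\<close>

lemma real_symmetric_annihilator:
  fixes z :: "'a \<Rightarrow> 'a \<Rightarrow> complex"
  assumes fin: "finite X" and supp: "\<And>x y. x \<notin> X \<Longrightarrow> z x y = 0"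
    and sym: "\<And>x y. z x y = z y x" and real: "\<And>x y. cnj (z x y) = z x y"
  obtains f where "f \<noteq> 0" "\<And>x y. x \<in> X \<Longrightarrow> y \<in> X \<Longrightarrow> peval X z f x y = 0"
    "\<And>l. poly f l = 0 \<Longrightarrow> \<exists>g. f = [:-l, 1:] * g \<and> poly g l \<noteq> 0 \<and> (\<exists>x\<in>X. \<exists>y\<in>X. peval X z g x y \<noteq> 0)"
proof -
  define ann where "ann f \<longleftrightarrow> f \<noteq> 0 \<and> (\<forall>x\<in>X. \<forall>y\<in>X. peval X z f x y = 0)" for f
  \<comment> \<open>The space of matrices on \<open>X\<close> has dimension \<open>n\<close>, so the
    \<open>n + 1\<close> powers from 0 to \<open>n\<close> are dependent.\<close>
  define n where "n = card (X \<times> X)"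
  obtain a where a: "\<exists>i\<in>{..n}. a i \<noteq> 0" "\<forall>d\<in>X \<times> X. (\<Sum>i\<in>{..n}. a i * mpow X z i (fst d) (snd d)) = 0"
    using linear_dependence[of "X \<times> X" "{..n}" "\<lambda>i d. mpow X z i (fst d) (snd d)"] fin by (auto simp: n_def)
  define f0 where "f0 = Poly (map a [0..<Suc n])"
  have cf0: "coeff f0 i = (if i \<le> n then a i else 0)" for i
    by (auto simp: f0_def nth_default_def less_Suc_eq_le simp del: upt_Suc)
  have "f0 \<noteq> 0" using a(1) cf0 by (metis atMost_iff coeff_0)
  moreover have "peval X z f0 x y = 0" if "x \<in> X" "y \<in> X" for x y
  proof -
    have "peval X z f0 x y = (\<Sum>i\<le>n. coeff f0 i * mpow X z i x y)"
      by (rule peval_bound) (auto intro!: degree_le simp: cf0)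
    also have "\<dots> = (\<Sum>i\<le>n. a i * mpow X z i x y)" by (rule sum.cong) (auto simp: cf0)
    finally show ?thesis using a(2) that by auto
  qed
  ultimately have "ann f0" by (simp add: ann_def)
  then obtain f where f: "ann f" and min: "\<And>g. ann g \<Longrightarrow> degree f \<le> degree g"
    using ex_has_least_nat[of ann f0 degree] by blast
  have pm: "peval X z (f * g) = mmul X (peval X z f) (peval X z g)" for f g
    by (rule peval_mult[OF fin supp])
  have vanish: "peval X z (h * g) x y = 0" if "\<forall>x\<in>X. \<forall>y\<in>X. peval X z g x y = 0" "x \<in> X" "y \<in> X" for h g x y
    unfolding pm mmul_def using that by simp
  have rootg: "\<exists>g. f = [:-l, 1:] * g \<and> poly g l \<noteq> 0 \<and> (\<exists>x\<in>X. \<exists>y\<in>X. peval X z g x y \<noteq> 0)" if l: "poly f l = 0" for l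
  proof -
    obtain g where g: "f = [:-l, 1:] * g" using l by (metis dvdE poly_eq_0_iff_dvd)
    have g0: "g \<noteq> 0" using f g by (auto simp: ann_def)
    have "degree f = Suc (degree g)" unfolding g by (subst degree_mult_eq) (use g0 in auto)
    then have nann: "\<not> ann g" using min[of g] by auto
    then have ne: "\<exists>x\<in>X. \<exists>y\<in>X. peval X z g x y \<noteq> 0" using g0 by (auto simp: ann_def)
    have "poly g l \<noteq> 0"
    proof
      assume "poly g l = 0"
      then obtain h where h: "g = [:-l, 1:] * h" by (metis dvdE poly_eq_0_iff_dvd)
      have gg: "\<forall>x\<in>X. \<forall>y\<in>X. peval X z (g * g) x y = 0"
      proof -
        have "g * g = ([:-l, 1:] * h) * g" using h by (rule arg_cong)
        also have "\<dots> = h * f" unfolding g by (simp only: mult_ac)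
        finally have "g * g = h * f" .
        then show ?thesis using vanish[where g = f and h = h] f by (auto simp: ann_def)
      qed
      \<comment> \<open>As \<open>z\<close> is real and symmetric, evaluating the conjugate
        polynomial gives the adjoint \<open>N'\<close> of \<open>N = g(z)\<close>. The matrix
        \<open>H = N' N\<close> is Hermitian, and \<open>H H = 0\<close> because polynomials in
        \<open>z\<close> commute and \<open>N N = 0\<close>; hence \<open>H = 0\<close> and then
        \<open>N = 0\<close>.\<close>
      define g' where "g' = map_poly cnj g"
      have psym: "mpow X z i x y = mpow X z i y x" if "x \<in> X" "y \<in> X" for i x y
        using that
      proof (induction i arbitrary: x y)
        case 0
        then show ?case by (auto simp: mid_def)
      next
        case (Suc i)
        have "mpow X z (Suc i) x y = (\<Sum>w\<in>X. mpow X z i y w * z w x)"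
          unfolding mpow.simps mmul_def by (intro sum.cong refl) (use Suc sym in \<open>simp add: mult.commute\<close>)
        also have "\<dots> = mmul X (mpow X z i) z y x" by (simp add: mmul_def)
        also have "\<dots> = mmul X z (mpow X z i) y x"
          using mpow_commute[OF fin _ Suc.prems(2,1), of z z i] by simp
        finally show ?case by simp
      qed
      have preal: "cnj (mpow X z i x y) = mpow X z i x y" for i x y
        by (induction i arbitrary: x) (auto simp: mid_def mmul_def real)
      have g'N: "peval X z g' x y = cnj (peval X z g y x)" if "x \<in> X" "y \<in> X" for x y
      proof -
        have "degree g' = degree g" unfolding g'_def by (rule degree_map_poly) auto
        then show ?thesis unfolding peval_def
          using that by (auto simp: preal g'_def coeff_map_poly psym[OF that] intro!: sum.cong)
      qed
      define H where "H = peval X z (g' * g)"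
      have Hval: "H x y = (\<Sum>w\<in>X. cnj (peval X z g w x) * peval X z g w y)" if "x \<in> X" "y \<in> X" for x y
        unfolding H_def pm mmul_def by (intro sum.cong refl) (use g'N that in auto)
      have HH: "mmul X H H x y = 0" if "x \<in> X" "y \<in> X" for x y
      proof -
        have "mmul X H H = peval X z ((g' * g') * (g * g))"
          unfolding H_def pm[symmetric] by (simp add: mult_ac)
        then show ?thesis using vanish[OF gg that, of "g' * g'"] by simp
      qed
      have norm0: "\<forall>w\<in>X. a w = 0" if "(\<Sum>w\<in>X. cnj (a w) * a w) = 0" for a :: "'a \<Rightarrow> complex"
      proof -
        have "(\<Sum>w\<in>X. cnj (a w) * a w) = of_real (\<Sum>w\<in>X. (cmod (a w))\<^sup>2)"
          by (simp add: complex_norm_square[symmetric] mult.commute[of "cnj _"])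
        then have "(\<Sum>w\<in>X. (cmod (a w))\<^sup>2) = 0" using that of_real_eq_0_iff by metis
        then show ?thesis using fin by (simp add: sum_nonneg_eq_0_iff)
      qed
      have "H w x = 0" if "w \<in> X" "x \<in> X" for w x
      proof -
        have "(\<Sum>w\<in>X. cnj (H w x) * H w x) = mmul X H H x x"
          unfolding mmul_def
          by (intro sum.cong refl) (use that in \<open>auto simp: Hval mult.commute\<close>)
        then have "(\<Sum>w\<in>X. cnj (H w x) * H w x) = 0" using HH[OF that(2) that(2)] by (rule trans)
        from norm0[OF this] show ?thesis using that(1) by (rule bspec)
      qed
      note H0 = this
      have "peval X z g w x = 0" if "w \<in> X" "x \<in> X" for w x
      proof -
        have "(\<Sum>w\<in>X. cnj (peval X z g w x) * peval X z g w x) = 0"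
          using Hval[OF that(2) that(2)] H0[OF that(2) that(2)] by (metis)
        from norm0[OF this] show ?thesis using that(1) by (rule bspec)
      qed
      then show False using ne by blast
    qed
    with g ne show ?thesis by (intro exI[of _ g] conjI)
  qed
  show ?thesis
  proof (rule that)
    show "f \<noteq> 0" using f by (simp add: ann_def)
    show "peval X z f x y = 0" if "x \<in> X" "y \<in> X" for x y using f that by (simp add: ann_def)
  qed (rule rootg)
qed

section \<open>The central element attached to a pair of fibers\<close>

lemma sum_rotate: "(\<Sum>a\<in>A. \<Sum>b\<in>B. \<Sum>c\<in>C. f a b c) = (\<Sum>c\<in>C. \<Sum>a\<in>A. \<Sum>b\<in>B. f a b c)"
proof -
  have "(\<Sum>a\<in>A. \<Sum>b\<in>B. \<Sum>c\<in>C. f a b c) = (\<Sum>a\<in>A. \<Sum>c\<in>C. \<Sum>b\<in>B. f a b c)"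
    by (intro sum.cong refl sum.swap)
  also have "\<dots> = (\<Sum>c\<in>C. \<Sum>a\<in>A. \<Sum>b\<in>B. f a b c)" by (rule sum.swap)
  finally show ?thesis .
qed

lemma sum_swap_outer: "(\<Sum>a\<in>A. \<Sum>b\<in>B. \<Sum>c\<in>C. f a b c) = (\<Sum>c\<in>C. \<Sum>b\<in>B. \<Sum>a\<in>A. f a b c)"
  by (subst sum_rotate) (intro sum.cong refl sum.swap)

locale prime_fibers = prime_fiber V RR X p for V :: "'a set" and RR X p +
  fixes F :: "'a set"
  assumes fibF: "fiber V RR F" and cardF: "card F = p"
begin

definition rels :: "('a \<times> 'a) set set" where "rels = rels_between RR X F"

text \<open>This does not depend on \<open>F\<close>, so the valency attached to one pair of fibers
  serves for all pairs; below \<open>xx.val\<close> is applied to relations of every kind.\<close>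

definition val :: "('a \<times> 'a) set \<Rightarrow> nat" where "val R = card R div p"

lemma finite_F: "finite F"
  using cardF p_gt_1 by (metis card.infinite not_less_zero)

lemma rels_RR: "R \<in> rels \<Longrightarrow> R \<in> RR" and rels_sub: "R \<in> rels \<Longrightarrow> R \<subseteq> X \<times> F"
  by (auto simp: rels_def rels_between_def)

lemma finite_rels: "finite rels"
  using finite_RR by (auto simp: rels_def rels_between_def)

lemma rels_ex:
  assumes "x \<in> X" "y \<in> F"
  obtains R where "R \<in> rels" "(x, y) \<in> R"
proof -
  have "x \<in> V" "y \<in> V" using assms fibX fibF by (auto simp: fiber_def)
  then obtain R where R: "R \<in> RR" "(x, y) \<in> R" using rel_ex by blast
  have "R \<subseteq> X \<times> F"
  proof
    fix t assume "t \<in> R"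
    then show "t \<in> X \<times> F"
      using cstD[OF cst_fiber_left[OF fibX] R(1) _ R(2)] cstD[OF cst_fiber_right[OF fibF] R(1) _ R(2)] assms
      by (cases t) auto
  qed
  then show ?thesis using that R by (auto simp: rels_def rels_between_def)
qed

lemma rels_unique: "R \<in> rels \<Longrightarrow> S \<in> rels \<Longrightarrow> (x, y) \<in> R \<Longrightarrow> (x, y) \<in> S \<Longrightarrow> R = S"
  using rel_unique rels_RR by blast

lemma card_rel:
  assumes R: "R \<in> rels"
  shows card_row: "x \<in> X \<Longrightarrow> card {y. (x, y) \<in> R} = val R"
    and card_col: "y \<in> F \<Longrightarrow> card {x. (x, y) \<in> R} = val R"
    and card_val: "card R = p * val R" and val_pos: "val R > 0"
proof -
  have A: "cst RR (adj R :: 'a \<Rightarrow> 'a \<Rightarrow> nat)" using cst_adj rels_RR[OF R] by blast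
  have row: "card {y. (x, y) \<in> R} = (\<Sum>y\<in>F. adj R x y)" for x
  proof -
    have "F \<inter> {y. (x, y) \<in> R} = {y. (x, y) \<in> R}" using rels_sub[OF R] by blast
    then show ?thesis using finite_F by (simp add: adj_def)
  qed
  have col: "card {x. (x, y) \<in> R} = (\<Sum>x\<in>X. adj R x y)" for y
  proof -
    have "X \<inter> {x. (x, y) \<in> R} = {x. (x, y) \<in> R}" using rels_sub[OF R] by blast
    then show ?thesis using finite_X by (simp add: adj_def)
  qed
  have tot: "card R = (\<Sum>x\<in>X. \<Sum>y\<in>F. adj R x y)"
  proof -
    have "R = (SIGMA x:X. {y. (x, y) \<in> R})" using rels_sub[OF R] by auto
    then have "card R = (\<Sum>x\<in>X. card {y. (x, y) \<in> R})"
      using card_SigmaI[OF finite_X, of "\<lambda>x. {y. (x, y) \<in> R}"] finite_subset[OF _ finite_F] rels_sub[OF R]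
      by (metis (no_types, lifting) mem_Collect_eq mem_Sigma_iff subset_eq)
    then show ?thesis using row by simp
  qed
  have p0: "p > 0" using p_gt_1 by simp
  show r: "card {y. (x, y) \<in> R} = val R" if x: "x \<in> X" for x
  proof -
    have "card R = (\<Sum>x'\<in>X. \<Sum>y\<in>F. adj R x y)"
      unfolding tot by (rule sum.cong) (use cst_row_sum[OF fibX fibF A _ x] in auto)
    then show ?thesis using row[of x] p0 by (simp add: cardX val_def)
  qed
  have rowsum: "(\<Sum>y\<in>F. adj R x y) = val R" if "x \<in> X" for x using r[OF that] row by simp
  show cv: "card R = p * val R"
    unfolding tot using rowsum by (simp add: cardX)
  show "card {x. (x, y) \<in> R} = val R" if y: "y \<in> F" for y
  proof -
    have "card R = (\<Sum>y\<in>F. \<Sum>x\<in>X. adj R x y)" unfolding tot by (rule sum.swap)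
    also have "\<dots> = (\<Sum>y'\<in>F. \<Sum>x\<in>X. adj R x y)"
      by (rule sum.cong) (use cst_row_sum[OF fibF fibX cst_transpose[OF A] _ y] in auto)
    finally show ?thesis using col[of y] p0 by (simp add: cardF val_def)
  qed
  show "val R > 0"
    using cv rel_ne[OF rels_RR[OF R]] finite_rel[OF rels_RR[OF R]] by (metis card_0_eq mult_0_right neq0_conv)
qed

lemma sum_val: "(\<Sum>R\<in>rels. val R) = p"
proof -
  obtain x where x: "x \<in> X" using X_ne by blast
  have "F = (\<Union>R\<in>rels. {y. (x, y) \<in> R})"
  proof
    show "F \<subseteq> (\<Union>R\<in>rels. {y. (x, y) \<in> R})"
    proof
      fix y assume "y \<in> F"
      then obtain R where "R \<in> rels" "(x, y) \<in> R" by (rule rels_ex[OF x])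
      then show "y \<in> (\<Union>R\<in>rels. {y. (x, y) \<in> R})" by blast
    qed
    show "(\<Union>R\<in>rels. {y. (x, y) \<in> R}) \<subseteq> F" using rels_sub by blast
  qed
  moreover have "card (\<Union>R\<in>rels. {y. (x, y) \<in> R}) = (\<Sum>R\<in>rels. card {y. (x, y) \<in> R})"
  proof (rule card_UN_disjoint[OF finite_rels])
    show "\<forall>R\<in>rels. finite {y. (x, y) \<in> R}"
    proof
      fix R assume "R \<in> rels"
      then have "{y. (x, y) \<in> R} \<subseteq> F" using rels_sub by blast
      then show "finite {y. (x, y) \<in> R}" using finite_F by (rule finite_subset)
    qed
    show "\<forall>i\<in>rels. \<forall>j\<in>rels. i \<noteq> j \<longrightarrow> {y. (x, y) \<in> i} \<inter> {y. (x, y) \<in> j} = {}"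
      using rels_unique by blast
  qed
  ultimately show ?thesis using card_row x cardF by simp
qed

text \<open>The \<open>A\<^sub>R\<close> are orthogonal for the trace form and
  \<open>p * val R\<close> is the squared norm of \<open>A\<^sub>R\<close>. So \<open>z\<close> is
  the sum of \<open>B B\<^sup>T\<close> over an orthonormal basis, a Casimir element.\<close>

definition z :: "'a \<Rightarrow> 'a \<Rightarrow> complex" where
  "z x x' = (\<Sum>R\<in>rels. mmul F (adj R) (\<lambda>y x. adj R x y) x x' / (of_nat p * of_nat (val R)))"

text \<open>Below, \<open>lmult A S R\<close> is the coefficient of \<open>A\<^sub>S\<close> in the expansion of \<open>A A\<^sub>R\<close>.\<close>

definition pairing :: "('a \<Rightarrow> 'a \<Rightarrow> complex) \<Rightarrow> ('a \<times> 'a) set \<Rightarrow> ('a \<times> 'a) set \<Rightarrow> complex" where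
  "pairing A S R = (\<Sum>u\<in>X. \<Sum>v\<in>F. adj S u v * mmul X A (adj R) u v)"

definition lmult :: "('a \<Rightarrow> 'a \<Rightarrow> complex) \<Rightarrow> ('a \<times> 'a) set \<Rightarrow> ('a \<times> 'a) set \<Rightarrow> complex" where
  "lmult A S R = pairing A S R / (of_nat p * of_nat (val S))"

lemma pv0: "R \<in> rels \<Longrightarrow> (of_nat p * of_nat (val R) :: complex) \<noteq> 0"
  using val_pos p_gt_1 by fastforce

lemma adj_outside: "R \<in> rels \<Longrightarrow> x \<notin> X \<Longrightarrow> adj R x y = 0" "R \<in> rels \<Longrightarrow> y \<notin> F \<Longrightarrow> adj R x y = 0"
  using rels_sub by (auto simp: adj_def)

lemma lmult_value:
  assumes A: "cst RR A" and S: "S \<in> rels" "(x, y) \<in> S" and R: "R \<in> rels"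
  shows "lmult A S R = mmul X A (adj R) x y"
proof -
  let ?B = "mmul X A (adj R)"
  have B: "cst RR ?B" using cst_mmul[OF fibX A] cst_adj rels_RR[OF R] by blast
  have "pairing A S R = (\<Sum>u\<in>X. \<Sum>v\<in>F. adj S u v * ?B x y)"
    unfolding pairing_def
    by (intro sum.cong refl) (use cstD[OF B rels_RR[OF S(1)] _ S(2)] in \<open>auto simp: adj_def\<close>)
  also have "\<dots> = (\<Sum>u\<in>X. \<Sum>v\<in>F. adj S u v) * ?B x y" by (simp add: sum_distrib_right)
  also have "(\<Sum>u\<in>X. \<Sum>v\<in>F. adj S u v :: complex) = of_nat p * of_nat (val S)"
  proof -
    have "(\<Sum>v\<in>F. adj S u v :: complex) = of_nat (val S)" if "u \<in> X" for u
    proof -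
      have "F \<inter> {v. (u, v) \<in> S} = {v. (u, v) \<in> S}" using rels_sub[OF S(1)] by blast
      then show ?thesis using finite_F card_row[OF S(1) that] by (simp add: adj_def)
    qed
    then show ?thesis by (simp add: cardX)
  qed
  finally show ?thesis unfolding lmult_def using pv0[OF S(1)] by simp
qed

lemma adj_expand:
  assumes A: "cst RR A" and R: "R \<in> rels" and xy: "x \<in> X" "y \<in> F"
  shows "mmul X A (adj R) x y = (\<Sum>S\<in>rels. lmult A S R * adj S x y)"
proof -
  obtain S where S: "S \<in> rels" "(x, y) \<in> S" using rels_ex[OF xy] by blast
  have "(\<Sum>T\<in>rels. lmult A T R * adj T x y) = (\<Sum>T\<in>rels. if T = S then lmult A T R else 0)"
    by (rule sum.cong) (use S rels_unique in \<open>auto simp: adj_def\<close>)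
  also have "\<dots> = lmult A S R" using S finite_rels by simp
  finally show ?thesis using lmult_value[OF A S R] by simp
qed

text \<open>Multiplication by the transpose of \<open>A\<close> is adjoint to multiplication by
  \<open>A\<close>.\<close>

lemma pairing_transpose: "pairing (\<lambda>x y. A y x) R S = pairing A S R"
proof -
  have e: "pairing B Q P = (\<Sum>u\<in>X. \<Sum>w\<in>X. \<Sum>v\<in>F. adj Q u v * B u w * adj P w v)" for B P Q
    unfolding pairing_def mmul_def sum_distrib_left
    by (rule sum.cong[OF refl], subst sum.swap) (simp add: mult_ac)
  show ?thesis unfolding e by (subst sum.swap) (simp add: mult_ac)
qed

lemma cst_z: "cst RR z"
  unfolding z_def
proof (intro cst_sum)
  fix R assume R: "R \<in> rels"
  have A: "cst RR (adj R :: 'a \<Rightarrow> 'a \<Rightarrow> complex)" using cst_adj rels_RR[OF R] by blast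
  then have "cst RR (mmul F (adj R) (\<lambda>y x. adj R x y) :: 'a \<Rightarrow> 'a \<Rightarrow> complex)"
    using cst_mmul[OF fibF A cst_transpose[OF A]] by simp
  then show "cst RR (\<lambda>x x'. mmul F (adj R) (\<lambda>y x. adj R x y) x x' / (of_nat p * of_nat (val R)) :: complex)"
    by (rule cst_map)
qed

lemma z_outside: "x \<notin> X \<Longrightarrow> z x y = 0"
  unfolding z_def mmul_def by (intro sum.neutral ballI) (simp add: adj_outside)

lemma z_sym: "z x y = z y x"
  unfolding z_def mmul_def by (simp add: mult.commute)

lemma z_rat: "z x y \<in> \<rat>"
  unfolding z_def mmul_def by (intro Rats_sum Rats_divide) (auto simp: adj_def)

text \<open>Expanding \<open>A A\<^sub>R\<close> and expanding \<open>A\<^sup>T A\<^sub>S\<close>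
  produce the same double sum, because the coefficients of the two expansions are adjoint to each
  other.\<close>

lemma z_central:
  assumes A: "cst RR A" and x: "x \<in> X" "x' \<in> X"
  shows "mmul X A z x x' = mmul X z A x x'"
proof -
  let ?c = "\<lambda>R. of_nat p * of_nat (val R) :: complex"
  have "mmul X A z x x' = (\<Sum>R\<in>rels. \<Sum>y\<in>F. mmul X A (adj R) x y * adj R x' y / ?c R)"
  proof -
    have "mmul X A z x x' = (\<Sum>w\<in>X. \<Sum>R\<in>rels. \<Sum>y\<in>F. A x w * adj R w y * adj R x' y / ?c R)"
      unfolding mmul_def[of X A z] z_def mmul_def[of F]
      by (simp add: sum_distrib_left sum_divide_distrib mult.assoc)
    also have "\<dots> = (\<Sum>R\<in>rels. \<Sum>y\<in>F. \<Sum>w\<in>X. A x w * adj R w y * adj R x' y / ?c R)"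
      by (subst sum.swap, rule sum.cong, simp, rule sum.swap)
    finally show ?thesis by (simp add: mmul_def sum_distrib_right sum_divide_distrib)
  qed
  also have "\<dots> = (\<Sum>R\<in>rels. \<Sum>y\<in>F. \<Sum>S\<in>rels. pairing A S R * adj S x y * adj R x' y / (?c S * ?c R))"
    by (intro sum.cong refl) (simp add: adj_expand[OF A _ x(1)] lmult_def sum_distrib_right sum_divide_distrib)
  also have "\<dots> = (\<Sum>S\<in>rels. \<Sum>y\<in>F. \<Sum>R\<in>rels. pairing A S R * adj S x y * adj R x' y / (?c S * ?c R))"
    by (rule sum_swap_outer)
  also have "\<dots> = (\<Sum>S\<in>rels. \<Sum>y\<in>F. adj S x y * mmul X (\<lambda>x y. A y x) (adj S) x' y / ?c S)"
  proof (intro sum.cong refl)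
    fix S y assume Sy: "S \<in> rels" "y \<in> F"
    have "mmul X (\<lambda>x y. A y x) (adj S) x' y = (\<Sum>R\<in>rels. pairing A S R / ?c R * adj R x' y)"
      unfolding adj_expand[OF cst_transpose[OF A] Sy(1) x(2) Sy(2)] lmult_def
      by (intro sum.cong refl) (simp only: pairing_transpose[where A = A])
    then show "(\<Sum>R\<in>rels. pairing A S R * adj S x y * adj R x' y / (?c S * ?c R)) =
        adj S x y * mmul X (\<lambda>x y. A y x) (adj S) x' y / ?c S"
      by (simp only: sum_distrib_left sum_divide_distrib) (intro sum.cong refl, simp add: mult_ac)
  qed
  also have "\<dots> = (\<Sum>S\<in>rels. \<Sum>y\<in>F. \<Sum>w\<in>X. adj S x y * adj S w y / ?c S * A w x')"
    unfolding mmul_def by (simp add: sum_distrib_left sum_divide_distrib mult_ac)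
  also have "\<dots> = (\<Sum>w\<in>X. \<Sum>S\<in>rels. \<Sum>y\<in>F. adj S x y * adj S w y / ?c S * A w x')"
    by (rule sum_rotate)
  also have "\<dots> = mmul X z A x x'"
    unfolding mmul_def[of X z A] z_def mmul_def[of F]
    by (simp add: sum_distrib_right sum_divide_distrib)
  finally show ?thesis .
qed

lemma trace_z: "mtrace X (mmul X A z) = (\<Sum>R\<in>rels. lmult A R R)"
proof -
  let ?c = "\<lambda>R. of_nat p * of_nat (val R) :: complex"
  have "mtrace X (mmul X A z) = (\<Sum>x\<in>X. \<Sum>w\<in>X. \<Sum>R\<in>rels. \<Sum>y\<in>F. adj R x y * (A x w * adj R w y) / ?c R)"
    unfolding mtrace_def mmul_def[of X A z] z_def mmul_def[of F]
    by (simp add: sum_distrib_left sum_divide_distrib mult_ac)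
  also have "\<dots> = (\<Sum>x\<in>X. \<Sum>R\<in>rels. \<Sum>w\<in>X. \<Sum>y\<in>F. adj R x y * (A x w * adj R w y) / ?c R)"
    by (intro sum.cong refl sum.swap)
  also have "\<dots> = (\<Sum>R\<in>rels. \<Sum>x\<in>X. \<Sum>w\<in>X. \<Sum>y\<in>F. adj R x y * (A x w * adj R w y) / ?c R)"
    by (rule sum.swap)
  also have "\<dots> = (\<Sum>R\<in>rels. \<Sum>x\<in>X. \<Sum>y\<in>F. \<Sum>w\<in>X. adj R x y * (A x w * adj R w y) / ?c R)"
    by (intro sum.cong refl sum.swap)
  also have "\<dots> = (\<Sum>R\<in>rels. lmult A R R)"
    unfolding lmult_def pairing_def mmul_def by (simp add: sum_distrib_left sum_divide_distrib)
  finally show ?thesis .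
qed

text \<open>Left multiplication is a representation of the algebra on the span of the
  \<open>A\<^sub>R\<close>; in particular it preserves idempotents.\<close>

lemma lmult_mmul:
  assumes A: "cst RR A" and B: "cst RR B" and S: "S \<in> rels" and R: "R \<in> rels"
  shows "lmult (mmul X A B) S R = mmul rels (lmult A) (lmult B) S R"
proof -
  obtain x y where xy: "(x, y) \<in> S" using rel_ne[OF rels_RR[OF S]] by fastforce
  then have x: "x \<in> X" and y: "y \<in> F" using rels_sub[OF S] by auto
  have "lmult (mmul X A B) S R = mmul X A (mmul X B (adj R)) x y"
    using lmult_value[OF cst_mmul[OF fibX A B] S xy R] by (simp add: mmul_assoc)
  also have "\<dots> = (\<Sum>w\<in>X. \<Sum>Q\<in>rels. A x w * (lmult B Q R * adj Q w y))"
    unfolding mmul_def[of X A] by (intro sum.cong refl) (simp add: adj_expand[OF B R _ y] sum_distrib_left)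
  also have "\<dots> = (\<Sum>Q\<in>rels. lmult B Q R * mmul X A (adj Q) x y)"
    by (subst sum.swap) (simp add: mmul_def sum_distrib_left mult_ac)
  also have "\<dots> = mmul rels (lmult A) (lmult B) S R"
    unfolding mmul_def[of rels] by (intro sum.cong refl) (simp add: lmult_value[OF A S xy] mult.commute)
  finally show ?thesis .
qed

text \<open>The all-ones vector is an eigenvector for the eigenvalue 1, so the idempotents of all
  other eigenvalues have row sums 0.\<close>

lemma z_row_sum: "x \<in> X \<Longrightarrow> (\<Sum>x'\<in>X. z x x') = 1"
proof -
  assume x: "x \<in> X"
  have "(\<Sum>x'\<in>X. z x x') = (\<Sum>R\<in>rels. (\<Sum>y\<in>F. adj R x y * (\<Sum>x'\<in>X. adj R x' y)) / (of_nat p * of_nat (val R)))"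
    unfolding z_def mmul_def
    by (subst sum.swap) (simp add: sum_divide_distrib sum_distrib_left sum.swap[of _ F X])
  also have "\<dots> = (\<Sum>R\<in>rels. of_nat (val R) / of_nat p)"
  proof (rule sum.cong[OF refl])
    fix R assume R: "R \<in> rels"
    have "(\<Sum>x'\<in>X. adj R x' y :: complex) = of_nat (val R)" if "y \<in> F" for y
    proof -
      have "X \<inter> {x. (x, y) \<in> R} = {x. (x, y) \<in> R}" using rels_sub[OF R] by blast
      then show ?thesis using finite_X card_col[OF R that] by (simp add: adj_def)
    qed
    moreover have "(\<Sum>y\<in>F. adj R x y :: complex) = of_nat (val R)"
    proof -
      have "F \<inter> {y. (x, y) \<in> R} = {y. (x, y) \<in> R}" using rels_sub[OF R] by blast
      then show ?thesis using finite_F card_row[OF R x] by (simp add: adj_def)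
    qed
    ultimately have "(\<Sum>y\<in>F. adj R x y * (\<Sum>x'\<in>X. adj R x' y :: complex)) = of_nat (val R) * of_nat (val R)"
      by (simp flip: sum_distrib_right)
    then show "(\<Sum>y\<in>F. adj R x y * (\<Sum>x'\<in>X. adj R x' y)) / (of_nat p * of_nat (val R)) = of_nat (val R) / (of_nat p :: complex)"
      using pv0[OF R] by simp
  qed
  also have "\<dots> = of_nat (\<Sum>R\<in>rels. val R) / of_nat p" by (simp add: sum_divide_distrib)
  also have "\<dots> = 1" using sum_val p_gt_1 by simp
  finally show ?thesis .
qed

end

section \<open>The spectrum of the central element\<close>

lemma coeff_prod_linear_Rats:
  fixes r :: "nat \<Rightarrow> complex"
  assumes "\<And>i. i < n \<Longrightarrow> r i \<in> \<rat>"
  shows "coeff (\<Prod>i<n. [:- r i, 1:]) j \<in> \<rat>"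
  using assms
proof (induction n arbitrary: j)
  case 0
  then show ?case by (cases j) auto
next
  case (Suc n)
  have "coeff (\<Prod>i<Suc n. [:- r i, 1:]) j = coeff (pCons 0 (\<Prod>i<n. [:- r i, 1:])) j - r n * coeff (\<Prod>i<n. [:- r i, 1:]) j"
    by (simp add: mult.commute)
  also have "\<dots> \<in> \<rat>" using Suc by (cases j) (auto simp: coeff_pCons intro!: Rats_diff Rats_mult)
  finally show ?case .
qed

lemma mpow_Rats: "(\<And>x y. z x y \<in> \<rat>) \<Longrightarrow> mpow X z i x y \<in> (\<rat> :: complex set)"
  by (induction i arbitrary: x) (auto simp: mid_def mmul_def intro!: Rats_sum Rats_mult)

context prime_fibers
begin

lemma lmult_cong: "(\<And>x y. x \<in> X \<Longrightarrow> y \<in> X \<Longrightarrow> A x y = B x y) \<Longrightarrow> lmult A = lmult B"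
  unfolding lmult_def pairing_def mmul_def by (intro ext arg_cong2[where f = "(/)"] sum.cong refl) simp

lemma cst_peval:
  fixes w :: "'a \<Rightarrow> 'a \<Rightarrow> complex"
  shows "cst RR w \<Longrightarrow> cst RR (peval X w f)"
  unfolding peval_def
  by (intro cst_sum cst_map[where f = "\<lambda>a. coeff f _ * a"] cst_mpow[OF fibX])

text \<open>By \<open>trace_z\<close> this is the trace of the idempotent \<open>lmult e\<close>,
  hence a rank.\<close>

lemma idempotent_trace_z:
  assumes e: "cst RR e" and idem: "\<And>x y. x \<in> X \<Longrightarrow> y \<in> X \<Longrightarrow> mmul X e e x y = e x y"
  shows "\<exists>n. mtrace X (mmul X e z) = of_nat n"
proof -
  have "mmul rels (lmult e) (lmult e) S R = lmult e S R" if "S \<in> rels" "R \<in> rels" for S R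
    using lmult_mmul[OF e e that] lmult_cong[of "mmul X e e" e] idem by simp
  note L_idem = this
  obtain n where "mtrace rels (lmult e) = of_nat n"
    by (rule field_val.idempotent_factorization[OF finite_rels L_idem], assumption+)
  then show ?thesis using trace_z[of e] by (auto simp: mtrace_def[of rels])
qed

text \<open>If some eigenvalue differs from 1, its spectral idempotent is rational, nonzero and has
  row sums 0, so it is \<open>I - J / p\<close> and determines \<open>z\<close> off the diagonal. If
  1 is the only eigenvalue, \<open>z\<close> is the identity on \<open>X\<close>.\<close>

lemma z_offdiag: "\<exists>b. \<forall>x\<in>X. \<forall>x'\<in>X. x \<noteq> x' \<longrightarrow> z x x' = b"
proof -
  have real: "cnj (z x y) = z x y" for x y
    unfolding z_def mmul_def by (simp add: adj_def of_bool_def if_distrib[of cnj] cong: if_cong)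
  obtain f where f0: "f \<noteq> 0" and fz: "\<And>x y. x \<in> X \<Longrightarrow> y \<in> X \<Longrightarrow> peval X z f x y = 0"
    and roots: "\<And>l. poly f l = 0 \<Longrightarrow> \<exists>g. f = [:-l, 1:] * g \<and> poly g l \<noteq> 0 \<and> (\<exists>x\<in>X. \<exists>y\<in>X. peval X z g x y \<noteq> 0)"
    by (rule real_symmetric_annihilator[OF finite_X z_outside z_sym real], assumption) (rule that)
  have pm: "peval X z (g * h) = mmul X (peval X z g) (peval X z h)" for g h
    by (rule peval_mult[OF finite_X z_outside])
  have zcol: "y \<notin> X \<Longrightarrow> z x y = 0" for x y using z_outside z_sym by metis
  have pz: "peval X z [:0, 1:] x y = z x y" for x y
  proof -
    have one: "peval X z [:1:] = mid X" by (intro ext) (simp add: peval_def)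
    have "peval X z (pCons 0 [:1:]) x y = mmul X z (mid X) x y"
      unfolding peval_pCons one by simp
    also have "\<dots> = z x y" by (rule mmul_mid_right[OF finite_X]) (rule zcol)
    finally show ?thesis by simp
  qed
  \<comment> \<open>Modulo \<open>[:-l, 1:]\<close> the polynomial \<open>h\<close> is the constant
    \<open>poly h l\<close>, and \<open>[:-l, 1:] * g\<close> evaluates to 0. So \<open>h(z)\<close>
    acts as this scalar on the image of \<open>g(z)\<close>.\<close>
  have act: "mmul X (peval X z h) (peval X z g) x y = poly h l * peval X z g x y"
    if g: "f = [:-l, 1:] * g" and xy: "x \<in> X" "y \<in> X" for h g l x y
  proof -
    have "h * g = ([:-l, 1:] * synthetic_div h l + [:poly h l:]) * g" by (simp only: synthetic_div_correct')
    also have "\<dots> = synthetic_div h l * f + [:poly h l:] * g"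
      unfolding g distrib_right by (simp only: mult_ac)
    also have "[:poly h l:] * g = smult (poly h l) g" by simp
    finally have "peval X z (h * g) x y = peval X z (synthetic_div h l * f) x y + poly h l * peval X z g x y"
      by (simp only: peval_add peval_smult)
    moreover have "peval X z (synthetic_div h l * f) x y = 0" unfolding pm mmul_def using fz xy by simp
    ultimately show ?thesis by (simp add: pm)
  qed
  have zact: "mmul X z (peval X z g) x y = l * peval X z g x y" if g: "f = [:-l, 1:] * g" and xy: "x \<in> X" "y \<in> X" for g l x y
    using act[OF that, of "[:0, 1:]"] pz by (simp add: mmul_def)
  \<comment> \<open>The spectral idempotent for \<open>l\<close>; the division is legitimate because
    the root is simple.\<close>
  define E where "E g l = (\<lambda>x y. peval X z g x y / poly g l)" for g l
  have Ecst: "cst RR (E g l)" for g l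
    unfolding E_def by (rule cst_map[OF cst_peval[OF cst_z]])
  have Eidem: "mmul X (E g l) (E g l) x y = E g l x y"
    if "f = [:-l, 1:] * g" "poly g l \<noteq> 0" "x \<in> X" "y \<in> X" for g l x y
  proof -
    have "mmul X (E g l) (E g l) x y = mmul X (peval X z g) (peval X z g) x y / (poly g l * poly g l)"
      unfolding E_def mmul_def by (simp add: sum_divide_distrib)
    then show ?thesis using act[OF that(1,3,4), of g] that(2) by (simp add: E_def)
  qed
  have zE: "mmul X z (E g l) x y = l * E g l x y" if "f = [:-l, 1:] * g" "x \<in> X" "y \<in> X" for g l x y
    using zact[OF that] by (simp add: E_def mmul_def flip: sum_divide_distrib)
  have Ez: "mmul X (E g l) z x y = l * E g l x y" if "f = [:-l, 1:] * g" "x \<in> X" "y \<in> X" for g l x y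
    using zE[OF that] z_central[OF Ecst that(2,3)] by simp
  \<comment> \<open>\<open>l\<close> times the rank of its idempotent is a trace
    \<open>mtrace X (mmul X E z)\<close>, which is a natural number.\<close>
  have rat: "l \<in> \<rat>" if l: "poly f l = 0" for l
  proof -
    obtain g where g: "f = [:-l, 1:] * g" "poly g l \<noteq> 0" and ne: "\<exists>x\<in>X. \<exists>y\<in>X. peval X z g x y \<noteq> 0"
      using roots[OF l] by blast
    have id: "\<And>x y. x \<in> X \<Longrightarrow> y \<in> X \<Longrightarrow> mmul X (E g l) (E g l) x y = E g l x y" by (rule Eidem[OF g])
    obtain n where n: "mtrace X (mmul X (E g l) z) = of_nat n" using idempotent_trace_z[OF Ecst id] by blast
    obtain Y M where Y: "Y \<subseteq> X" "\<And>x z. x \<in> X \<Longrightarrow> z \<in> X \<Longrightarrow> E g l x z = mmul Y (E g l) M x z"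
      "mtrace X (E g l) = of_nat (card Y)"
      by (rule field_val.idempotent_factorization[OF finite_X id], assumption+) (rule that)
    have "card Y \<noteq> 0"
    proof
      assume "card Y = 0"
      then have "Y = {}" using finite_subset[OF Y(1) finite_X] by simp
      then have "E g l x y = 0" if "x \<in> X" "y \<in> X" for x y using Y(2)[OF that] by (simp add: mmul_def)
      then show False using ne g(2) by (auto simp: E_def)
    qed
    moreover have "mtrace X (mmul X (E g l) z) = l * mtrace X (E g l)"
      unfolding mtrace_def sum_distrib_left by (intro sum.cong refl Ez[OF g(1)])
    ultimately have "l = of_nat n / of_nat (card Y)" using n Y(3) by (simp add: field_simps)
    then show ?thesis by (metis Rats_divide Rats_of_nat)
  qed
  obtain x0 where x0: "x0 \<in> X" using X_ne by blast
  show ?thesis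
  proof (cases "\<exists>l. poly f l = 0 \<and> l \<noteq> 1")
    case True
    then obtain l where l: "poly f l = 0" "l \<noteq> 1" by blast
    obtain g where g: "f = [:-l, 1:] * g" "poly g l \<noteq> 0" and ne: "\<exists>x\<in>X. \<exists>y\<in>X. peval X z g x y \<noteq> 0"
      using roots[OF l(1)] by blast
    obtain r where r: "smult (lead_coeff g) (\<Prod>i<degree g. [:- r i, 1:]) = g"
      using complex_poly_decompose'[of g] by blast
    \<comment> \<open>The roots of \<open>g\<close> are eigenvalues too, hence rational, so the
      monic \<open>q\<close> has rational coefficients. The leading coefficient of \<open>g\<close>
      may be irrational but cancels in \<open>E\<close>.\<close>
    define q where "q = (\<Prod>i<degree g. [:- r i, 1:])"
    have gq: "g = smult (lead_coeff g) q" using r by (simp add: q_def)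
    have lc: "lead_coeff g \<noteq> 0" using g(2) by auto
    have "r i \<in> \<rat>" if "i < degree g" for i
    proof (rule rat)
      have "poly q (r i) = 0" unfolding q_def poly_prod using that by (intro prod_zero) auto
      then have "poly g (r i) = 0" by (subst gq) simp
      then show "poly f (r i) = 0" using g(1) by simp
    qed
    then have qc: "coeff q j \<in> \<rat>" for j unfolding q_def by (rule coeff_prod_linear_Rats)
    have Eq: "E g l x y = peval X z q x y / poly q l" for x y
    proof -
      have "peval X z g x y = lead_coeff g * peval X z q x y" by (subst gq) (rule peval_smult)
      moreover have "poly g l = lead_coeff g * poly q l" by (subst gq) simp
      ultimately show ?thesis using lc by (simp add: E_def)
    qed
    have "E g l x y \<in> \<rat>" for x y
      unfolding Eq peval_def poly_altdef
      by (intro Rats_divide Rats_sum Rats_mult Rats_power qc rat[OF l(1)] mpow_Rats z_rat)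
    then have "\<forall>x y. \<exists>q. E g l x y = of_rat q" unfolding Rats_def by blast
    then obtain e where e: "\<And>x y. E g l x y = of_rat (e x y)" by metis
    have ecst: "cst RR e"
      unfolding cst_def
    proof (intro ballI allI impI)
      fix R u v u' v' assume "R \<in> RR" "(u, v) \<in> R" "(u', v') \<in> R"
      then have "E g l u v = E g l u' v'" by (rule cstD[OF Ecst])
      then show "e u v = e u' v'" by (simp only: e of_rat_eq_iff)
    qed
    have em: "of_rat (mmul X A B x y) = mmul X (\<lambda>x y. of_rat (A x y)) (\<lambda>x y. of_rat (B x y) :: complex) x y" for A B x y
      by (simp add: mmul_def of_rat_sum of_rat_mult)
    have triv: "(\<forall>x\<in>X. \<forall>y\<in>X. e x y = 0) \<or> (\<forall>x\<in>X. \<forall>y\<in>X. e x y = of_bool (x = y) - 1 / of_nat p)"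
    proof (rule central_idempotent_trivial[OF ecst])
      fix x y assume xy: "x \<in> X" "y \<in> X"
      have "(of_rat (mmul X e e x y) :: complex) = of_rat (e x y)"
        unfolding em e[symmetric] using Eidem[OF g xy] by simp
      then show "mmul X e e x y = e x y" by (simp only: of_rat_eq_iff)
    next
      fix A :: "'a \<Rightarrow> 'a \<Rightarrow> rat" and x y assume A: "cst RR A" and xy: "x \<in> X" "y \<in> X"
      define A' where "A' = (\<lambda>x y. of_rat (A x y) :: complex)"
      have "cst RR A'" unfolding A'_def by (rule cst_map[OF A])
      then have "mmul X A' (peval X z g) x y = mmul X (peval X z g) A' x y"
        using peval_commute[OF finite_X z_central xy] by blast
      then have "mmul X (E g l) A' x y = mmul X A' (E g l) x y"
        by (simp add: E_def mmul_def flip: sum_divide_distrib)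
      then have "(of_rat (mmul X e A x y) :: complex) = of_rat (mmul X A e x y)"
        unfolding em A'_def[symmetric] e[symmetric] .
      then show "mmul X e A x y = mmul X A e x y" by (simp only: of_rat_eq_iff)
    next
      fix x assume x: "x \<in> X"
      have "l * (\<Sum>y\<in>X. E g l x y) = (\<Sum>y\<in>X. mmul X (E g l) z x y)"
        unfolding sum_distrib_left by (intro sum.cong refl) (simp add: Ez[OF g(1) x])
      also have "\<dots> = (\<Sum>w\<in>X. E g l x w * (\<Sum>y\<in>X. z w y))"
        unfolding mmul_def sum_distrib_left by (rule sum.swap)
      also have "\<dots> = (\<Sum>y\<in>X. E g l x y)" by (intro sum.cong refl) (simp add: z_row_sum)
      finally have "(\<Sum>y\<in>X. E g l x y) = 0" using l(2) by simp
      then have "(of_rat (\<Sum>y\<in>X. e x y) :: complex) = of_rat 0" by (simp add: of_rat_sum e)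
      then show "(\<Sum>y\<in>X. e x y) = 0" by (simp only: of_rat_eq_iff)
    qed
    have "\<not> (\<forall>x\<in>X. \<forall>y\<in>X. e x y = 0)"
    proof
      assume "\<forall>x\<in>X. \<forall>y\<in>X. e x y = 0"
      then have "\<forall>x\<in>X. \<forall>y\<in>X. E g l x y = 0" by (simp add: e)
      then show False using ne g(2) by (auto simp: E_def)
    qed
    then have ev: "E g l x y = of_bool (x = y) - 1 / of_nat p" if "x \<in> X" "y \<in> X" for x y
      using triv that e by (auto simp: of_rat_diff of_rat_divide of_rat_minus)
    \<comment> \<open>Comparing \<open>z E = z - J / p\<close> with \<open>z E = l E\<close> off the
      diagonal.\<close>
    have "z x y = (1 - l) / of_nat p" if "x \<in> X" "y \<in> X" "x \<noteq> y" for x y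
    proof -
      have "mmul X z (E g l) x y = (\<Sum>w\<in>X. (if w = y then z x w else 0) - z x w / of_nat p)"
        unfolding mmul_def by (rule sum.cong) (auto simp: ev that algebra_simps)
      also have "\<dots> = z x y - 1 / of_nat p"
        using z_row_sum[OF that(1)] finite_X that(2) by (simp add: sum_subtractf flip: sum_divide_distrib)
      finally show ?thesis using zE[OF g(1) that(1,2)] ev[OF that(1,2)] that(3) p_gt_1
        by (simp add: field_simps)
    qed
    then show ?thesis by blast
  next
    case False
    have "degree f \<noteq> 0"
    proof
      assume "degree f = 0"
      then obtain c where c: "f = [:c:]" using degree_eq_zeroE by blast
      then have "peval X z f x0 x0 = c" using x0 by (simp add: peval_def mid_def)
      then show False using fz x0 c f0 by simp
    qed
    then have "\<not> constant (poly f)" by (simp add: constant_degree)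
    then obtain l where "poly f l = 0" using fundamental_theorem_of_algebra by blast
    then have "poly f 1 = 0" using False by auto
    then obtain g where g: "f = [:-1, 1:] * g" "poly g 1 \<noteq> 0" using roots by blast
    \<comment> \<open>The only root 1 is simple, so \<open>f\<close> is a constant multiple of
      \<open>[:-1, 1:]\<close> and \<open>z\<close> acts as the identity.\<close>
    have "constant (poly g)"
    proof (rule ccontr)
      assume "\<not> constant (poly g)"
      then obtain l where "poly g l = 0" using fundamental_theorem_of_algebra by blast
      then show False using False g by (cases "l = 1") auto
    qed
    then obtain c where c: "g = [:c:]" using constant_degree degree_eq_zeroE by metis
    have "c \<noteq> 0" using c g(2) by auto
    have "z x y = 0" if "x \<in> X" "y \<in> X" "x \<noteq> y" for x y
    proof -
      have "mmul X z (peval X z g) x y = c * mmul X z (mid X) x y"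
        by (simp add: c peval_def mmul_def sum_distrib_left mult_ac)
      also have "mmul X z (mid X) x y = z x y" by (rule mmul_mid_right[OF finite_X]) (rule zcol)
      finally show ?thesis using zact[OF g(1) that(1,2)] \<open>c \<noteq> 0\<close> that(3) by (simp add: c peval_def mid_def)
    qed
    then show ?thesis by blast
  qed
qed

lemma z_real: "z x x' = of_real (\<Sum>R\<in>rels. real (card {y. (x, y) \<in> R \<and> (x', y) \<in> R}) / real (val R)) / of_nat p"
proof -
  have "mmul F (adj R) (\<lambda>y x. adj R x y) x x' = (of_nat (card {y. (x, y) \<in> R \<and> (x', y) \<in> R}) :: complex)" if "R \<in> rels" for R
  proof -
    have "F \<inter> {y. (x, y) \<in> R \<and> (x', y) \<in> R} = {y. (x, y) \<in> R \<and> (x', y) \<in> R}" using rels_sub[OF that] by blast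
    then show ?thesis using finite_F by (simp add: mmul_def adj_def flip: of_bool_conj)
  qed
  then show ?thesis unfolding z_def by (simp add: sum_divide_distrib divide_divide_eq_left mult.commute)
qed

text \<open>The sum is \<open>p\<close> times an off-diagonal entry of \<open>z\<close>, hence the
  same for all pairs. The common value follows from the row sums 1, as each diagonal entry of
  \<open>z\<close> is \<open>card rels / p\<close>.\<close>

theorem indistinguishing:
  assumes "x \<in> X" "x' \<in> X" "x \<noteq> x'"
  shows "(\<Sum>R\<in>rels. real (card {y. (x, y) \<in> R \<and> (x', y) \<in> R}) / real (val R))
    = (real p - real (card rels)) / (real p - 1)"
proof -
  define w where "w x x' = (\<Sum>R\<in>rels. real (card {y. (x, y) \<in> R \<and> (x', y) \<in> R}) / real (val R))" for x x'
  have zw: "z x x' = of_real (w x x') / of_nat p" for x x' by (simp add: z_real w_def)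
  have p0: "real p > 1" using p_gt_1 by simp
  obtain b where b: "\<And>x x'. x \<in> X \<Longrightarrow> x' \<in> X \<Longrightarrow> x \<noteq> x' \<Longrightarrow> z x x' = b" using z_offdiag by blast
  have diag: "w x x = real (card rels)"
  proof -
    have "w x x = (\<Sum>R\<in>rels. 1)"
      unfolding w_def by (rule sum.cong) (use card_row[OF _ assms(1)] val_pos in \<open>auto simp: less_imp_neq\<close>)
    then show ?thesis by simp
  qed
  have off: "w x v = w x x'" if "v \<in> X - {x}" for v
  proof -
    have "z x v = z x x'" using b[of x v] b[of x x'] assms that by auto
    then show ?thesis using p0 by (simp add: zw)
  qed
  have "(\<Sum>v\<in>X. w x v) = w x x + (\<Sum>v\<in>X - {x}. w x v)" using finite_X assms by (simp add: sum.remove)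
  also have "(\<Sum>v\<in>X - {x}. w x v) = (\<Sum>v\<in>X - {x}. w x x')" by (rule sum.cong) (use off in auto)
  also have "\<dots> = (real p - 1) * w x x'" using assms finite_X p_gt_1 by (simp add: cardX of_nat_diff)
  finally have tot: "(\<Sum>v\<in>X. w x v) = real (card rels) + (real p - 1) * w x x'" using diag by simp
  have "of_real (\<Sum>v\<in>X. w x v) / of_nat p = (1 :: complex)"
    using z_row_sum[OF assms(1)] by (simp add: zw flip: sum_divide_distrib)
  then have "complex_of_real (\<Sum>v\<in>X. w x v) = of_real (real p)" using p0 by (simp add: field_simps)
  then have "(\<Sum>v\<in>X. w x v) = real p" using of_real_eq_iff by blast
  then show ?thesis using tot p0 by (simp add: w_def field_simps)
qed

end

section \<open>Intersection numbers\<close>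

context prime_fibers
begin

lemma row_sum_rels:
  fixes g :: "'a \<Rightarrow> 'f::comm_semiring_1"
  assumes x: "x \<in> X" and h: "\<And>R y. R \<in> rels \<Longrightarrow> (x, y) \<in> R \<Longrightarrow> g y = h R"
  shows "(\<Sum>y\<in>F. g y) = (\<Sum>R\<in>rels. of_nat (val R) * h R)"
proof -
  have "(\<Sum>R\<in>rels. of_nat (val R) * h R) = (\<Sum>R\<in>rels. \<Sum>y\<in>F. of_bool ((x, y) \<in> R) * g y)"
  proof (rule sum.cong[OF refl])
    fix R assume R: "R \<in> rels"
    have "F \<inter> {y. (x, y) \<in> R} = {y. (x, y) \<in> R}" using rels_sub[OF R] by blast
    then have "of_nat (val R) = (\<Sum>y\<in>F. of_bool ((x, y) \<in> R) :: 'f)"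
      using finite_F card_row[OF R x] by simp
    then have "of_nat (val R) * h R = (\<Sum>y\<in>F. of_bool ((x, y) \<in> R) * h R)" by (simp only: sum_distrib_right)
    also have "\<dots> = (\<Sum>y\<in>F. of_bool ((x, y) \<in> R) * g y)" by (rule sum.cong) (use h[OF R] in auto)
    finally show "of_nat (val R) * h R = (\<Sum>y\<in>F. of_bool ((x, y) \<in> R) * g y)" .
  qed
  also have "\<dots> = (\<Sum>y\<in>F. \<Sum>R\<in>rels. of_bool ((x, y) \<in> R) * g y)" by (rule sum.swap)
  also have "\<dots> = (\<Sum>y\<in>F. g y)"
  proof (rule sum.cong[OF refl])
    fix y assume "y \<in> F"
    then obtain S where S: "S \<in> rels" "(x, y) \<in> S" by (rule rels_ex[OF x])
    have "(\<Sum>R\<in>rels. of_bool ((x, y) \<in> R) * g y) = (\<Sum>R\<in>rels. if R = S then g y else 0)"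
      by (rule sum.cong) (use S rels_unique in auto)
    then show "(\<Sum>R\<in>rels. of_bool ((x, y) \<in> R) * g y) = g y" using S finite_rels by simp
  qed
  finally show ?thesis by simp
qed

lemma sum_rels:
  fixes g :: "'a \<Rightarrow> 'a \<Rightarrow> 'f::comm_semiring_1"
  assumes h: "\<And>R x y. R \<in> rels \<Longrightarrow> (x, y) \<in> R \<Longrightarrow> g x y = h R"
  shows "(\<Sum>x\<in>X. \<Sum>y\<in>F. g x y) = of_nat p * (\<Sum>R\<in>rels. of_nat (val R) * h R)"
proof -
  have "(\<Sum>x\<in>X. \<Sum>y\<in>F. g x y) = (\<Sum>x\<in>X. \<Sum>R\<in>rels. of_nat (val R) * h R)"
    by (intro sum.cong refl row_sum_rels h)
  then show ?thesis by (simp add: cardX)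
qed

lemma adj_rel: "T \<in> rels \<Longrightarrow> U \<in> rels \<Longrightarrow> (x, y) \<in> U \<Longrightarrow> adj T x y = of_bool (U = T)"
  using rels_unique by (auto simp: adj_def)

lemma rel_pick:
  assumes "R \<in> rels"
  obtains x y where "(x, y) \<in> R" "x \<in> X" "y \<in> F"
  using rel_ne[OF rels_RR[OF assms]] rels_sub[OF assms] by fast

end

section \<open>Intersection numbers for two fibers of the same prime size\<close>

locale fiber_pair = coherent V RR for V :: "'a set" and RR +
  fixes X Y :: "'a set" and p :: nat
  assumes fiber_X: "fiber V RR X" and fiber_Y: "fiber V RR Y"
    and card_X: "card X = p" and card_Y: "card Y = p" and p_prime: "prime p"
begin

sublocale xx: prime_fibers V RR X p X
  by unfold_locales (use fiber_X card_X p_prime in auto)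
sublocale xy: prime_fibers V RR X p Y
  by unfold_locales (use fiber_Y card_Y in auto)
sublocale yx: prime_fibers V RR Y p X
  by unfold_locales (use fiber_X fiber_Y card_X card_Y p_prime in auto)
sublocale yy: prime_fibers V RR Y p Y
  by unfold_locales (use fiber_Y card_Y in auto)

lemma flip: "fiber_pair V RR Y X p"
  by unfold_locales (use fiber_X fiber_Y card_X card_Y p_prime in auto)

lemma Id_rel: "Id_on X \<in> xx.rels"
  using fiber_X by (auto simp: xx.rels_def rels_between_def fiber_def)

lemma val_Id: "xx.val (Id_on X) = 1"
proof -
  obtain x where x: "x \<in> X" using xx.X_ne by blast
  then have "{y. (x, y) \<in> Id_on X} = {x}" by auto
  then show ?thesis using xx.card_row[OF Id_rel x] by simp
qed

lemma rel_offdiag: "T \<in> xx.rels \<Longrightarrow> T \<noteq> Id_on X \<Longrightarrow> (x, x') \<in> T \<Longrightarrow> x \<noteq> x'"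
  using xx.rels_unique[OF _ Id_rel] xx.rels_sub by blast

lemma conv_rel: "R \<in> xy.rels \<Longrightarrow> R\<inverse> \<in> yx.rels" "R \<in> xx.rels \<Longrightarrow> R\<inverse> \<in> xx.rels"
  using conv_RR by (auto simp: xx.rels_def xy.rels_def yx.rels_def rels_between_def)

lemma val_conv: "xx.val (R\<inverse>) = xx.val R"
  by (simp add: xx.val_def)

text \<open>The \<open>(x, x')\<close> entry of \<open>A\<^sub>R A\<^sub>S\<^sup>T\<close>.
  Accordingly \<open>inum R S T\<close> is the coefficient of \<open>A\<^sub>T\<close> in this
  product, and \<open>tnum T S R\<close> is the coefficient of \<open>A\<^sub>R\<close> in
  \<open>A\<^sub>T A\<^sub>S\<close>.\<close>

definition common :: "('a \<times> 'a) set \<Rightarrow> ('a \<times> 'a) set \<Rightarrow> 'a \<Rightarrow> 'a \<Rightarrow> nat" where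
  "common R S x x' = card {y. (x, y) \<in> R \<and> (x', y) \<in> S}"

text \<open>In the next two definitions any pair of the relation serves, because intersection numbers do not
  depend on the pair.\<close>

definition inum :: "('a \<times> 'a) set \<Rightarrow> ('a \<times> 'a) set \<Rightarrow> ('a \<times> 'a) set \<Rightarrow> nat" where
  "inum R S T = (case SOME t. t \<in> T of (x, x') \<Rightarrow> common R S x x')"

definition tnum :: "('a \<times> 'a) set \<Rightarrow> ('a \<times> 'a) set \<Rightarrow> ('a \<times> 'a) set \<Rightarrow> nat" where
  "tnum T S R = (case SOME t. t \<in> R of (x, y) \<Rightarrow> card {x'. (x, x') \<in> T \<and> (x', y) \<in> S})"

lemma inum_eq:
  assumes "R \<in> RR" "S \<in> RR" "T \<in> RR" "(x, x') \<in> T"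
  shows "common R S x x' = inum R S T"
proof -
  have *: "common R S u v = card {y. (u, y) \<in> R \<and> (y, v) \<in> S\<inverse>}" for u v by (simp add: common_def)
  obtain u v where uv: "(SOME t. t \<in> T) = (u, v)" by fastforce
  have "(SOME t. t \<in> T) \<in> T" by (rule someI[of "\<lambda>t. t \<in> T", OF assms(4)])
  then have "(u, v) \<in> T" using uv by simp
  then show ?thesis
    unfolding inum_def uv * prod.case by (rule intersection_number[OF assms(1) conv_RR[OF assms(2)] assms(3,4)])
qed

lemma tnum_eq:
  assumes "T \<in> RR" "S \<in> RR" "R \<in> RR" "(x, y) \<in> R"
  shows "card {x'. (x, x') \<in> T \<and> (x', y) \<in> S} = tnum T S R"
proof -
  obtain u v where uv: "(SOME t. t \<in> R) = (u, v)" by fastforce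
  have "(SOME t. t \<in> R) \<in> R" by (rule someI[of "\<lambda>t. t \<in> R", OF assms(4)])
  then have "(u, v) \<in> R" using uv by simp
  then show ?thesis unfolding tnum_def uv prod.case by (rule intersection_number[OF assms])
qed

lemma common_sum:
  assumes "R \<in> xy.rels"
  shows "common R S x x' = (\<Sum>y\<in>Y. adj R x y * adj S x' y)"
proof -
  have "Y \<inter> {y. (x, y) \<in> R \<and> (x', y) \<in> S} = {y. (x, y) \<in> R \<and> (x', y) \<in> S}" using xy.rels_sub[OF assms] by blast
  then show ?thesis using xy.finite_F by (simp add: common_def adj_def flip: of_bool_conj)
qed

lemma adj_row: "R \<in> xy.rels \<Longrightarrow> x \<in> X \<Longrightarrow> (\<Sum>y\<in>Y. adj R x y) = xx.val R"
proof -
  assume R: "R \<in> xy.rels" and x: "x \<in> X"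
  have "Y \<inter> {y. (x, y) \<in> R} = {y. (x, y) \<in> R}" using xy.rels_sub[OF R] by blast
  then show ?thesis using xy.finite_F xy.card_row[OF R x] by (simp add: adj_def)
qed

lemma adj_col: "R \<in> xy.rels \<Longrightarrow> y \<in> Y \<Longrightarrow> (\<Sum>x\<in>X. adj R x y) = xx.val R"
proof -
  assume R: "R \<in> xy.rels" and y: "y \<in> Y"
  have "X \<inter> {x. (x, y) \<in> R} = {x. (x, y) \<in> R}" using xy.rels_sub[OF R] by blast
  then show ?thesis using xx.finite_X xy.card_col[OF R y] by (simp add: adj_def)
qed

lemma inum_rels: "R \<in> xy.rels \<Longrightarrow> S \<in> xy.rels \<Longrightarrow> T \<in> xx.rels \<Longrightarrow> (x, x') \<in> T \<Longrightarrow> common R S x x' = inum R S T"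
  using inum_eq xy.rels_RR xx.rels_RR by blast

text \<open>Both sides are a row sum of \<open>A\<^sub>R A\<^sub>S\<^sup>T\<close>.\<close>

lemma sum_inum:
  assumes R: "R \<in> xy.rels" and S: "S \<in> xy.rels"
  shows "(\<Sum>T\<in>xx.rels. xx.val T * inum R S T) = xx.val R * xx.val S"
proof -
  obtain x where x: "x \<in> X" using xx.X_ne by blast
  have "(\<Sum>x'\<in>X. common R S x x') = (\<Sum>T\<in>xx.rels. of_nat (xx.val T) * inum R S T)"
    by (rule xx.row_sum_rels[OF x]) (rule inum_rels[OF R S])
  moreover have "(\<Sum>x'\<in>X. common R S x x') = (\<Sum>y\<in>Y. adj R x y * (\<Sum>x'\<in>X. adj S x' y))"
    unfolding common_sum[OF R] sum_distrib_left by (rule sum.swap)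
  moreover have "\<dots> = (\<Sum>y\<in>Y. adj R x y) * xx.val S"
    unfolding sum_distrib_right by (intro sum.cong refl) (simp add: adj_col[OF S])
  ultimately show ?thesis using adj_row[OF R x] by simp
qed

lemma inum_Id:
  assumes R: "R \<in> xy.rels" and S: "S \<in> xy.rels"
  shows "inum R S (Id_on X) = (if R = S then xx.val R else 0)"
proof -
  obtain x where x: "x \<in> X" using xx.X_ne by blast
  have "inum R S (Id_on X) = common R S x x" using inum_rels[OF R S Id_rel Id_onI[OF x]] by simp
  moreover have "common R S x x = (if R = S then xx.val R else 0)"
  proof (cases "R = S")
    case True
    then show ?thesis using xy.card_row[OF R x] by (simp add: common_def)
  next
    case False
    then have E: "{y. (x, y) \<in> R \<and> (x, y) \<in> S} = {}" using xy.rels_unique[OF R S] by blast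
    show ?thesis unfolding common_def E using False by simp
  qed
  ultimately show ?thesis by simp
qed

text \<open>Both sides count the triangles \<open>(x, x') \<in> T\<close>, \<open>(x, y) \<in> R\<close>, \<open>(x', y) \<in> S\<close>, divided by \<open>p\<close>.\<close>

lemma triangle_count:
  assumes R: "R \<in> xy.rels" and S: "S \<in> xy.rels" and T: "T \<in> xx.rels"
  shows "xx.val T * inum R S T = xx.val R * tnum T S R"
proof -
  have "(\<Sum>x\<in>X. \<Sum>x'\<in>X. adj T x x' * common R S x x') = of_nat p * (\<Sum>U\<in>xx.rels. of_nat (xx.val U) * (of_bool (U = T) * inum R S U))"
    by (rule xx.sum_rels) (simp add: inum_rels[OF R S] xx.adj_rel[OF T])
  also have "(\<Sum>U\<in>xx.rels. of_nat (xx.val U) * (of_bool (U = T) * inum R S U)) = (\<Sum>U\<in>xx.rels. if U = T then xx.val U * inum R S U else 0)"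
    by (rule sum.cong) auto
  also have "\<dots> = xx.val T * inum R S T" using T xx.finite_rels by simp
  finally have 1: "(\<Sum>x\<in>X. \<Sum>x'\<in>X. adj T x x' * common R S x x') = p * (xx.val T * inum R S T)" by simp
  define N where "N x y = card {x'. (x, x') \<in> T \<and> (x', y) \<in> S}" for x y
  have N: "N x y = (\<Sum>x'\<in>X. adj T x x' * adj S x' y)" for x y
  proof -
    have "X \<inter> {x'. (x, x') \<in> T \<and> (x', y) \<in> S} = {x'. (x, x') \<in> T \<and> (x', y) \<in> S}" using xx.rels_sub[OF T] by blast
    then show ?thesis using xx.finite_X by (simp add: N_def adj_def flip: of_bool_conj)
  qed
  have "N x y = tnum T S U" if "U \<in> xy.rels" "(x, y) \<in> U" for U x y
    unfolding N_def using tnum_eq[OF xx.rels_RR[OF T] xy.rels_RR[OF S] xy.rels_RR[OF that(1)] that(2)] .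
  then have "(\<Sum>x\<in>X. \<Sum>y\<in>Y. adj R x y * N x y) = of_nat p * (\<Sum>U\<in>xy.rels. of_nat (xx.val U) * (of_bool (U = R) * tnum T S U))"
    by (intro xy.sum_rels) (simp add: xy.adj_rel[OF R])
  also have "(\<Sum>U\<in>xy.rels. of_nat (xx.val U) * (of_bool (U = R) * tnum T S U)) = (\<Sum>U\<in>xy.rels. if U = R then xx.val U * tnum T S U else 0)"
    by (rule sum.cong) auto
  also have "\<dots> = xx.val R * tnum T S R" using R xy.finite_rels by simp
  finally have 2: "(\<Sum>x\<in>X. \<Sum>y\<in>Y. adj R x y * N x y) = p * (xx.val R * tnum T S R)" by simp
  have "(\<Sum>x\<in>X. \<Sum>x'\<in>X. adj T x x' * common R S x x') = (\<Sum>x\<in>X. \<Sum>y\<in>Y. adj R x y * N x y)"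
  proof (rule sum.cong[OF refl])
    fix x
    have "(\<Sum>x'\<in>X. adj T x x' * common R S x x') = (\<Sum>x'\<in>X. \<Sum>y\<in>Y. adj R x y * (adj T x x' * adj S x' y))"
      unfolding common_sum[OF R] by (simp add: sum_distrib_left mult_ac)
    also have "\<dots> = (\<Sum>y\<in>Y. adj R x y * N x y)" unfolding N sum_distrib_left by (rule sum.swap)
    finally show "(\<Sum>x'\<in>X. adj T x x' * common R S x x') = (\<Sum>y\<in>Y. adj R x y * N x y)" .
  qed
  then have "p * (xx.val T * inum R S T) = p * (xx.val R * tnum T S R)" using 1 2 by simp
  then show ?thesis using xx.p_gt_1 by simp
qed

lemma inum_swap:
  assumes R: "R \<in> xy.rels" and S: "S \<in> xy.rels" and T: "T \<in> xx.rels"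
  shows "inum R S T = inum S R (T\<inverse>)"
proof -
  obtain x x' where x: "(x, x') \<in> T" by (rule xx.rel_pick[OF T])
  then have "inum R S T = common R S x x'" using inum_rels[OF R S T] by simp
  also have "\<dots> = common S R x' x" by (simp add: common_def conj_commute)
  also have "\<dots> = inum S R (T\<inverse>)" using inum_rels[OF S R conv_rel(2)[OF T], of x' x] x by simp
  finally show ?thesis .
qed

lemma val_dvd:
  assumes R: "R \<in> xy.rels" and S: "S \<in> xy.rels" and T: "T \<in> xx.rels"
  shows "xx.val R dvd xx.val T * inum R S T" "xx.val S dvd xx.val T * inum R S T"
proof -
  show "xx.val R dvd xx.val T * inum R S T" using triangle_count[OF R S T] by simp
  have "xx.val S dvd xx.val (T\<inverse>) * inum S R (T\<inverse>)" using triangle_count[OF S R conv_rel(2)[OF T]] by simp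
  then show "xx.val S dvd xx.val T * inum R S T" using inum_swap[OF R S T] val_conv by simp
qed

definition cocommon :: "('a \<times> 'a) set \<Rightarrow> ('a \<times> 'a) set \<Rightarrow> 'a \<Rightarrow> 'a \<Rightarrow> nat" where
  "cocommon R S y y' = card {x. (x, y) \<in> R \<and> (x, y') \<in> S}"

lemma cocommon_sum:
  assumes "R \<in> xy.rels"
  shows "cocommon R S y y' = (\<Sum>x\<in>X. adj R x y * adj S x y')"
proof -
  have "X \<inter> {x. (x, y) \<in> R \<and> (x, y') \<in> S} = {x. (x, y) \<in> R \<and> (x, y') \<in> S}" using xy.rels_sub[OF assms] by blast
  then show ?thesis using xx.finite_X by (simp add: cocommon_def adj_def flip: of_bool_conj)
qed

text \<open>Both sides are the trace of a product of \<open>A\<^sub>R\<close>,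
  \<open>A\<^sub>S\<close> and their transposes, permuted cyclically: the squared norm of
  \<open>A\<^sub>R A\<^sub>S\<^sup>T\<close> is the inner product of
  \<open>A\<^sub>R\<^sup>T A\<^sub>R\<close> and \<open>A\<^sub>S\<^sup>T A\<^sub>S\<close>.\<close>

lemma norm_identity:
  assumes R: "R \<in> xy.rels" and S: "S \<in> xy.rels"
  shows "(\<Sum>x\<in>X. \<Sum>x'\<in>X. (common R S x x')^2) = (\<Sum>y\<in>Y. \<Sum>y'\<in>Y. cocommon R R y y' * cocommon S S y y')"
proof -
  have "(\<Sum>x\<in>X. \<Sum>x'\<in>X. (common R S x x')^2) = (\<Sum>x\<in>X. \<Sum>x'\<in>X. \<Sum>y\<in>Y. \<Sum>y'\<in>Y. (adj R x y * adj R x y') * (adj S x' y * adj S x' y'))"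
    unfolding common_sum[OF R] power2_eq_square sum_product by (simp add: mult_ac)
  also have "\<dots> = (\<Sum>x\<in>X. \<Sum>y\<in>Y. \<Sum>x'\<in>X. \<Sum>y'\<in>Y. (adj R x y * adj R x y') * (adj S x' y * adj S x' y'))"
    by (intro sum.cong refl sum.swap)
  also have "\<dots> = (\<Sum>y\<in>Y. \<Sum>x\<in>X. \<Sum>x'\<in>X. \<Sum>y'\<in>Y. (adj R x y * adj R x y') * (adj S x' y * adj S x' y'))"
    by (rule sum.swap)
  also have "\<dots> = (\<Sum>y\<in>Y. \<Sum>y'\<in>Y. \<Sum>x\<in>X. \<Sum>x'\<in>X. (adj R x y * adj R x y') * (adj S x' y * adj S x' y'))"
    by (intro sum.cong refl sum_rotate)
  also have "\<dots> = (\<Sum>y\<in>Y. \<Sum>y'\<in>Y. cocommon R R y y' * cocommon S S y y')"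
    unfolding cocommon_sum[OF R] cocommon_sum[OF S] sum_product by (rule refl)
  finally show ?thesis .
qed

end

section \<open>Valencies inside a fiber and the number of relations between fibers\<close>

context fiber_pair
begin

lemma self: "fiber_pair V RR X X p"
  by unfold_locales (use fiber_X card_X p_prime in auto)

text \<open>The trace \<open>M\<close> of left multiplication by \<open>A\<^sub>U\<close> is an
  integer, and by \<open>indistinguishing\<close> it equals \<open>(1 - 1 / k) * val U\<close>; so
  \<open>k\<close> divides every nontrivial valency. There are \<open>m\<close> of these and they
  add up to \<open>k * m\<close>, so all equal \<open>k\<close>.\<close>

lemma val_XX:
  assumes k: "p - 1 = k * (card xx.rels - 1)" and T: "T \<in> xx.rels" "T \<noteq> Id_on X"
  shows "xx.val T = k"
proof -
  interpret S: fiber_pair V RR X X p by (rule self)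
  define m where "m = card xx.rels - 1"
  have p1: "p > 1" by (rule xx.p_gt_1)
  have km: "p = 1 + k * m" using k p1 by (simp add: m_def)
  have "card xx.rels > 0" using Id_rel xx.finite_rels by (auto simp: card_gt_0_iff)
  then have r: "card xx.rels = m + 1" by (simp add: m_def)
  have km0: "k * m > 0" using km p1 by auto
  have kdvd: "k dvd xx.val U" if U: "U \<in> xx.rels" "U \<noteq> Id_on X" for U
  proof -
    obtain x x' where x: "(x, x') \<in> U" "x \<in> X" "x' \<in> X" by (rule xx.rel_pick[OF U(1)])
    have ne: "x \<noteq> x'" by (rule rel_offdiag[OF U x(1)])
    define M where "M = (\<Sum>R\<in>xx.rels. tnum U R R)"
    have "real M = (\<Sum>R\<in>xx.rels. real (xx.val U) * (real (card {y. (x, y) \<in> R \<and> (x', y) \<in> R}) / real (xx.val R)))"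
      unfolding M_def of_nat_sum
    proof (rule sum.cong[OF refl])
      fix R assume R: "R \<in> xx.rels"
      have "xx.val U * S.inum R R U = xx.val R * S.tnum U R R" by (rule S.triangle_count[OF R R U(1)])
      moreover have "S.inum R R U = card {y. (x, y) \<in> R \<and> (x', y) \<in> R}"
        using S.inum_rels[OF R R U(1) x(1)] by (simp add: S.common_def)
      ultimately have "real (xx.val U) * real (card {y. (x, y) \<in> R \<and> (x', y) \<in> R}) = real (xx.val R) * real (S.tnum U R R)"
        by (metis of_nat_mult)
      moreover have "real (xx.val R) > 0" using xx.val_pos[OF R] by simp
      ultimately show "real (tnum U R R) = real (xx.val U) * (real (card {y. (x, y) \<in> R \<and> (x', y) \<in> R}) / real (xx.val R))"
        by (simp add: field_simps)
    qed
    also have "\<dots> = real (xx.val U) * ((real p - real (card xx.rels)) / (real p - 1))"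
      unfolding sum_distrib_left[symmetric] using xx.indistinguishing[OF x(2,3) ne] by simp
    also have "(real p - real (card xx.rels)) / (real p - 1) = 1 - 1 / real k"
      using km0 by (simp add: km r field_simps)
    finally have "real k * real M = real k * real (xx.val U) - real (xx.val U)" using km0 by (simp add: field_simps)
    then have "real (k * M + xx.val U) = real (k * xx.val U)" by simp
    then have "k * M + xx.val U = k * xx.val U" using of_nat_eq_iff by blast
    then have "k dvd k * M + xx.val U" by simp
    then show ?thesis by (simp add: dvd_add_right_iff)
  qed
  have ge: "k \<le> xx.val U" if U: "U \<in> xx.rels - {Id_on X}" for U
    using kdvd[of U] xx.val_pos[of U] U dvd_imp_le by blast
  have "(\<Sum>U\<in>xx.rels - {Id_on X}. xx.val U) = k * m"
    using xx.sum_val km xx.finite_rels Id_rel val_Id by (simp add: sum.remove[of _ "Id_on X"])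
  also have "\<dots> = (\<Sum>U\<in>xx.rels - {Id_on X}. k)" using r xx.finite_rels Id_rel by simp
  finally have eq: "(\<Sum>U\<in>xx.rels - {Id_on X}. k) = (\<Sum>U\<in>xx.rels - {Id_on X}. xx.val U)" by simp
  show ?thesis
  proof (rule ccontr)
    assume "xx.val T \<noteq> k"
    then have "k < xx.val T" using ge[of T] T by auto
    then have "(\<Sum>U\<in>xx.rels - {Id_on X}. k) < (\<Sum>U\<in>xx.rels - {Id_on X}. xx.val U)"
      using T xx.finite_rels ge by (intro sum_strict_mono_ex1) auto
    then show False using eq by simp
  qed
qed

lemma converse_bij: "bij_betw converse xy.rels yx.rels"
proof (rule bij_betw_byWitness[where f' = converse])
  show "converse ` xy.rels \<subseteq> yx.rels" using conv_rel by blast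
  show "converse ` yx.rels \<subseteq> xy.rels" using fiber_pair.conv_rel(1)[OF flip] by blast
qed auto

lemma card_yx: "card yx.rels = card xy.rels"
  using bij_betw_same_card[OF converse_bij] by simp

text \<open>The statement of \<open>indistinguishing\<close> for the reversed pair of fibers,
  transported by converse.\<close>

lemma coindist:
  assumes y: "y \<in> Y" "y' \<in> Y"
  shows "(\<Sum>R\<in>xy.rels. real (cocommon R R y y') / real (xx.val R))
    = (if y = y' then real (card xy.rels) else (real p - real (card xy.rels)) / (real p - 1))"
proof (cases "y = y'")
  case True
  have "(\<Sum>R\<in>xy.rels. real (cocommon R R y y') / real (xx.val R)) = (\<Sum>R\<in>xy.rels. 1)"
  proof (rule sum.cong[OF refl])
    fix R assume R: "R \<in> xy.rels"
    have "cocommon R R y y' = xx.val R" using xy.card_col[OF R y(1)] True by (simp add: cocommon_def)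
    then show "real (cocommon R R y y') / real (xx.val R) = 1" using xy.val_pos[OF R] by simp
  qed
  then show ?thesis using True by simp
next
  case False
  have "(\<Sum>R\<in>xy.rels. real (cocommon R R y y') / real (xx.val R))
    = (\<Sum>R\<in>xy.rels. real (card {x. (y, x) \<in> R\<inverse> \<and> (y', x) \<in> R\<inverse>}) / real (xx.val (R\<inverse>)))"
    by (simp add: cocommon_def val_conv)
  also have "\<dots> = (\<Sum>R\<in>yx.rels. real (card {x. (y, x) \<in> R \<and> (y', x) \<in> R}) / real (xx.val R))"
    by (rule sum.reindex_bij_betw[OF converse_bij])
  also have "\<dots> = (real p - real (card yx.rels)) / (real p - 1)" by (rule yx.indistinguishing[OF y False])
  finally show ?thesis using False card_yx by simp
qed

lemma indist:
  assumes x: "x \<in> X" "x' \<in> X"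
  shows "(\<Sum>R\<in>xy.rels. real (common R R x x') / real (xx.val R))
    = (if x = x' then real (card xy.rels) else (real p - real (card xy.rels)) / (real p - 1))"
proof (cases "x = x'")
  case True
  have "(\<Sum>R\<in>xy.rels. real (common R R x x') / real (xx.val R)) = (\<Sum>R\<in>xy.rels. 1)"
  proof (rule sum.cong[OF refl])
    fix R assume R: "R \<in> xy.rels"
    have "common R R x x' = xx.val R" using xy.card_row[OF R x(1)] True by (simp add: common_def)
    then show "real (common R R x x') / real (xx.val R) = 1" using xy.val_pos[OF R] by simp
  qed
  then show ?thesis using True by simp
next
  case False
  then show ?thesis using xy.indistinguishing[OF x False] by (simp add: common_def)
qed

definition steps :: "('a \<times> 'a) set \<Rightarrow> ('a \<times> 'a) set \<Rightarrow> 'a \<Rightarrow> 'a \<Rightarrow> nat" where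
  "steps T S x y = card {x'. (x, x') \<in> T \<and> (x', y) \<in> S}"

lemma steps_sum:
  assumes "T \<in> xx.rels"
  shows "steps T S x y = (\<Sum>x'\<in>X. adj T x x' * adj S x' y)"
proof -
  have "X \<inter> {x'. (x, x') \<in> T \<and> (x', y) \<in> S} = {x'. (x, x') \<in> T \<and> (x', y) \<in> S}" using xx.rels_sub[OF assms] by blast
  then show ?thesis using xx.finite_X by (simp add: steps_def adj_def flip: of_bool_conj)
qed

lemma norm_identity2:
  assumes T: "T \<in> xx.rels" and S: "S \<in> xy.rels"
  shows "(\<Sum>x\<in>X. \<Sum>y\<in>Y. (steps T S x y)^2) = (\<Sum>x\<in>X. \<Sum>x'\<in>X. fiber_pair.cocommon T T x x' * common S S x x')"
proof -
  interpret S: fiber_pair V RR X X p by (rule self)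
  have "(\<Sum>x\<in>X. \<Sum>y\<in>Y. (steps T S x y)^2) = (\<Sum>x\<in>X. \<Sum>y\<in>Y. \<Sum>u\<in>X. \<Sum>v\<in>X. (adj T x u * adj T x v) * (adj S u y * adj S v y))"
    unfolding steps_sum[OF T] power2_eq_square sum_product by (simp add: mult_ac)
  also have "\<dots> = (\<Sum>x\<in>X. \<Sum>u\<in>X. \<Sum>y\<in>Y. \<Sum>v\<in>X. (adj T x u * adj T x v) * (adj S u y * adj S v y))"
    by (intro sum.cong refl sum.swap)
  also have "\<dots> = (\<Sum>u\<in>X. \<Sum>x\<in>X. \<Sum>y\<in>Y. \<Sum>v\<in>X. (adj T x u * adj T x v) * (adj S u y * adj S v y))"
    by (rule sum.swap)
  also have "\<dots> = (\<Sum>u\<in>X. \<Sum>v\<in>X. \<Sum>x\<in>X. \<Sum>y\<in>Y. (adj T x u * adj T x v) * (adj S u y * adj S v y))"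
    by (intro sum.cong refl sum_rotate)
  also have "\<dots> = (\<Sum>x\<in>X. \<Sum>x'\<in>X. S.cocommon T T x x' * common S S x x')"
    unfolding S.cocommon_sum[OF T] common_sum[OF S] sum_product by (rule refl)
  finally show ?thesis .
qed

text \<open>One weighted double count, evaluated in two ways. The sum of the squared norms of all
  \<open>A\<^sub>R A\<^sub>S\<^sup>T\<close>, divided by the valencies, equals the analogous sum for
  all \<open>A\<^sub>T A\<^sub>S\<close> with \<open>T\<close> on \<open>X\<close>. Each is known
  from the norm identities, and equating them gives \<open>(s - 1) * (s - r) = 0\<close>.\<close>

lemma card_rels_XY:
  assumes s: "card xy.rels > 1"
  shows "card xy.rels = card xx.rels"
proof -
  interpret S: fiber_pair V RR X X p by (rule self)
  define s r where "s = real (card xy.rels)" and "r = real (card xx.rels)"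
  define P where "P = real p"
  have P1: "P > 1" using xx.p_gt_1 by (simp add: P_def)
  define c where "c = (P - s) / (P - 1)"
  define c0 where "c0 = (P - r) / (P - 1)"
  let ?d = "\<lambda>R. real (xx.val R)"
  have dsum: "(\<Sum>x\<in>A. \<Sum>x'\<in>A. if x = x' then a else b) = P * a + P * (P - 1) * b" if A: "card A = p" for A :: "'a set" and a b :: real
  proof -
    have fA: "finite A" using A xx.p_gt_1 by (metis card.infinite not_less_zero)
    have "(\<Sum>x'\<in>A. if x = x' then a else b) = a + (P - 1) * b" if "x \<in> A" for x
    proof -
      have "(\<Sum>x'\<in>A. if x = x' then a else b) = a + (\<Sum>x'\<in>A-{x}. if x = x' then a else b)"
        using fA that by (simp add: sum.remove)
      also have "(\<Sum>x'\<in>A-{x}. if x = x' then a else b) = (\<Sum>x'\<in>A-{x}. b)" by (rule sum.cong) auto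
      finally show ?thesis using fA that A xx.p_gt_1 by (simp add: P_def of_nat_diff)
    qed
    then have "(\<Sum>x\<in>A. \<Sum>x'\<in>A. if x = x' then a else b) = (\<Sum>x\<in>A. a + (P - 1) * b)"
      by (intro sum.cong refl)
    also have "\<dots> = P * a + P * (P - 1) * b" using A by (simp add: P_def algebra_simps)
    finally show ?thesis .
  qed
  \<comment> \<open>After \<open>norm_identity\<close> the sums over \<open>R\<close> and
    \<open>S\<close> separate, and each is the constant of \<open>coindist\<close>.\<close>
  have Q1: "(\<Sum>R\<in>xy.rels. \<Sum>S\<in>xy.rels. (\<Sum>x\<in>X. \<Sum>x'\<in>X. real (common R S x x')^2) / (?d R * ?d S)) = P * s^2 + P * (P - 1) * c^2"
  proof -
    have "(\<Sum>R\<in>xy.rels. \<Sum>S\<in>xy.rels. (\<Sum>x\<in>X. \<Sum>x'\<in>X. real (common R S x x')^2) / (?d R * ?d S))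
      = (\<Sum>R\<in>xy.rels. \<Sum>S\<in>xy.rels. \<Sum>y\<in>Y. \<Sum>y'\<in>Y. (real (cocommon R R y y') / ?d R) * (real (cocommon S S y y') / ?d S))"
    proof (intro sum.cong refl)
      fix R S assume RS: "R \<in> xy.rels" "S \<in> xy.rels"
      have "(\<Sum>x\<in>X. \<Sum>x'\<in>X. real (common R S x x')^2) = real (\<Sum>x\<in>X. \<Sum>x'\<in>X. (common R S x x')^2)" by simp
      also have "\<dots> = (\<Sum>y\<in>Y. \<Sum>y'\<in>Y. real (cocommon R R y y') * real (cocommon S S y y'))"
        unfolding norm_identity[OF RS] by simp
      finally show "(\<Sum>x\<in>X. \<Sum>x'\<in>X. real (common R S x x')^2) / (?d R * ?d S)
          = (\<Sum>y\<in>Y. \<Sum>y'\<in>Y. (real (cocommon R R y y') / ?d R) * (real (cocommon S S y y') / ?d S))"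
        by (simp add: sum_divide_distrib)
    qed
    also have "\<dots> = (\<Sum>R\<in>xy.rels. \<Sum>y\<in>Y. \<Sum>S\<in>xy.rels. \<Sum>y'\<in>Y. (real (cocommon R R y y') / ?d R) * (real (cocommon S S y y') / ?d S))"
      by (intro sum.cong refl sum.swap)
    also have "\<dots> = (\<Sum>y\<in>Y. \<Sum>R\<in>xy.rels. \<Sum>S\<in>xy.rels. \<Sum>y'\<in>Y. (real (cocommon R R y y') / ?d R) * (real (cocommon S S y y') / ?d S))"
      by (rule sum.swap)
    also have "\<dots> = (\<Sum>y\<in>Y. \<Sum>y'\<in>Y. \<Sum>R\<in>xy.rels. \<Sum>S\<in>xy.rels. (real (cocommon R R y y') / ?d R) * (real (cocommon S S y y') / ?d S))"
      by (intro sum.cong refl sum_rotate)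
    also have "\<dots> = (\<Sum>y\<in>Y. \<Sum>y'\<in>Y. (if y = y' then s^2 else c^2))"
      by (intro sum.cong refl, unfold sum_product[symmetric]) (simp add: coindist power2_eq_square s_def c_def P_def)
    finally show ?thesis using dsum[OF card_Y] by simp
  qed
  have Q2: "(\<Sum>T\<in>xx.rels. \<Sum>S\<in>xy.rels. (\<Sum>x\<in>X. \<Sum>y\<in>Y. real (steps T S x y)^2) / (?d T * ?d S)) = P * (r * s) + P * (P - 1) * (c0 * c)"
  proof -
    have "(\<Sum>T\<in>xx.rels. \<Sum>S\<in>xy.rels. (\<Sum>x\<in>X. \<Sum>y\<in>Y. real (steps T S x y)^2) / (?d T * ?d S))
      = (\<Sum>T\<in>xx.rels. \<Sum>S\<in>xy.rels. \<Sum>y\<in>X. \<Sum>y'\<in>X. (real (S.cocommon T T y y') / ?d T) * (real (common S S y y') / ?d S))"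
    proof (intro sum.cong refl)
      fix T S assume RS: "T \<in> xx.rels" "S \<in> xy.rels"
      have "(\<Sum>x\<in>X. \<Sum>y\<in>Y. real (steps T S x y)^2) = real (\<Sum>x\<in>X. \<Sum>y\<in>Y. (steps T S x y)^2)" by simp
      also have "\<dots> = (\<Sum>y\<in>X. \<Sum>y'\<in>X. real (S.cocommon T T y y') * real (common S S y y'))"
        unfolding norm_identity2[OF RS] by simp
      finally show "(\<Sum>x\<in>X. \<Sum>y\<in>Y. real (steps T S x y)^2) / (?d T * ?d S)
          = (\<Sum>y\<in>X. \<Sum>y'\<in>X. (real (S.cocommon T T y y') / ?d T) * (real (common S S y y') / ?d S))"
        by (simp add: sum_divide_distrib)
    qed
    also have "\<dots> = (\<Sum>T\<in>xx.rels. \<Sum>y\<in>X. \<Sum>S\<in>xy.rels. \<Sum>y'\<in>X. (real (S.cocommon T T y y') / ?d T) * (real (common S S y y') / ?d S))"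
      by (intro sum.cong refl sum.swap)
    also have "\<dots> = (\<Sum>y\<in>X. \<Sum>T\<in>xx.rels. \<Sum>S\<in>xy.rels. \<Sum>y'\<in>X. (real (S.cocommon T T y y') / ?d T) * (real (common S S y y') / ?d S))"
      by (rule sum.swap)
    also have "\<dots> = (\<Sum>y\<in>X. \<Sum>y'\<in>X. \<Sum>T\<in>xx.rels. \<Sum>S\<in>xy.rels. (real (S.cocommon T T y y') / ?d T) * (real (common S S y y') / ?d S))"
      by (intro sum.cong refl sum_rotate)
    also have "\<dots> = (\<Sum>y\<in>X. \<Sum>y'\<in>X. (if y = y' then r * s else c0 * c))"
      by (intro sum.cong refl, unfold sum_product[symmetric]) (simp add: S.coindist indist s_def r_def c_def c0_def P_def)
    finally show ?thesis using dsum[OF card_X] by simp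
  qed
  \<comment> \<open>By \<open>triangle_count\<close> the term
    \<open>d\<^sub>T c\<^sup>2 / (d\<^sub>R d\<^sub>S)\<close>, for a coefficient \<open>c\<close>
    of \<open>A\<^sub>R A\<^sub>S\<^sup>T\<close>, equals
    \<open>d\<^sub>R t\<^sup>2 / (d\<^sub>T d\<^sub>S)\<close>, where \<open>t\<close> is the
    matching coefficient of \<open>A\<^sub>T A\<^sub>S\<close>.\<close>
  have Q12: "(\<Sum>R\<in>xy.rels. \<Sum>S\<in>xy.rels. (\<Sum>x\<in>X. \<Sum>x'\<in>X. real (common R S x x')^2) / (?d R * ?d S))
     = (\<Sum>T\<in>xx.rels. \<Sum>S\<in>xy.rels. (\<Sum>x\<in>X. \<Sum>y\<in>Y. real (steps T S x y)^2) / (?d T * ?d S))"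
  proof -
    have "(\<Sum>R\<in>xy.rels. \<Sum>S\<in>xy.rels. (\<Sum>x\<in>X. \<Sum>x'\<in>X. real (common R S x x')^2) / (?d R * ?d S))
      = (\<Sum>R\<in>xy.rels. \<Sum>S\<in>xy.rels. \<Sum>T\<in>xx.rels. P * (?d T * real (inum R S T)^2) / (?d R * ?d S))"
    proof (intro sum.cong refl)
      fix R S assume RS: "R \<in> xy.rels" "S \<in> xy.rels"
      have "(\<Sum>x\<in>X. \<Sum>x'\<in>X. real (common R S x x')^2) = of_nat p * (\<Sum>T\<in>xx.rels. of_nat (xx.val T) * real (inum R S T)^2)"
        by (rule xx.sum_rels) (simp add: inum_rels[OF RS])
      then show "(\<Sum>x\<in>X. \<Sum>x'\<in>X. real (common R S x x')^2) / (?d R * ?d S) = (\<Sum>T\<in>xx.rels. P * (?d T * real (inum R S T)^2) / (?d R * ?d S))"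
        by (simp add: P_def sum_distrib_left sum_divide_distrib)
    qed
    also have "\<dots> = (\<Sum>R\<in>xy.rels. \<Sum>S\<in>xy.rels. \<Sum>T\<in>xx.rels. P * (?d R * real (tnum T S R)^2) / (?d T * ?d S))"
    proof (intro sum.cong refl)
      fix R S T assume RST: "R \<in> xy.rels" "S \<in> xy.rels" "T \<in> xx.rels"
      have pos: "?d R > 0" "?d S > 0" "?d T > 0" using xy.val_pos RST xx.val_pos by auto
      have "?d T * real (inum R S T) = ?d R * real (tnum T S R)"
        using triangle_count[OF RST] by (metis of_nat_mult)
      then have t: "real (tnum T S R) = ?d T * real (inum R S T) / ?d R" using pos by (simp add: field_simps)
      show "P * (?d T * real (inum R S T)^2) / (?d R * ?d S) = P * (?d R * real (tnum T S R)^2) / (?d T * ?d S)"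
        unfolding t using pos by (simp add: field_simps power2_eq_square)
    qed
    also have "\<dots> = (\<Sum>T\<in>xx.rels. \<Sum>S\<in>xy.rels. \<Sum>R\<in>xy.rels. P * (?d R * real (tnum T S R)^2) / (?d T * ?d S))"
      by (rule sum_swap_outer)
    also have "\<dots> = (\<Sum>T\<in>xx.rels. \<Sum>S\<in>xy.rels. (\<Sum>x\<in>X. \<Sum>y\<in>Y. real (steps T S x y)^2) / (?d T * ?d S))"
    proof (intro sum.cong refl)
      fix T S assume TS: "T \<in> xx.rels" "S \<in> xy.rels"
      have "(\<Sum>x\<in>X. \<Sum>y\<in>Y. real (steps T S x y)^2) = of_nat p * (\<Sum>R\<in>xy.rels. of_nat (xx.val R) * real (tnum T S R)^2)"
        by (rule xy.sum_rels)
          (simp add: steps_def tnum_eq[OF xx.rels_RR[OF TS(1)] xy.rels_RR[OF TS(2)] xy.rels_RR])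
      then show "(\<Sum>R\<in>xy.rels. P * (?d R * real (tnum T S R)^2) / (?d T * ?d S)) = (\<Sum>x\<in>X. \<Sum>y\<in>Y. real (steps T S x y)^2) / (?d T * ?d S)"
        by (simp add: P_def sum_distrib_left sum_divide_distrib)
    qed
    finally show ?thesis .
  qed
  have "P * s^2 + P * (P - 1) * c^2 = P * (r * s) + P * (P - 1) * (c0 * c)" using Q1 Q2 Q12 by simp
  then have "P * (s^2 + (P - 1) * c^2) = P * (r * s + (P - 1) * (c0 * c))" by (simp add: algebra_simps)
  then have e1: "s^2 + (P - 1) * c^2 = r * s + (P - 1) * (c0 * c)" using P1 by simp
  have "(P - 1) * c^2 = (P - s)^2 / (P - 1)" using P1 by (simp add: c_def power2_eq_square)
  moreover have "(P - 1) * (c0 * c) = (P - r) * (P - s) / (P - 1)" using P1 by (simp add: c_def c0_def)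
  ultimately have "s^2 + (P - s)^2 / (P - 1) = r * s + (P - r) * (P - s) / (P - 1)" using e1 by simp
  then have "(P - 1) * s^2 + (P - s)^2 = (P - 1) * (r * s) + (P - r) * (P - s)"
    using P1 by (simp add: field_simps)
  then have "P * ((s - 1) * (s - r)) = 0" by (simp add: algebra_simps power2_eq_square)
  moreover have "s > 1" using s by (simp add: s_def)
  ultimately have "s = r" using P1 by simp
  then show ?thesis by (simp add: s_def r_def)
qed

end

section \<open>Configurations with constant valency\<close>

locale equivalenced_pair = fiber_pair V RR X Y p for V :: "'a set" and RR X Y p +
  fixes k m :: nat
  assumes card_xx: "card xx.rels = m + 1" and card_xy: "card xy.rels = m + 1"
    and card_yy: "card yy.rels = m + 1" and m2: "m \<ge> 2" and p_eq: "p = 1 + k * m"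
begin

lemma eflip: "equivalenced_pair V RR Y X p k m"
proof -
  interpret fl: fiber_pair V RR Y X p by (rule flip)
  show ?thesis by unfold_locales (use card_xx card_xy card_yy card_yx m2 p_eq in auto)
qed

lemma k_pos: "k > 0" using p_eq xx.p_gt_1 by (cases k) auto

abbreviation nt where "nt \<equiv> xx.rels - {Id_on X}"

lemma finite_nt: "finite nt" using xx.finite_rels by simp

lemma val_nt: "T \<in> nt \<Longrightarrow> xx.val T = k"
  using val_XX[of k T] card_xx p_eq by simp

lemma sum_split: "(\<Sum>T\<in>xx.rels. xx.val T * h T) = h (Id_on X) + k * (\<Sum>T\<in>nt. h T)"
proof -
  have "(\<Sum>T\<in>xx.rels. xx.val T * h T) = xx.val (Id_on X) * h (Id_on X) + (\<Sum>T\<in>nt. xx.val T * h T)"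
    using Id_rel xx.finite_rels by (simp add: sum.remove)
  also have "(\<Sum>T\<in>nt. xx.val T * h T) = (\<Sum>T\<in>nt. k * h T)" by (rule sum.cong) (use val_nt in auto)
  finally show ?thesis using val_Id by (simp add: sum_distrib_left)
qed

lemma val_mult:
  assumes "R \<in> xy.rels" "S \<in> xy.rels"
  shows "xx.val R * xx.val S = (if R = S then xx.val R else 0) + k * (\<Sum>T\<in>nt. inum R S T)"
  using sum_inum[OF assms] sum_split[of "inum R S"] inum_Id[OF assms] by simp

lemma inum_dvd:
  assumes "R \<in> xy.rels" "S \<in> xy.rels" "T \<in> nt"
  shows "xx.val R dvd k * inum R S T" "xx.val S dvd k * inum R S T"
  using val_dvd[OF assms(1,2), of T] assms(3) val_nt[OF assms(3)] by auto

lemma cocommon_conv: "cocommon R S y y' = common (R\<inverse>) (S\<inverse>) y y'"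
  by (simp add: cocommon_def common_def)

text \<open>This is \<open>norm_identity\<close> divided by \<open>p\<close>. The diagonal of
  \<open>X\<close> contributes nothing because \<open>R\<close> and \<open>S\<close> are disjoint,
  and the diagonal of \<open>Y\<close> contributes the product of the valencies.\<close>

lemma norm_nt:
  assumes R: "R \<in> xy.rels" and S: "S \<in> xy.rels" and ne: "R \<noteq> S"
  shows "k * (\<Sum>T\<in>nt. (inum R S T)^2) = xx.val R * xx.val S +
    k * (\<Sum>T\<in>yy.rels - {Id_on Y}. inum (R\<inverse>) (R\<inverse>) T * inum (S\<inverse>) (S\<inverse>) T)"
proof -
  interpret fl: equivalenced_pair V RR Y X p k m by (rule eflip)
  have Ri: "R\<inverse> \<in> yx.rels" and Si: "S\<inverse> \<in> yx.rels" using conv_rel R S by auto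
  have "(\<Sum>x\<in>X. \<Sum>x'\<in>X. (common R S x x')^2) = of_nat p * (\<Sum>T\<in>xx.rels. of_nat (xx.val T) * (inum R S T)^2)"
    by (rule xx.sum_rels) (simp add: inum_rels[OF R S])
  then have 1: "(\<Sum>x\<in>X. \<Sum>x'\<in>X. (common R S x x')^2) = p * (k * (\<Sum>T\<in>nt. (inum R S T)^2))"
    using sum_split[of "\<lambda>T. (inum R S T)^2"] inum_Id[OF R S] ne by simp
  have "(\<Sum>y\<in>Y. \<Sum>y'\<in>Y. cocommon R R y y' * cocommon S S y y') =
      of_nat p * (\<Sum>T\<in>yy.rels. of_nat (xx.val T) * (inum (R\<inverse>) (R\<inverse>) T * inum (S\<inverse>) (S\<inverse>) T))"
    by (rule yy.sum_rels) (simp add: cocommon_conv fl.inum_rels[OF Ri Ri] fl.inum_rels[OF Si Si])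
  then have 2: "(\<Sum>y\<in>Y. \<Sum>y'\<in>Y. cocommon R R y y' * cocommon S S y y') =
      p * (xx.val R * xx.val S + k * (\<Sum>T\<in>yy.rels - {Id_on Y}. inum (R\<inverse>) (R\<inverse>) T * inum (S\<inverse>) (S\<inverse>) T))"
    using fl.sum_split[of "\<lambda>T. inum (R\<inverse>) (R\<inverse>) T * inum (S\<inverse>) (S\<inverse>) T"] fl.inum_Id[OF Ri Ri] fl.inum_Id[OF Si Si]
    by (simp add: val_conv)
  show ?thesis using norm_identity[OF R S] 1 2 xx.p_gt_1 by simp
qed

lemma sum_inum_self:
  assumes R: "R \<in> xy.rels"
  shows "k * (\<Sum>T\<in>nt. inum R R T) = xx.val R * (xx.val R - 1)"
  using val_mult[OF R R] by (simp add: right_diff_distrib')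

text \<open>A part of the sum in \<open>indist\<close>, whose terms are nonnegative and whose value
  is \<open>1 - 1 / k\<close>.\<close>

lemma indist_bound:
  assumes T: "T \<in> nt" and G: "G \<subseteq> xy.rels" "\<And>S. S \<in> G \<Longrightarrow> xx.val S = k"
  shows "(\<Sum>S\<in>G. inum S S T) \<le> k - 1"
proof -
  have Tr: "T \<in> xx.rels" "T \<noteq> Id_on X" using T by auto
  obtain x x' where x: "(x, x') \<in> T" "x \<in> X" "x' \<in> X" by (rule xx.rel_pick[OF Tr(1)])
  have ne: "x \<noteq> x'" by (rule rel_offdiag[OF Tr x(1)])
  have "(\<Sum>S\<in>G. real (inum S S T)) / real k = (\<Sum>S\<in>G. real (inum S S T) / real (xx.val S))"
    unfolding sum_divide_distrib by (rule sum.cong) (use G in auto)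
  also have "\<dots> \<le> (\<Sum>S\<in>xy.rels. real (inum S S T) / real (xx.val S))"
    by (rule sum_mono2[OF xy.finite_rels G(1)]) auto
  also have "\<dots> = (\<Sum>S\<in>xy.rels. real (common S S x x') / real (xx.val S))"
    by (rule sum.cong) (use inum_rels[OF _ _ Tr(1) x(1)] in auto)
  also have "\<dots> = (real p - real (card xy.rels)) / (real p - 1)" using indist[OF x(2,3)] ne by simp
  also have "\<dots> = 1 - 1 / real k" using k_pos m2 by (simp add: card_xy p_eq field_simps)
  finally have "(\<Sum>S\<in>G. real (inum S S T)) \<le> real k - 1" using k_pos by (simp add: field_simps)
  then have "real (\<Sum>S\<in>G. inum S S T) \<le> real (k - 1)" using k_pos by (simp add: of_nat_diff)
  then show ?thesis using of_nat_le_iff by blast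
qed

text \<open>Relations whose valency does not divide \<open>k\<close> force the coefficients of \<open>A\<^sub>R A\<^sub>S\<^sup>T\<close> to be
  at least 2, which a typical \<open>S\<close> of valency \<open>k\<close> does not permit.\<close>

lemma nondividing_valency:
  assumes R: "R \<in> xy.rels" "\<not> xx.val R dvd k"
  shows "card {S\<in>xy.rels. xx.val S = k} * k \<le> (k - 1) * (xx.val R - 1)"
proof -
  interpret fl: equivalenced_pair V RR Y X p k m by (rule eflip)
  define G where "G = {S\<in>xy.rels. xx.val S = k}"
  define d where "d = xx.val R"
  have d0: "d > 0" using xy.val_pos[OF R(1)] by (simp add: d_def)
  have Ri: "R\<inverse> \<in> yx.rels" using conv_rel R by auto
  \<comment> \<open>The coefficients of \<open>A\<^sub>R A\<^sub>S\<^sup>T\<close> add up to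
    \<open>d\<close> and none equals 1, since \<open>d\<close> divides \<open>k * inum R S T\<close>
    but not \<open>k\<close>. So their squares add up to at least \<open>2 * d\<close>, and
    \<open>norm_nt\<close> turns the excess over \<open>d\<close> into a lower bound on the
    \<open>Y\<close> side.\<close>
  have step: "d \<le> (\<Sum>T\<in>fl.nt. inum (R\<inverse>) (R\<inverse>) T * inum (S\<inverse>) (S\<inverse>) T)" if S: "S \<in> G" for S
  proof -
    have S': "S \<in> xy.rels" "xx.val S = k" using S by (auto simp: G_def)
    have ne: "R \<noteq> S" using S' R by auto
    have s1: "(\<Sum>T\<in>nt. inum R S T) = d" using val_mult[OF R(1) S'(1)] ne S'(2) k_pos by (simp add: d_def)
    have "2 * d \<le> (\<Sum>T\<in>nt. (inum R S T)^2)"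
      unfolding s1[symmetric] sum_distrib_left
    proof (rule sum_mono)
      fix T assume T: "T \<in> nt"
      have "inum R S T \<noteq> 1" using inum_dvd(1)[OF R(1) S'(1) T] R(2) by auto
      then have "inum R S T = 0 \<or> 2 \<le> inum R S T" by linarith
      then show "2 * inum R S T \<le> (inum R S T)^2" by (auto simp: power2_eq_square)
    qed
    then have "k * (2 * d) \<le> k * (\<Sum>T\<in>nt. (inum R S T)^2)" by simp
    also have "\<dots> = d * k + k * (\<Sum>T\<in>fl.nt. inum (R\<inverse>) (R\<inverse>) T * inum (S\<inverse>) (S\<inverse>) T)"
      using norm_nt[OF R(1) S'(1) ne] S'(2) by (simp add: d_def)
    finally have "k * (2 * d) \<le> k * (d + (\<Sum>T\<in>fl.nt. inum (R\<inverse>) (R\<inverse>) T * inum (S\<inverse>) (S\<inverse>) T))"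
      by (simp add: algebra_simps)
    then show ?thesis using k_pos by simp
  qed
  have fG: "finite G" using xy.finite_rels by (simp add: G_def)
  have "card G * d = (\<Sum>S\<in>G. d)" by simp
  also have "\<dots> \<le> (\<Sum>S\<in>G. \<Sum>T\<in>fl.nt. inum (R\<inverse>) (R\<inverse>) T * inum (S\<inverse>) (S\<inverse>) T)"
    by (rule sum_mono) (rule step)
  also have "\<dots> = (\<Sum>T\<in>fl.nt. inum (R\<inverse>) (R\<inverse>) T * (\<Sum>S\<in>G. inum (S\<inverse>) (S\<inverse>) T))"
    unfolding sum_distrib_left by (rule sum.swap)
  also have "\<dots> \<le> (\<Sum>T\<in>fl.nt. inum (R\<inverse>) (R\<inverse>) T * (k - 1))"
  proof (intro sum_mono mult_left_mono)
    fix T assume T: "T \<in> fl.nt"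
    have "(\<Sum>S\<in>G. inum (S\<inverse>) (S\<inverse>) T) = (\<Sum>S\<in>converse ` G. inum S S T)"
      by (subst sum.reindex) (auto simp: inj_on_def)
    also have "\<dots> \<le> k - 1"
    proof (rule fl.indist_bound[OF T])
      show "converse ` G \<subseteq> yx.rels" using conv_rel by (auto simp: G_def)
      show "\<And>S. S \<in> converse ` G \<Longrightarrow> xx.val S = k" by (auto simp: G_def val_conv)
    qed
    finally show "(\<Sum>S\<in>G. inum (S\<inverse>) (S\<inverse>) T) \<le> k - 1" .
  qed auto
  also have "\<dots> = (k - 1) * (\<Sum>T\<in>fl.nt. inum (R\<inverse>) (R\<inverse>) T)" by (simp add: sum_distrib_left mult.commute)
  finally have "k * (card G * d) \<le> k * ((k - 1) * (\<Sum>T\<in>fl.nt. inum (R\<inverse>) (R\<inverse>) T))" by simp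
  also have "\<dots> = (k - 1) * (k * (\<Sum>T\<in>fl.nt. inum (R\<inverse>) (R\<inverse>) T))" by (rule mult.left_commute)
  also have "\<dots> = (k - 1) * (d * (d - 1))" using fl.sum_inum_self[OF Ri] by (simp add: d_def val_conv)
  finally have "d * (card G * k) \<le> d * ((k - 1) * (d - 1))" by (simp only: mult_ac)
  then show ?thesis using d0 by (simp add: G_def d_def)
qed

end

section \<open>Two exceptional valencies\<close>

lemma sum_concentrated_dvd:
  fixes h :: "'b \<Rightarrow> nat"
  assumes "finite A" "sum h A = n" "n > 0" "\<And>x. x \<in> A \<Longrightarrow> n dvd h x"
  obtains u where "u \<in> A" "h u = n" "\<And>x. x \<in> A \<Longrightarrow> x \<noteq> u \<Longrightarrow> h x = 0"
proof -
  have "\<exists>u\<in>A. h u \<noteq> 0" using assms(2,3) by (metis less_numeral_extra(3) sum.neutral)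
  then obtain u where u: "u \<in> A" "h u \<noteq> 0" by blast
  have ge: "n \<le> h u" using assms(4)[OF u(1)] u(2) dvd_imp_le by blast
  have eq: "h u + sum h (A - {u}) = n" using assms(1,2) u(1) by (simp add: sum.remove)
  then have "h u = n" "sum h (A - {u}) = 0" using ge by auto
  then show ?thesis using that[of u] u assms(1) by auto
qed

text \<open>Each value of \<open>G\<close> is at most its total, so equality forces \<open>G\<close>
  to attain its total wherever \<open>F\<close> is positive, and conversely.\<close>

lemma sum_concentrated_mult:
  fixes F G :: "'b \<Rightarrow> nat"
  assumes fin: "finite A" and prod: "(\<Sum>x\<in>A. F x * G x) = sum F A * sum G A" and pos: "sum F A > 0" "sum G A > 0"
  obtains t where "t \<in> A" "F t = sum F A" "G t = sum G A" "\<And>x. x \<in> A \<Longrightarrow> x \<noteq> t \<Longrightarrow> F x = 0 \<and> G x = 0"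
proof -
  have key: "G t = sum G A" if F: "(\<Sum>x\<in>A. F x * G x) = sum F A * sum G A" and t: "t \<in> A" "F t > 0" for F G :: "'b \<Rightarrow> nat" and t
  proof (rule ccontr)
    have le: "G x \<le> sum G A" if "x \<in> A" for x using member_le_sum[OF that, of G] fin by simp
    assume "G t \<noteq> sum G A"
    then have "G t < sum G A" using le[OF t(1)] by simp
    then have "(\<Sum>x\<in>A. F x * G x) < (\<Sum>x\<in>A. F x * sum G A)"
      using fin t le by (intro sum_strict_mono_ex1) auto
    then show False using F by (simp add: sum_distrib_right)
  qed
  have "\<exists>t\<in>A. F t \<noteq> 0" using pos(1) by (metis less_numeral_extra(3) sum.neutral)
  then obtain t where t: "t \<in> A" "F t > 0" by auto
  have Gt: "G t = sum G A" by (rule key[OF prod t])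
  have Ft: "F t = sum F A" by (rule key[of G F t]) (use prod t Gt pos in \<open>auto simp: mult.commute\<close>)
  have "sum F (A - {t}) = 0" "sum G (A - {t}) = 0"
    using Ft Gt fin t by (auto simp: sum.remove)
  then show ?thesis using that[OF t(1) Ft Gt] fin by auto
qed

lemma even_card_symmetric:
  assumes fin: "finite T" and sym: "T\<inverse> = T" and irr: "\<And>x. (x, x) \<notin> T"
  shows "even (card T)"
proof -
  define r where "r = {(s, t). s \<in> T \<and> t \<in> T \<and> (t = s \<or> t = prod.swap s)}"
  have "equiv T r"
    by (rule equivI) (auto simp: r_def refl_on_def sym_def trans_def)
  then show ?thesis
  proof (rule equiv_imp_dvd_card[OF fin])
    fix C assume "C \<in> T // r"
    then obtain s where s: "s \<in> T" "C = r `` {s}" by (auto elim: quotientE)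
    have sw: "prod.swap s \<in> T" using s(1) sym by (cases s) auto
    have "C = {s, prod.swap s}" using s sw by (auto simp: r_def)
    moreover have "s \<noteq> prod.swap s" using irr s(1) by (cases s) auto
    ultimately show "even (card C)" by simp
  qed
qed

lemma sum_of_bool_eq:
  fixes h :: "'b \<Rightarrow> nat"
  assumes "finite A" "x \<in> A"
  shows "(\<Sum>y\<in>A. h y * of_bool (x = y)) = h x" "(\<Sum>y\<in>A. of_bool (x = y) * h y) = h x"
    "(\<Sum>y\<in>A. h y * of_bool (y = x)) = h x" "(\<Sum>y\<in>A. of_bool (y = x) * h y) = h x"
proof -
  have "(\<Sum>y\<in>A. h y * of_bool (x = y)) = (\<Sum>y\<in>A. if y = x then h y else 0)" by (rule sum.cong) auto
  then show 1: "(\<Sum>y\<in>A. h y * of_bool (x = y)) = h x" using assms by simp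
  then show "(\<Sum>y\<in>A. of_bool (x = y) * h y) = h x" by (simp add: mult.commute)
  show 2: "(\<Sum>y\<in>A. h y * of_bool (y = x)) = h x" using 1 by (simp add: eq_commute)
  then show "(\<Sum>y\<in>A. of_bool (y = x) * h y) = h x" by (simp add: mult.commute)
qed

lemma bezout_complement:
  fixes a b a' b' f g :: nat
  assumes "a = g + b'" "b = f + a'" "a * a' + b * b' = a * b + 1"
  shows "f * g + 1 = a' * b'" "a * f + 1 = b * b'" "b * g + 1 = a * a'"
proof -
  show 1: "f * g + 1 = a' * b'" using assms(3) unfolding assms(1,2) by (simp add: algebra_simps)
  show "a * f + 1 = b * b'" "b * g + 1 = a * a'" using 1 unfolding assms(1,2) by (simp_all add: algebra_simps)
qed

context equivalenced_pair
begin

text \<open>Otherwise \<open>T\<close> and the diagonal would form an equivalence relation with classes of size \<open>k + 1\<close>,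
  which does not divide \<open>p\<close>.\<close>

lemma nt_not_equivalence:
  assumes T: "T \<in> nt" and sym: "T\<inverse> = T"
  obtains z z' where "(z, z') \<in> T" "card {w. (z, w) \<in> T \<and> (w, z') \<in> T} + 2 \<le> k"
proof (rule ccontr)
  note found = that
  assume "\<not> thesis"
  have big: "card {w. (z, w) \<in> T \<and> (w, z') \<in> T} + 2 > k" if zz: "(z, z') \<in> T" for z z'
  proof (rule ccontr)
    assume "\<not> card {w. (z, w) \<in> T \<and> (w, z') \<in> T} + 2 > k"
    then have "card {w. (z, w) \<in> T \<and> (w, z') \<in> T} + 2 \<le> k" by simp
    then have thesis by (rule found[OF zz])
    then show False using \<open>\<not> thesis\<close> by blast
  qed
  have Tr: "T \<in> xx.rels" "T \<noteq> Id_on X" using T by auto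
  have irr: "(x, x) \<notin> T" for x using rel_offdiag[OF Tr] by blast
  have TX: "T \<subseteq> X \<times> X" by (rule xx.rels_sub[OF Tr(1)])
  have symD: "(y, x) \<in> T" if "(x, y) \<in> T" for x y using that sym by blast
  have tr: "(z, w) \<in> T" if z: "(z, z') \<in> T" "(z', w) \<in> T" "z \<noteq> w" for z z' w
  proof -
    have z'X: "z' \<in> X" using z TX by auto
    have fin: "finite {w. (z', w) \<in> T}" using TX xx.finite_X by (auto intro: finite_subset[of _ X])
    have c: "card {w. (z', w) \<in> T} = k" using xx.card_row[OF Tr(1) z'X] val_nt[OF T] by simp
    \<comment> \<open>At most \<open>k - 1\<close> common neighbours are possible, and more than
      \<open>k - 2\<close> are assumed. So every neighbour of \<open>z'\<close> other than
      \<open>z\<close> is a neighbour of \<open>z\<close>, which is transitivity.\<close>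
    have sub: "{w. (z, w) \<in> T \<and> (w, z') \<in> T} \<subseteq> {w. (z', w) \<in> T} - {z}" using irr symD by auto
    have "card ({w. (z', w) \<in> T} - {z}) = k - 1" using c fin symD[OF z(1)] by simp
    then have "{w. (z, w) \<in> T \<and> (w, z') \<in> T} = {w. (z', w) \<in> T} - {z}"
      using big[OF z(1)] fin by (intro card_seteq sub) auto
    then show ?thesis using z by blast
  qed
  have eq: "equiv X (T \<union> Id_on X)"
  proof (rule equivI)
    show "T \<union> Id_on X \<subseteq> X \<times> X" using TX by auto
    show "refl_on X (T \<union> Id_on X)" using TX by (auto simp: refl_on_def)
    show "sym (T \<union> Id_on X)" using symD by (auto simp: sym_def)
    show "trans (T \<union> Id_on X)" using tr TX by (auto simp: trans_def)
  qed
  have "(k + 1) dvd card X"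
  proof (rule equiv_imp_dvd_card[OF xx.finite_X eq])
    fix C assume "C \<in> X // (T \<union> Id_on X)"
    then obtain x where x: "x \<in> X" "C = (T \<union> Id_on X) `` {x}" by (auto elim: quotientE)
    have "C = insert x {y. (x, y) \<in> T}" using x by auto
    moreover have "finite {y. (x, y) \<in> T}" using TX xx.finite_X by (auto intro: finite_subset[of _ X])
    moreover have "card {y. (x, y) \<in> T} = k" using xx.card_row[OF Tr(1) x(1)] val_nt[OF T] by simp
    ultimately have "card C = k + 1" using irr by simp
    then show "(k + 1) dvd card C" by simp
  qed
  then have "(k + 1) dvd p" by (simp add: card_X)
  then have "k + 1 = p" using p_prime k_pos prime_nat_iff by auto
  then show False using p_eq k_pos m2 by auto
qed

end

section \<open>Two relations with valencies a a' and b b' whose sum is k + 1\<close>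

locale special_pair = equivalenced_pair V RR X Y p k m for V :: "'a set" and RR X Y p k m +
  fixes R1 R2 :: "('a \<times> 'a) set" and a b a' b' :: nat
  assumes R1: "R1 \<in> xy.rels" and R2: "R2 \<in> xy.rels" and ne12: "R1 \<noteq> R2"
    and val1: "xx.val R1 = a * a'" and val2: "xx.val R2 = b * b'"
    and k_eq: "k = a * b" and sum_eq: "a * a' + b * b' = a * b + 1" and a2: "a \<ge> 2" and b2: "b \<ge> 2"
begin

lemma sflip: "special_pair V RR Y X p k m (R1\<inverse>) (R2\<inverse>) a b a' b'"
proof -
  interpret fl: equivalenced_pair V RR Y X p k m by (rule eflip)
  show ?thesis
    by unfold_locales (use conv_rel R1 R2 ne12 val1 val2 k_eq sum_eq a2 b2 in \<open>auto simp: val_conv\<close>)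
qed

lemma sswap: "special_pair V RR X Y p k m R2 R1 b a b' a'"
  by unfold_locales (use R1 R2 ne12 val1 val2 k_eq sum_eq a2 b2 in \<open>auto simp: mult.commute add.commute\<close>)

lemma a'_pos: "a' > 0" using xy.val_pos[OF R1] val1 by simp
lemma b'_pos: "b' > 0" using xy.val_pos[OF R2] val2 by simp

text \<open>The coefficients of \<open>A\<^sub>R A\<^sub>R\<^sup>T\<close> off the diagonal add up
  to \<open>b' * f\<close> for \<open>R2\<close> and, symmetrically, to \<open>a' * g\<close> for
  \<open>R1\<close>.\<close>

definition f where "f = b - a'"
definition g where "g = a - b'"

lemma a'_less: "a' < b"
proof -
  have "b * b' \<ge> 2 * 1" by (rule mult_mono) (use b2 b'_pos in auto)
  then have "a * a' < a * b" using sum_eq by linarith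
  then show ?thesis by simp
qed

lemma b'_less: "b' < a"
proof -
  have "a * a' \<ge> 2 * 1" by (rule mult_mono) (use a2 a'_pos in auto)
  then have "b * b' < a * b" using sum_eq by linarith
  then have "b * b' < b * a" by (simp only: mult.commute)
  then show ?thesis by simp
qed

lemma f_pos: "f > 0" and g_pos: "g > 0" and b_eq: "b = f + a'" and a_eq: "a = g + b'"
  using a'_less b'_less by (auto simp: f_def g_def)

lemma fg: "f * g + 1 = a' * b'" and af: "a * f + 1 = b * b'" and bg: "b * g + 1 = a * a'"
  using bezout_complement[OF a_eq b_eq sum_eq] by auto

lemma coprime_ab': "coprime a b'"
proof (rule coprimeI)
  fix c assume c: "c dvd a" "c dvd b'"
  then have "c dvd a * f + 1" unfolding af by simp
  then show "is_unit c" using c(1) by (metis dvd_add_right_iff dvd_mult2)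
qed

text \<open>\<open>b * b'\<close> divides \<open>a * b\<close> times the coefficient, and
  \<open>b'\<close> is prime to \<open>a\<close>. Such divisibilities, set against small totals,
  concentrate products on single relations.\<close>

lemma b'_dvd:
  assumes S: "S \<in> xy.rels" and T: "T \<in> nt"
  shows "b' dvd inum R2 S T" "b' dvd inum S R2 T"
proof -
  have *: "b' dvd n" if "b * b' dvd k * n" for n
  proof -
    have "b * b' dvd b * (a * n)" using that by (simp add: k_eq mult_ac)
    then have "b' dvd a * n" using b2 by simp
    then show ?thesis using coprime_ab' by (simp add: coprime_dvd_mult_right_iff coprime_commute)
  qed
  show "b' dvd inum R2 S T" using inum_dvd(1)[OF R2 S T] val2 * by simp
  show "b' dvd inum S R2 T" using inum_dvd(2)[OF S R2 T] val2 * by simp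
qed

lemma sum22: "(\<Sum>T\<in>nt. inum R2 R2 T) = b' * f"
proof -
  have "b * b' - 1 = a * f" using af by simp
  then have "k * (\<Sum>T\<in>nt. inum R2 R2 T) = k * (b' * f)"
    using sum_inum_self[OF R2] by (simp add: val2 k_eq mult_ac)
  then show ?thesis using k_pos by simp
qed

text \<open>\<open>A\<^sub>R A\<^sub>R\<^sup>T\<close> is symmetric, so the transpose of
  \<open>T\<close> supports it as well.\<close>

lemma symmetric_of_unique:
  assumes T: "T \<in> nt" "inum R2 R2 T \<noteq> 0" and zero: "\<And>U. U \<in> nt \<Longrightarrow> U \<noteq> T \<Longrightarrow> inum R2 R2 U = 0"
  shows "T\<inverse> = T"
proof (rule ccontr)
  assume "T\<inverse> \<noteq> T"
  moreover have "T\<inverse> \<in> nt"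
  proof -
    have "T\<inverse> \<in> xx.rels" using conv_rel(2) T(1) by blast
    moreover have "T\<inverse> \<noteq> Id_on X" using T(1) by (metis DiffD2 converse_converse converse_Id_on singletonI)
    ultimately show ?thesis by blast
  qed
  ultimately have "inum R2 R2 (T\<inverse>) = 0" using zero by blast
  then show False using T inum_swap[OF R2 R2, of T] by auto
qed

text \<open>For \<open>f = 1\<close> the total \<open>b'\<close> is the least positive multiple of
  \<open>b'\<close>, so one symmetric relation \<open>T\<close> carries everything. Its size
  \<open>p * k\<close> is even, which forces \<open>p = 2\<close>, too small for
  \<open>m \<ge> 2\<close>.\<close>

lemma parity:
  assumes "f = 1" "odd k"
  shows False
proof -
  obtain T where T: "T \<in> nt" "inum R2 R2 T = b'" "\<And>U. U \<in> nt \<Longrightarrow> U \<noteq> T \<Longrightarrow> inum R2 R2 U = 0"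
    by (rule sum_concentrated_dvd[OF finite_nt, of "inum R2 R2" b'])
      (use sum22 assms b'_pos b'_dvd(1)[OF R2] in auto)
  have sym: "T\<inverse> = T" by (rule symmetric_of_unique) (use T b'_pos in auto)
  have Tr: "T \<in> xx.rels" "T \<noteq> Id_on X" using T by auto
  have "even (card T)"
    by (rule even_card_symmetric[OF _ sym]) (use rel_offdiag[OF Tr] finite_rel xx.rels_RR Tr in blast)+
  then have "even (p * k)" using xx.card_val[OF Tr(1)] val_nt[OF T(1)] by simp
  then have "even p" using assms by simp
  then have "p = 2" using p_prime prime_nat_iff by (metis numeral_eq_one_iff semiring_norm(85))
  then have "k * m = 1" using p_eq by simp
  then show False using m2 by simp
qed

context
  assumes cop: "coprime a' b'"
begin

text \<open>Each coefficient is divisible by the coprime numbers \<open>a'\<close> and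
  \<open>b'\<close>, and the total is only \<open>a' * b'\<close>.\<close>

lemma U_ex:
  obtains U where "U \<in> nt" "inum R1 R2 U = a' * b'" "\<And>T. T \<in> nt \<Longrightarrow> T \<noteq> U \<Longrightarrow> inum R1 R2 T = 0"
proof (rule sum_concentrated_dvd[OF finite_nt, of "inum R1 R2" "a' * b'"])
  interpret sw: special_pair V RR X Y p k m R2 R1 b a b' a' by (rule sswap)
  have "k * (\<Sum>T\<in>nt. inum R1 R2 T) = k * (a' * b')"
    using val_mult[OF R1 R2] ne12 by (auto simp: val1 val2 k_eq mult_ac)
  then show "(\<Sum>T\<in>nt. inum R1 R2 T) = a' * b'" using k_pos by simp
  show "a' * b' > 0" using a'_pos b'_pos by simp
  show "a' * b' dvd inum R1 R2 T" if "T \<in> nt" for T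
    using b'_dvd(2)[OF R1 that] sw.b'_dvd(1)[OF R2 that] cop by (simp add: divides_mult)
qed (rule that)

end

end

lemma sum_square_le:
  fixes h :: "'b \<Rightarrow> real"
  assumes "finite A"
  shows "(\<Sum>x\<in>A. h x)^2 \<le> real (card A) * (\<Sum>x\<in>A. (h x)^2)"
proof -
  define n s q where "n = real (card A)" and "s = (\<Sum>x\<in>A. h x)" and "q = (\<Sum>x\<in>A. (h x)^2)"
  have "0 \<le> (\<Sum>x\<in>A. (n * h x - s)^2)" by (simp add: sum_nonneg)
  also have "\<dots> = (\<Sum>x\<in>A. n^2 * (h x)^2 - 2 * n * s * h x + s^2)"
    by (rule sum.cong) (auto simp: power2_eq_square algebra_simps)
  also have "\<dots> = n^2 * q - 2 * n * s * s + n * s^2"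
    by (simp add: sum.distrib sum_subtractf n_def s_def q_def flip: sum_distrib_left)
  also have "\<dots> = n * (n * q - s^2)" by (simp add: power2_eq_square algebra_simps)
  finally have *: "0 \<le> n * (n * q - s^2)" .
  show ?thesis
  proof (cases "A = {}")
    case False
    then have "n > 0" using assms by (simp add: n_def card_gt_0_iff)
    then show ?thesis using * by (simp add: zero_le_mult_iff n_def s_def q_def)
  qed simp
qed

context equivalenced_pair
begin

text \<open>The matrix form of concentration: off the diagonal the product is a multiple of one
  adjacency matrix.\<close>

lemma common_form:
  assumes S: "S \<in> xy.rels" "S' \<in> xy.rels" and T: "T \<in> nt" "inum S S' T = c"
    "\<And>U. U \<in> nt \<Longrightarrow> U \<noteq> T \<Longrightarrow> inum S S' U = 0" and x: "x \<in> X" "x' \<in> X"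
  shows "common S S' x x' = (if S = S' then xx.val S else 0) * of_bool (x = x') + c * adj T x x'"
proof -
  obtain U where U: "U \<in> xx.rels" "(x, x') \<in> U" by (rule xx.rels_ex[OF x])
  have i: "common S S' x x' = inum S S' U" by (rule inum_rels[OF S U])
  have adj: "adj T x x' = (of_bool (U = T) :: nat)" by (rule xx.adj_rel[OF _ U]) (use T(1) in simp)
  show ?thesis
  proof (cases "U = Id_on X")
    case True
    then have "x = x'" "U \<noteq> T" using U(2) T(1) by auto
    then show ?thesis using i adj inum_Id[OF S] True by simp
  next
    case False
    then have "x \<noteq> x'" using rel_offdiag[OF U(1) False U(2)] by simp
    then show ?thesis using i adj T U False by (cases "U = T") auto
  qed
qed

end

section \<open>The case of coprime cofactors\<close>

context special_pair
begin

context
  assumes cop: "coprime a' b'"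
begin

text \<open>The product of the reversed relations is concentrated by \<open>U_ex\<close>, so
  \<open>norm_nt\<close> on the \<open>Y\<close> side gives the inner product of the two coefficient
  vectors on \<open>X\<close>. Divided by \<open>a' * b'\<close> it is \<open>f * g\<close>, the
  product of the totals \<open>f\<close> and \<open>g\<close> of the scaled vectors; so both are
  supported on one relation.\<close>

lemma T_ex:
  obtains T where "T \<in> nt" "inum R2 R2 T = b' * f" "inum R1 R1 T = a' * g"
    "\<And>S. S \<in> nt \<Longrightarrow> S \<noteq> T \<Longrightarrow> inum R2 R2 S = 0 \<and> inum R1 R1 S = 0"
proof -
  note found = that
  interpret fl: special_pair V RR Y X p k m "R1\<inverse>" "R2\<inverse>" a b a' b' by (rule sflip)
  interpret sw: special_pair V RR X Y p k m R2 R1 b a b' a' by (rule sswap)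
  have swf: "sw.f = g" by (simp add: sw.f_def g_def)
  obtain U where U: "U \<in> fl.nt" "inum (R1\<inverse>) (R2\<inverse>) U = a' * b'"
    "\<And>T. T \<in> fl.nt \<Longrightarrow> T \<noteq> U \<Longrightarrow> inum (R1\<inverse>) (R2\<inverse>) T = 0"
    by (rule fl.U_ex[OF cop]) (rule that)
  have "(\<Sum>T\<in>fl.nt. (inum (R1\<inverse>) (R2\<inverse>) T)^2) = (a' * b')^2"
  proof -
    have "(\<Sum>T\<in>fl.nt. (inum (R1\<inverse>) (R2\<inverse>) T)^2) = (inum (R1\<inverse>) (R2\<inverse>) U)^2 + (\<Sum>T\<in>fl.nt - {U}. (inum (R1\<inverse>) (R2\<inverse>) T)^2)"
      using U(1) fl.finite_nt by (rule sum.remove[rotated])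
    also have "(\<Sum>T\<in>fl.nt - {U}. (inum (R1\<inverse>) (R2\<inverse>) T)^2) = 0" by (rule sum.neutral) (use U(3) in auto)
    finally show ?thesis using U(2) by simp
  qed
  then have "k * (a' * b')^2 = (a * a') * (b * b') + k * (\<Sum>T\<in>nt. inum R1 R1 T * inum R2 R2 T)"
    using fl.norm_nt[OF fl.R1 fl.R2 fl.ne12] fl.val1 fl.val2 by simp
  also have "\<dots> = k * (a' * b' + (\<Sum>T\<in>nt. inum R1 R1 T * inum R2 R2 T))" by (simp add: k_eq algebra_simps)
  finally have n: "(a' * b')^2 = a' * b' + (\<Sum>T\<in>nt. inum R1 R1 T * inum R2 R2 T)" using k_pos by simp
  define F where "F T = inum R2 R2 T div b'" for T
  define G where "G T = inum R1 R1 T div a'" for T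
  have F: "inum R2 R2 T = b' * F T" if "T \<in> nt" for T using b'_dvd(1)[OF R2 that] by (simp add: F_def)
  have G: "inum R1 R1 T = a' * G T" if "T \<in> nt" for T using sw.b'_dvd(1)[OF R1 that] by (simp add: G_def)
  have "b' * sum F nt = b' * f" using sum22 F by (simp add: sum_distrib_left)
  then have SF: "sum F nt = f" using b'_pos by simp
  have "a' * sum G nt = a' * g" using sw.sum22 G by (simp add: sum_distrib_left swf)
  then have SG: "sum G nt = g" using a'_pos by simp
  have "(\<Sum>T\<in>nt. inum R1 R1 T * inum R2 R2 T) = a' * b' * (\<Sum>T\<in>nt. F T * G T)"
    unfolding sum_distrib_left by (rule sum.cong) (use F G in \<open>auto simp: mult_ac\<close>)
  then have "a' * b' * (a' * b') = a' * b' * (1 + (\<Sum>T\<in>nt. F T * G T))" using n by (simp add: power2_eq_square)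
  then have "a' * b' = 1 + (\<Sum>T\<in>nt. F T * G T)"
    by (subst (asm) nat_mult_eq_cancel1) (use a'_pos b'_pos in simp_all)
  then have FG: "(\<Sum>T\<in>nt. F T * G T) = sum F nt * sum G nt" using fg SF SG by simp
  obtain T where T: "T \<in> nt" "F T = sum F nt" "G T = sum G nt" "\<And>x. x \<in> nt \<Longrightarrow> x \<noteq> T \<Longrightarrow> F x = 0 \<and> G x = 0"
    by (rule sum_concentrated_mult[OF finite_nt FG]) (use SF SG f_pos g_pos in auto)
  show ?thesis by (rule found[OF T(1)]) (use F G T SF SG in auto)
qed

text \<open>Two opposing estimates for the number \<open>\<mu>\<close> of \<open>w\<close> with
  \<open>(v, w) \<in> T\<close> and \<open>(x, w) \<in> U\<close>, given
  \<open>(x, v) \<in> U\<close>. Cauchy--Schwarz bounds it from below, and the failure of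
  \<open>T\<close> to be an equivalence, combined with a divisibility, bounds it from above.\<close>

lemma counting_bound: "b' * f \<le> 1"
proof -
  interpret fl: special_pair V RR Y X p k m "R1\<inverse>" "R2\<inverse>" a b a' b' by (rule sflip)
  interpret S: fiber_pair V RR X X p by (rule self)
  obtain U where U: "U \<in> nt" "inum R1 R2 U = a' * b'" "\<And>T. T \<in> nt \<Longrightarrow> T \<noteq> U \<Longrightarrow> inum R1 R2 T = 0"
    by (rule U_ex[OF cop]) (rule that)
  obtain T where T: "T \<in> nt" "inum R2 R2 T = b' * f" "inum R1 R1 T = a' * g"
    "\<And>S. S \<in> nt \<Longrightarrow> S \<noteq> T \<Longrightarrow> inum R2 R2 S = 0 \<and> inum R1 R1 S = 0"
    by (rule T_ex) (rule that)
  obtain T' where T': "T' \<in> fl.nt" "inum (R2\<inverse>) (R2\<inverse>) T' = b' * f" "inum (R1\<inverse>) (R1\<inverse>) T' = a' * g"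
    "\<And>S. S \<in> fl.nt \<Longrightarrow> S \<noteq> T' \<Longrightarrow> inum (R2\<inverse>) (R2\<inverse>) S = 0 \<and> inum (R1\<inverse>) (R1\<inverse>) S = 0"
    by (rule fl.T_ex[OF cop]) (rule that)
  have Tr: "T \<in> xx.rels" "T \<noteq> Id_on X" and Ur: "U \<in> xx.rels" using T(1) U(1) by auto
  have sym: "T\<inverse> = T" by (rule symmetric_of_unique) (use T b'_pos f_pos in auto)
  define A1 where "A1 = (adj R1 :: 'a \<Rightarrow> 'a \<Rightarrow> nat)"
  define A2 where "A2 = (adj R2 :: 'a \<Rightarrow> 'a \<Rightarrow> nat)"
  define t where "t = (adj T :: 'a \<Rightarrow> 'a \<Rightarrow> nat)"
  define t' where "t' = (adj T' :: 'a \<Rightarrow> 'a \<Rightarrow> nat)"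
  define u where "u = (adj U :: 'a \<Rightarrow> 'a \<Rightarrow> nat)"
  have fX: "finite X" and fY: "finite Y" by (rule xx.finite_X, rule xy.finite_F)
  have c22: "(\<Sum>y\<in>Y. A2 x y * A2 x' y) = b * b' * of_bool (x = x') + b' * f * t x x'" if "x \<in> X" "x' \<in> X" for x x'
    using common_form[OF R2 R2 T(1,2) _ that] T(4) common_sum[OF R2, of R2 x x'] val2 by (simp add: A2_def t_def)
  have c12: "(\<Sum>y\<in>Y. A1 x y * A2 x' y) = a' * b' * u x x'" if "x \<in> X" "x' \<in> X" for x x'
    using common_form[OF R1 R2 U that] common_sum[OF R1, of R2 x x'] ne12 by (simp add: A1_def A2_def u_def)
  have d22: "(\<Sum>x\<in>X. A2 x y * A2 x y') = b * b' * of_bool (y = y') + b' * f * t' y y'" if "y \<in> Y" "y' \<in> Y" for y y'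
    using fl.common_form[OF fl.R2 fl.R2 T'(1,2) _ that] T'(4) fl.common_sum[OF fl.R2, of "R2\<inverse>" y y'] val2
    by (simp add: A2_def t'_def val_conv adj_def)
  have d11: "(\<Sum>x\<in>X. A1 x y * A1 x y') = a * a' * of_bool (y = y') + a' * g * t' y y'" if "y \<in> Y" "y' \<in> Y" for y y'
    using fl.common_form[OF fl.R1 fl.R1 T'(1,3) _ that] T'(4) fl.common_sum[OF fl.R1, of "R1\<inverse>" y y'] val1
    by (simp add: A1_def t'_def val_conv adj_def)
  have col2: "(\<Sum>x\<in>X. A2 x y) = b * b'" if "y \<in> Y" for y
    using adj_col[OF R2 that] val2 by (simp add: A2_def)
  have symt: "t x x' = t x' x" for x x' using sym by (auto simp: t_def adj_def)
  have bf: "b' * f > 0" using b'_pos f_pos by simp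
  \<comment> \<open>Evaluate the triple product \<open>A2\<close>, transpose of \<open>A2\<close>,
    \<open>A2\<close> with either bracketing; the diagonal parts agree and leave
    \<open>A2 t' = t A2\<close>.\<close>
  have comm: "(\<Sum>y'\<in>Y. A2 x y' * t' y' y) = (\<Sum>x'\<in>X. t x x' * A2 x' y)" if xy: "x \<in> X" "y \<in> Y" for x y
  proof -
    have "(\<Sum>x'\<in>X. (\<Sum>y'\<in>Y. A2 x y' * A2 x' y') * A2 x' y) = (\<Sum>y'\<in>Y. A2 x y' * (\<Sum>x'\<in>X. A2 x' y' * A2 x' y))"
      unfolding sum_distrib_left sum_distrib_right by (subst sum.swap) (simp add: mult_ac)
    moreover have "(\<Sum>x'\<in>X. (\<Sum>y'\<in>Y. A2 x y' * A2 x' y') * A2 x' y)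
        = (\<Sum>x'\<in>X. b * b' * (of_bool (x = x') * A2 x' y) + b' * f * (t x x' * A2 x' y))"
      by (intro sum.cong refl) (simp only: c22[OF xy(1)], simp only: distrib_right distrib_left mult_ac)
    moreover have "\<dots> = b * b' * A2 x y + b' * f * (\<Sum>x'\<in>X. t x x' * A2 x' y)"
      using sum_of_bool_eq(2)[OF fX xy(1), of "\<lambda>x'. A2 x' y"] by (simp only: sum.distrib sum_distrib_left[symmetric])
    moreover have "(\<Sum>y'\<in>Y. A2 x y' * (\<Sum>x'\<in>X. A2 x' y' * A2 x' y))
        = (\<Sum>y'\<in>Y. b * b' * (A2 x y' * of_bool (y' = y)) + b' * f * (A2 x y' * t' y' y))"
      by (intro sum.cong refl) (simp only: d22[OF _ xy(2)], simp only: distrib_right distrib_left mult_ac)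
    moreover have "\<dots> = b * b' * A2 x y + b' * f * (\<Sum>y'\<in>Y. A2 x y' * t' y' y)"
      using sum_of_bool_eq(3)[OF fY xy(2), of "A2 x"] by (simp only: sum.distrib sum_distrib_left[symmetric])
    ultimately have "b' * f * (\<Sum>x'\<in>X. t x x' * A2 x' y) = b' * f * (\<Sum>y'\<in>Y. A2 x y' * t' y' y)" by simp
    then show ?thesis using bf by simp
  qed
  \<comment> \<open>With \<open>W = A1 A2\<^sup>T = a' b' u\<close>, the entry at
    \<open>(z, z')\<close> of \<open>W\<^sup>T W\<close> is computed as that of
    \<open>A2 (A1\<^sup>T A1) A2\<^sup>T\<close>, using \<open>comm\<close> to move
    \<open>t'\<close> past \<open>A2\<close>.\<close>
  have main: "(a' * b')^2 * (\<Sum>x\<in>X. u x z * u x z') = a * a' * (b' * f) + a' * g * (b * b' + b' * f * (\<Sum>w\<in>X. t z w * t w z'))"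
    if zz: "(z, z') \<in> T" for z z'
  proof -
    have z: "z \<in> X" "z' \<in> X" using xx.rels_sub[OF Tr(1)] zz by auto
    have "z \<noteq> z'" by (rule rel_offdiag[OF Tr zz])
    have tz: "t z z' = 1" using zz by (simp add: t_def adj_def)
    have "(a' * b')^2 * (\<Sum>x\<in>X. u x z * u x z') = (\<Sum>x\<in>X. (a' * b' * u x z) * (a' * b' * u x z'))"
      by (simp add: sum_distrib_left power2_eq_square mult_ac)
    also have "\<dots> = (\<Sum>x\<in>X. (\<Sum>y\<in>Y. A1 x y * A2 z y) * (\<Sum>y\<in>Y. A1 x y * A2 z' y))"
      by (rule sum.cong) (auto simp: c12 z)
    also have "\<dots> = (\<Sum>x\<in>X. \<Sum>y\<in>Y. \<Sum>y'\<in>Y. (A2 z y * A2 z' y') * (A1 x y * A1 x y'))"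
      unfolding sum_product by (simp add: mult_ac)
    also have "\<dots> = (\<Sum>y'\<in>Y. \<Sum>x\<in>X. \<Sum>y\<in>Y. (A2 z y * A2 z' y') * (A1 x y * A1 x y'))"
      by (rule sum_rotate)
    also have "\<dots> = (\<Sum>y'\<in>Y. \<Sum>y\<in>Y. (A2 z y * A2 z' y') * (\<Sum>x\<in>X. A1 x y * A1 x y'))"
      unfolding sum_distrib_left by (intro sum.cong refl sum.swap)
    also have "\<dots> = (\<Sum>y'\<in>Y. \<Sum>y\<in>Y. a * a' * (A2 z' y' * (A2 z y * of_bool (y = y'))) + a' * g * (A2 z' y' * (A2 z y * t' y y')))"
      by (intro sum.cong refl) (simp only: d11, simp only: distrib_right distrib_left mult_ac)
    also have "\<dots> = a * a' * (\<Sum>y'\<in>Y. A2 z' y' * (\<Sum>y\<in>Y. A2 z y * of_bool (y = y'))) + a' * g * (\<Sum>y'\<in>Y. A2 z' y' * (\<Sum>y\<in>Y. A2 z y * t' y y'))"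
      by (simp only: sum.distrib sum_distrib_left)
    also have "(\<Sum>y'\<in>Y. A2 z' y' * (\<Sum>y\<in>Y. A2 z y * of_bool (y = y'))) = (\<Sum>y'\<in>Y. A2 z y' * A2 z' y')"
      by (intro sum.cong refl) (simp only: sum_of_bool_eq(3)[OF fY] mult.commute)
    also have "\<dots> = b' * f" using c22[OF z] tz \<open>z \<noteq> z'\<close> by simp
    also have "(\<Sum>y'\<in>Y. A2 z' y' * (\<Sum>y\<in>Y. A2 z y * t' y y')) = (\<Sum>y'\<in>Y. A2 z' y' * (\<Sum>w\<in>X. t z w * A2 w y'))"
      by (intro sum.cong refl) (simp only: comm[OF z(1)])
    also have "\<dots> = (\<Sum>w\<in>X. t z w * (\<Sum>y'\<in>Y. A2 w y' * A2 z' y'))"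
      unfolding sum_distrib_left by (subst sum.swap) (simp add: mult_ac)
    also have "\<dots> = (\<Sum>w\<in>X. b * b' * (t z w * of_bool (w = z')) + b' * f * (t z w * t w z'))"
      by (intro sum.cong refl) (simp only: c22[OF _ z(2)], simp only: distrib_right distrib_left mult_ac)
    also have "\<dots> = b * b' * t z z' + b' * f * (\<Sum>w\<in>X. t z w * t w z')"
      using sum_of_bool_eq(3)[OF fX z(2), of "t z"] by (simp only: sum.distrib sum_distrib_left[symmetric])
    finally show ?thesis using tz by simp
  qed
  obtain z z' where zz: "(z, z') \<in> T" "card {w. (z, w) \<in> T \<and> (w, z') \<in> T} + 2 \<le> k"
    by (rule nt_not_equivalence[OF T(1) sym])
  define lam where "lam = (\<Sum>w\<in>X. t z w * t w z')"
  have lam_le: "lam + 2 \<le> k"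
  proof -
    have "X \<inter> {w. (z, w) \<in> T \<and> (w, z') \<in> T} = {w. (z, w) \<in> T \<and> (w, z') \<in> T}" using xx.rels_sub[OF Tr(1)] by blast
    then have "lam = card {w. (z, w) \<in> T \<and> (w, z') \<in> T}" using fX by (simp add: lam_def t_def adj_def flip: of_bool_conj)
    then show ?thesis using zz(2) by simp
  qed
  define \<mu> where "\<mu> = inum (U\<inverse>) (U\<inverse>) T"
  have Ui: "U\<inverse> \<in> xx.rels" using conv_rel(2) Ur by blast
  have "(\<Sum>x\<in>X. u x z * u x z') = \<mu>"
  proof -
    have "X \<inter> {x. (x, z) \<in> U \<and> (x, z') \<in> U} = {x. (x, z) \<in> U \<and> (x, z') \<in> U}" using xx.rels_sub[OF Ur] by blast
    then have "(\<Sum>x\<in>X. u x z * u x z') = common (U\<inverse>) (U\<inverse>) z z'"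
      using fX by (simp add: u_def adj_def common_def flip: of_bool_conj)
    then show ?thesis using S.inum_rels[OF Ui Ui Tr(1) zz(1)] by (simp add: \<mu>_def)
  qed
  then have "(a' * b') * (a' * b' * \<mu>) = (a' * b') * (a * f + b * g + f * g * lam)"
    using main[OF zz(1)] by (simp add: lam_def power2_eq_square algebra_simps)
  then have mu: "a' * b' * \<mu> = a * f + b * g + f * g * lam" using a'_pos b'_pos by simp
  have val_U: "xx.val (U\<inverse>) = k" using val_nt[OF U(1)] by (simp add: val_conv)
  \<comment> \<open>The same triangles are now counted from an edge of \<open>U\<close> instead of
    an edge of \<open>T\<close>; both valencies are \<open>k\<close>, so the count per edge stays
    \<open>\<mu>\<close>.\<close>
  have "k * \<mu> = k * tnum T (U\<inverse>) (U\<inverse>)"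
    using S.triangle_count[OF Ui Ui Tr(1)] val_U val_nt[OF T(1)] by (simp add: \<mu>_def)
  then have mut: "\<mu> = tnum T (U\<inverse>) (U\<inverse>)" using k_pos by simp
  obtain x v where xv: "(x, v) \<in> U" "x \<in> X" "v \<in> X" by (rule xx.rel_pick[OF Ur])
  define Z where "Z = {w\<in>X. (v, w) \<in> T \<and> (x, w) \<in> U}"
  have "{w. (v, w) \<in> T \<and> (w, x) \<in> U\<inverse>} = Z" using xx.rels_sub[OF Ur] by (auto simp: Z_def)
  then have cZ: "card Z = \<mu>"
    using tnum_eq[OF xx.rels_RR[OF Tr(1)] xx.rels_RR[OF Ui] xx.rels_RR[OF Ui], of v x] xv(1) mut by simp
  \<comment> \<open>The number of \<open>y\<close> joined to \<open>x\<close> by \<open>R1\<close>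
    and to both \<open>v\<close> and \<open>w\<close> by \<open>R2\<close>. It vanishes unless
    \<open>w = v\<close> or \<open>w \<in> Z\<close>, and its first two moments are computable, so
    Cauchy--Schwarz over \<open>Z\<close> bounds \<open>\<mu>\<close>.\<close>
  define q where "q w = (\<Sum>y\<in>Y. A1 x y * A2 v y * A2 w y)" for w
  have ux: "u x v = 1" using xv(1) by (simp add: u_def adj_def)
  have cxv: "(\<Sum>y\<in>Y. A1 x y * A2 v y) = a' * b'" using c12[OF xv(2,3)] ux by simp
  have idem: "A1 i j * A1 i j = A1 i j" "A2 i j * A2 i j = A2 i j" for i j by (simp_all add: A1_def A2_def adj_def)
  have q1: "(\<Sum>w\<in>X. q w) = a' * b' * (b * b')"
  proof -
    have "(\<Sum>w\<in>X. q w) = (\<Sum>y\<in>Y. A1 x y * A2 v y * (\<Sum>w\<in>X. A2 w y))"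
      unfolding q_def sum_distrib_left by (rule sum.swap)
    also have "\<dots> = (\<Sum>y\<in>Y. A1 x y * A2 v y) * (b * b')"
      unfolding sum_distrib_right by (rule sum.cong) (auto simp: col2)
    finally show ?thesis using cxv by simp
  qed
  define B where "B y = A1 x y * A2 v y" for y
  have BB: "B y * B y = B y" for y
  proof -
    have "B y * B y = (A1 x y * A1 x y) * (A2 v y * A2 v y)" by (simp only: B_def mult_ac)
    then show ?thesis by (simp only: idem B_def)
  qed
  have q2: "(\<Sum>w\<in>X. q w * q w) + a' * b' * (b' * f) = a' * b' * (b * b') + a' * b' * (a' * b') * (b' * f)"
  proof -
    have "(\<Sum>w\<in>X. q w * q w) = (\<Sum>w\<in>X. \<Sum>y\<in>Y. \<Sum>y'\<in>Y. (B y * B y') * (A2 w y * A2 w y'))"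
      unfolding q_def sum_product B_def by (simp add: mult_ac)
    also have "\<dots> = (\<Sum>y'\<in>Y. \<Sum>w\<in>X. \<Sum>y\<in>Y. (B y * B y') * (A2 w y * A2 w y'))" by (rule sum_rotate)
    also have "\<dots> = (\<Sum>y'\<in>Y. \<Sum>y\<in>Y. B y * B y' * (\<Sum>w\<in>X. A2 w y * A2 w y'))"
      unfolding sum_distrib_left by (intro sum.cong refl sum.swap)
    finally have 1: "(\<Sum>w\<in>X. q w * q w) = (\<Sum>y'\<in>Y. \<Sum>y\<in>Y. B y * B y' * (\<Sum>w\<in>X. A2 w y * A2 w y'))" .
    \<comment> \<open>If both factors are nonzero, \<open>y\<close> and \<open>y'\<close> are joined
      to \<open>v\<close> by \<open>R2\<close>. For \<open>y \<noteq> y'\<close> the entry of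
      \<open>A2\<^sup>T A2\<close> is then nonzero, so \<open>t' y y' = 1\<close> and the entry is
      exactly \<open>b' * f\<close>.\<close>
    have 2: "B y * B y' * (\<Sum>w\<in>X. A2 w y * A2 w y') + b' * f * (B y * B y' * of_bool (y = y'))
        = b * b' * (B y * B y' * of_bool (y = y')) + b' * f * (B y * B y')" if y: "y \<in> Y" "y' \<in> Y" for y y'
    proof (cases "B y * B y' = 0")
      case True
      then show ?thesis by auto
    next
      case False
      then have nz: "A2 v y \<noteq> 0" "A2 v y' \<noteq> 0" by (auto simp: B_def)
      show ?thesis
      proof (cases "y = y'")
        case True
        have "t' y' y' = 0" using fl.rel_offdiag[of T' y' y'] T'(1) by (auto simp: t'_def adj_def)
        then show ?thesis using d22[OF y] True by (simp add: algebra_simps)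
      next
        case neq: False
        have "(\<Sum>w\<in>X. A2 w y * A2 w y') \<noteq> 0" using nz xv(3) fX by auto
        then have "t' y y' \<noteq> 0" using d22[OF y] neq by (auto)
        then have "t' y y' = 1" by (auto simp: t'_def adj_def split: if_splits)
        then show ?thesis using d22[OF y] neq by (simp add: algebra_simps)
      qed
    qed
    have s1: "(\<Sum>y'\<in>Y. \<Sum>y\<in>Y. B y * B y' * of_bool (y = y')) = a' * b'"
    proof -
      have "(\<Sum>y\<in>Y. B y * B y' * of_bool (y = y')) = B y'" if "y' \<in> Y" for y'
        using sum_of_bool_eq(3)[OF fY that, of "\<lambda>y. B y * B y'"] BB by simp
      then show ?thesis using cxv by (simp add: B_def)
    qed
    have s2: "(\<Sum>y'\<in>Y. \<Sum>y\<in>Y. B y * B y') = a' * b' * (a' * b')"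
      using cxv by (simp add: B_def flip: sum_distrib_left sum_distrib_right)
    have "(\<Sum>y'\<in>Y. \<Sum>y\<in>Y. B y * B y' * (\<Sum>w\<in>X. A2 w y * A2 w y') + b' * f * (B y * B y' * of_bool (y = y')))
        = (\<Sum>y'\<in>Y. \<Sum>y\<in>Y. b * b' * (B y * B y' * of_bool (y = y')) + b' * f * (B y * B y'))"
      by (intro sum.cong refl) (rule 2)
    then have "(\<Sum>w\<in>X. q w * q w) + b' * f * (\<Sum>y'\<in>Y. \<Sum>y\<in>Y. B y * B y' * of_bool (y = y'))
        = b * b' * (\<Sum>y'\<in>Y. \<Sum>y\<in>Y. B y * B y' * of_bool (y = y')) + b' * f * (\<Sum>y'\<in>Y. \<Sum>y\<in>Y. B y * B y')"
      unfolding 1 by (simp only: sum.distrib sum_distrib_left)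
    then show ?thesis unfolding s1 s2 by (simp only: mult_ac)
  qed
  have qv: "q v = a' * b'"
  proof -
    have "q v = (\<Sum>y\<in>Y. A1 x y * A2 v y)" unfolding q_def by (rule sum.cong) (simp_all only: mult.assoc idem)
    then show ?thesis using cxv by simp
  qed
  have q0: "q w = 0" if w: "w \<in> X" "w \<noteq> v" "w \<notin> Z" for w
  proof (cases "(x, w) \<in> U")
    case False
    then have "(\<Sum>y\<in>Y. A1 x y * A2 w y) = 0" using c12[OF xv(2) w(1)] by (simp add: u_def adj_def)
    then have "\<forall>y\<in>Y. A1 x y * A2 w y = 0" using fY by simp
    then show ?thesis unfolding q_def by (intro sum.neutral) auto
  next
    case True
    then have "(v, w) \<notin> T" using w by (auto simp: Z_def)
    then have "(\<Sum>y\<in>Y. A2 v y * A2 w y) = 0" using c22[OF xv(3) w(1)] w(2) by (simp add: t_def adj_def)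
    then have "\<forall>y\<in>Y. A2 v y * A2 w y = 0" using fY by simp
    then show ?thesis unfolding q_def by (intro sum.neutral) auto
  qed
  have vZ: "v \<notin> Z" using rel_offdiag[OF Tr, of v v] by (auto simp: Z_def)
  have ZX: "Z \<subseteq> X" by (auto simp: Z_def)
  have fZ: "finite Z" using ZX fX finite_subset by blast
  have split: "(\<Sum>w\<in>X. h w) = h v + (\<Sum>w\<in>Z. h w)" if h: "\<And>w. w \<in> X \<Longrightarrow> w \<noteq> v \<Longrightarrow> w \<notin> Z \<Longrightarrow> h w = 0" for h :: "'a \<Rightarrow> nat"
  proof -
    have "(\<Sum>w\<in>X. h w) = (\<Sum>w\<in>insert v Z. h w)"
      by (rule sum.mono_neutral_right[OF fX]) (use ZX xv(3) h in auto)
    then show ?thesis using fZ vZ by simp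
  qed
  define s1 where "s1 = (\<Sum>w\<in>Z. q w)"
  define s2 where "s2 = (\<Sum>w\<in>Z. q w * q w)"
  have "a' * b' + s1 = a' * b' * (a * f + 1)" using split[of q] q0 q1 qv af by (simp add: s1_def)
  then have s1: "s1 = a' * b' * (a * f)" by simp
  have s2: "s2 = (a' * b') * (a' * b') * (b' * f)"
  proof -
    have "a' * b' * (a' * b') + s2 + a' * b' * (b' * f) = a' * b' * (b * b') + a' * b' * (a' * b') * (b' * f)"
      using split[of "\<lambda>w. q w * q w"] q0 q2 qv by (simp add: s2_def)
    also have "b * b' = f * b' + a' * b'" by (subst b_eq) (rule distrib_right)
    finally show ?thesis by (simp add: algebra_simps)
  qed
  have "real s1 ^ 2 \<le> real \<mu> * real s2"
    using sum_square_le[OF fZ, of "\<lambda>w. real (q w)"] by (simp add: s1_def s2_def cZ power2_eq_square)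
  then have "real (s1 ^ 2) \<le> real (\<mu> * s2)" by simp
  then have "s1 ^ 2 \<le> \<mu> * s2" using of_nat_le_iff by blast
  then have "(a' * b' * (a' * b') * f) * (a * (a * f)) \<le> (a' * b' * (a' * b') * f) * (\<mu> * b')"
    unfolding s1 s2 by (simp add: power2_eq_square mult_ac)
  then have "a * (a * f) \<le> \<mu> * b'" using a'_pos b'_pos f_pos by simp
  then have "a * (a * f + 1) \<le> \<mu> * b' + a" by simp
  then have bnd: "a * (b * b') \<le> \<mu> * b' + a" unfolding af .
  \<comment> \<open>The neighbours of \<open>z'\<close> in \<open>T\<close>, apart from
    \<open>z\<close>, that are not neighbours of \<open>z\<close>; there is at least one by the
    choice of \<open>z\<close> and \<open>z'\<close>. The formula for \<open>\<mu>\<close> becomes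
    \<open>(K + 1) * (a * b - 1 - \<mu>) = K * n\<close>, so \<open>K + 1\<close> divides
    \<open>n\<close> and \<open>n \<ge> K + 1\<close>.\<close>
  define n where "n = k - 1 - lam"
  have n: "lam + n + 1 = a * b" "n \<ge> 1" using lam_le k_eq by (auto simp: n_def)
  define K where "K = f * g"
  have K: "a' * b' = K + 1" using fg by (simp add: K_def)
  have "(K + 1) * \<mu> + K * n = a * f + b * g + K * (lam + n)" using mu K by (simp add: K_def algebra_simps)
  also have "\<dots> + K + 1 + (K + 1) = a * f + b * g + 1 + K * (a * b) + (K + 1)" using n(1) by (simp add: algebra_simps flip: n(1))
  finally have e: "(K + 1) * \<mu> + K * n + K + 1 + (K + 1) = a * f + b * g + 1 + (K + 1) + K * (a * b)" by simp
  have "a * f + b * g + 1 + (K + 1) = a * b + (K + 1)"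
  proof -
    have "a * f + 1 + (b * g + 1) = a * b + 1" using af bg sum_eq by simp
    then show ?thesis by simp
  qed
  then have e2: "(K + 1) * \<mu> + K * n + (K + 1) = (K + 1) * (a * b)" using e by (simp add: algebra_simps)
  then have "(K + 1) dvd (K + 1) * \<mu> + K * n + (K + 1)" by (metis dvd_triv_left)
  then have "(K + 1) dvd K * n" by (metis dvd_add_left_iff dvd_add_right_iff dvd_refl dvd_triv_left)
  moreover have "coprime (K + 1) K" by simp
  ultimately have "(K + 1) dvd n" by (simp add: coprime_dvd_mult_right_iff)
  then have "K + 1 \<le> n" using n(2) dvd_imp_le by auto
  then have "(K + 1) * \<mu> + K * (K + 1) + (K + 1) \<le> (K + 1) * (a * b)" using e2 by (metis add_le_mono1 add_left_mono mult_le_mono2)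
  then have "(K + 1) * (\<mu> + K + 1) \<le> (K + 1) * (a * b)" by (simp add: algebra_simps)
  then have "\<mu> + K + 1 \<le> a * b" by (subst (asm) nat_mult_le_cancel1) simp_all
  then have "(\<mu> + K + 1) * b' \<le> (a * b) * b'" by (rule mult_le_mono1)
  also have "\<dots> \<le> \<mu> * b' + a" using bnd by (simp add: mult.assoc)
  finally have "(K + 1) * b' \<le> a" by (simp add: algebra_simps)
  then have "K * b' + b' \<le> g + b'" using a_eq by (simp add: algebra_simps)
  then have "g * (b' * f) \<le> g * 1" by (simp add: K_def mult_ac)
  then show ?thesis by (subst (asm) nat_mult_le_cancel1) (use g_pos in simp_all)
qed

end

text \<open>The bound for both orders of \<open>R1\<close> and \<open>R2\<close> gives
  \<open>a' = b' = f = g = 1\<close>, against \<open>f * g + 1 = a' * b'\<close>.\<close>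

theorem no_coprime_special_pair: "\<not> coprime a' b'"
proof
  assume cop: "coprime a' b'"
  interpret sw: special_pair V RR X Y p k m R2 R1 b a b' a' by (rule sswap)
  have swf: "sw.f = g" by (simp add: sw.f_def g_def)
  have "b' * f \<le> 1" by (rule counting_bound[OF cop])
  moreover have "b' * f > 0" using b'_pos f_pos by simp
  ultimately have "b' * f = 1" by linarith
  then have 1: "b' = 1" "f = 1" by simp_all
  have "a' * g \<le> 1" using sw.counting_bound cop swf by (simp add: coprime_commute)
  moreover have "a' * g > 0" using a'_pos g_pos by simp
  ultimately have "a' * g = 1" by linarith
  then have "a' = 1" "g = 1" by simp_all
  then show False using fg 1 by simp
qed

end

section \<open>Valencies modulo k\<close>

lemma primepow_dvd_consecutive:
  fixes n d :: nat
  assumes "primepow n" "n dvd d * (d - 1)"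
  shows "n dvd d \<or> n dvd d - 1"
proof (cases "d = 0")
  case False
  obtain r i where r: "prime r" "n = r ^ i" using assms(1) by (auto simp: primepow_def)
  show ?thesis
  proof (cases "r dvd d")
    case True
    have "\<not> r dvd d - 1"
    proof
      assume "r dvd d - 1"
      then have "r dvd d - (d - 1)" using True by (metis dvd_diff_nat)
      then show False using False r(1) by simp
    qed
    then have "coprime n (d - 1)" using r by (simp add: prime_imp_coprime)
    then show ?thesis using assms(2) by (simp add: coprime_dvd_mult_left_iff)
  next
    case False
    then have "coprime n d" using r by (simp add: prime_imp_coprime)
    then show ?thesis using assms(2) by (simp add: coprime_dvd_mult_right_iff)
  qed
qed simp

section \<open>Relations whose valency is not a multiple of k\<close>

context equivalenced_pair
begin

definition special where "special = {R\<in>xy.rels. \<not> k dvd xx.val R}"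

lemma finite_special: "finite special"
  using xy.finite_rels by (simp add: special_def)

lemma val_idem: "R \<in> xy.rels \<Longrightarrow> k dvd xx.val R * (xx.val R - 1)"
  using sum_inum_self[of R] by (metis dvd_triv_left)

lemma val_orth: "R \<in> xy.rels \<Longrightarrow> S \<in> xy.rels \<Longrightarrow> R \<noteq> S \<Longrightarrow> k dvd xx.val R * xx.val S"
  using val_mult[of R S] by simp

text \<open>Some prime divisor of \<open>k\<close> does not divide a special valency
  \<open>d\<close>: otherwise \<open>k\<close> would be prime to \<open>d - 1\<close> and would
  divide \<open>d\<close>. By orthogonality two special relations cannot share such a prime, so
  choosing one is injective.\<close>

lemma card_special: "card special \<le> card (prime_factors k)"
proof -
  have "\<exists>q\<in>prime_factors k. \<not> q dvd xx.val R" if R: "R \<in> special" for R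
  proof (rule ccontr)
    assume "\<not> (\<exists>q\<in>prime_factors k. \<not> q dvd xx.val R)"
    then have all: "q dvd xx.val R" if "prime q" "q dvd k" for q
      using that k_pos by (auto simp: prime_factors_dvd)
    have R': "R \<in> xy.rels" "\<not> k dvd xx.val R" using R by (auto simp: special_def)
    have "coprime k (xx.val R - 1)"
    proof (rule ccontr)
      assume "\<not> coprime k (xx.val R - 1)"
      then obtain q where q: "prime q" "q dvd k" "q dvd xx.val R - 1"
        by (metis coprime_iff_gcd_eq_1 gcd_nat.bounded_iff prime_factor_nat)
      then have "q dvd xx.val R - (xx.val R - 1)" using all by (metis dvd_diff_nat)
      then show False using xy.val_pos[OF R'(1)] q(1) by simp
    qed
    then have "k dvd xx.val R" using val_idem[OF R'(1)] by (simp add: coprime_dvd_mult_left_iff)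
    then show False using R' by simp
  qed
  then obtain q where q: "\<And>R. R \<in> special \<Longrightarrow> q R \<in> prime_factors k \<and> \<not> q R dvd xx.val R" by metis
  show ?thesis
  proof (rule card_inj_on_le[of q])
    show "q ` special \<subseteq> prime_factors k" using q by blast
    show "inj_on q special"
    proof (rule inj_onI, rule ccontr)
      fix R S assume RS: "R \<in> special" "S \<in> special" "q R = q S" "R \<noteq> S"
      have "k dvd xx.val R * xx.val S" using val_orth RS by (auto simp: special_def)
      moreover have "prime (q R)" "q R dvd k" using q[OF RS(1)] by auto
      ultimately have "q R dvd xx.val R \<or> q R dvd xx.val S" by (metis dvd_trans prime_dvd_mult_iff)
      then show False using q[OF RS(1)] q[OF RS(2)] RS(3) by auto
    qed
  qed simp
qed

lemma sum_val_eq: "(\<Sum>R\<in>xy.rels. xx.val R) = 1 + k * m"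
  using xy.sum_val p_eq by simp

lemma nonspecial_ge: "R \<in> xy.rels \<Longrightarrow> R \<notin> special \<Longrightarrow> k \<le> xx.val R"
  using xy.val_pos[of R] dvd_imp_le by (auto simp: special_def)

text \<open>Outside one relation \<open>R\<close> there are \<open>m\<close> valencies, each at
  least \<open>k\<close>; the total \<open>1 + k * m\<close> leaves at most 1 for
  \<open>R\<close>.\<close>

lemma few_special:
  assumes "card special \<le> 1"
  shows "\<exists>R\<in>xy.rels. xx.val R = 1"
proof -
  have "xy.rels \<noteq> {}" using card_xy by auto
  then obtain R where R: "R \<in> xy.rels" "special \<subseteq> {R}"
  proof (cases "special = {}")
    case False
    then have "card special = 1" using assms finite_special by (simp add: le_Suc_eq)
    then obtain R where "special = {R}" using card_1_singletonE by blast
    then show ?thesis using that by (auto simp: special_def)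
  qed auto
  have "(\<Sum>S\<in>xy.rels - {R}. k) \<le> (\<Sum>S\<in>xy.rels - {R}. xx.val S)"
    by (rule sum_mono) (use R nonspecial_ge in auto)
  then have "m * k \<le> (\<Sum>S\<in>xy.rels - {R}. xx.val S)" using R card_xy by simp
  moreover have "xx.val R + (\<Sum>S\<in>xy.rels - {R}. xx.val S) = 1 + k * m"
    using sum_val_eq R xy.finite_rels by (simp add: sum.remove)
  ultimately have "xx.val R \<le> 1" by (simp add: mult.commute)
  then show ?thesis using R xy.val_pos[OF R(1)] by (intro bexI[of _ R]) auto
qed

lemma k_ge_2:
  assumes "special \<noteq> {}"
  shows "k \<ge> 2"
proof -
  obtain R where "\<not> k dvd xx.val R" using assms by (auto simp: special_def)
  then have "k \<noteq> 1" by auto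
  then show ?thesis using k_pos by linarith
qed

lemma large_rank:
  assumes large: "m + 1 > k^2 * (k + card (prime_factors k) - 2)"
  shows "card special \<le> 1"
proof (rule ccontr)
  assume t: "\<not> card special \<le> 1"
  define t where "t = card special"
  define e where "e = card (prime_factors k)"
  define G where "G = {S\<in>xy.rels. xx.val S = k}"
  define H where "H = xy.rels - special - G"
  have t2: "t \<ge> 2" and te: "t \<le> e" using t card_special by (auto simp: t_def e_def)
  have k2: "k \<ge> 2" by (rule k_ge_2) (use t in auto)
  have sub: "special \<subseteq> xy.rels" "G \<subseteq> xy.rels" "special \<inter> G = {}" by (auto simp: special_def G_def)
  have fin: "finite special" "finite G" "finite H" using xy.finite_rels by (auto simp: special_def G_def H_def)
  have un: "xy.rels = special \<union> (G \<union> H)" using sub by (auto simp: H_def)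
  have dj: "special \<inter> (G \<union> H) = {}" "G \<inter> H = {}" using sub by (auto simp: H_def)
  have "card xy.rels = card special + card (G \<union> H)" by (subst un) (rule card_Un_disjoint, use fin dj in auto)
  also have "card (G \<union> H) = card G + card H" by (rule card_Un_disjoint) (use fin dj in auto)
  finally have cards: "m + 1 = t + card G + card H" using card_xy by (simp add: t_def)
  have "(\<Sum>S\<in>xy.rels. xx.val S) = (\<Sum>S\<in>special. xx.val S) + (\<Sum>S\<in>G \<union> H. xx.val S)"
    by (subst un) (rule sum.union_disjoint, use fin dj in auto)
  also have "(\<Sum>S\<in>G \<union> H. xx.val S) = (\<Sum>S\<in>G. xx.val S) + (\<Sum>S\<in>H. xx.val S)"
    by (rule sum.union_disjoint) (use fin dj in auto)
  also have "(\<Sum>S\<in>G. xx.val S) = card G * k" by (simp add: G_def)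
  finally have sums: "1 + k * m = (\<Sum>S\<in>special. xx.val S) + (card G * k + (\<Sum>S\<in>H. xx.val S))"
    using sum_val_eq by simp
  have Hge: "2 * k \<le> xx.val S" if "S \<in> H" for S
  proof -
    have S: "k dvd xx.val S" "xx.val S \<noteq> k" "xx.val S > 0" using that xy.val_pos by (auto simp: H_def special_def G_def)
    then obtain c where c: "xx.val S = k * c" by blast
    then have "c \<ge> 2" using S by (cases c; cases "c - 1") auto
    then show ?thesis using c by simp
  qed
  have Hsum: "card H * (2 * k) \<le> (\<Sum>S\<in>H. xx.val S)"
    using sum_mono[of H "\<lambda>_. 2 * k" xx.val] Hge by simp
  have Sge: "card special \<le> (\<Sum>S\<in>special. xx.val S)"
    using sum_mono[of special "\<lambda>_. 1" xx.val] xy.val_pos by (auto simp: special_def Suc_le_eq)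
  show False
  proof (cases "\<forall>R\<in>xy.rels. xx.val R dvd k")
    case True
    have "H = {}"
    proof (rule ccontr)
      assume "H \<noteq> {}"
      then obtain S where S: "S \<in> H" by blast
      then have "xx.val S dvd k" using True by (auto simp: H_def)
      then have "xx.val S \<le> k" using k_pos dvd_imp_le by blast
      then show False using Hge[OF S] k_pos by simp
    qed
    \<comment> \<open>A special valency is a proper divisor of \<open>k\<close>, hence at most
      \<open>k / 2\<close>. With at least two of them and all other valencies equal to
      \<open>k\<close>, the total is at most \<open>k * m\<close>.\<close>
    have half: "2 * xx.val S \<le> k" if "S \<in> special" for S
    proof -
      have S: "xx.val S dvd k" "\<not> k dvd xx.val S" using True that by (auto simp: special_def)
      then obtain c where c: "k = xx.val S * c" by blast
      have "c \<noteq> 0" "c \<noteq> 1" using c S k_pos by auto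
      then have "c \<ge> 2" by linarith
      then have "xx.val S * 2 \<le> xx.val S * c" by (rule mult_le_mono2)
      then show ?thesis using c by simp
    qed
    have "2 * (\<Sum>S\<in>special. xx.val S) \<le> t * k"
      using sum_mono[of special "\<lambda>S. 2 * xx.val S" "\<lambda>_. k"] half by (simp add: t_def sum_distrib_left)
    then have "2 + 2 * (k * m) \<le> t * k + 2 * (card G * k)" using sums \<open>H = {}\<close> by simp
    moreover have "k * m + k = t * k + card G * k"
    proof -
      have "(m + 1) * k = (t + card G) * k" using cards \<open>H = {}\<close> by simp
      then show ?thesis by (simp add: algebra_simps)
    qed
    ultimately have "2 + t * k \<le> 2 * k" by linarith
    moreover have "2 * k \<le> t * k" using t2 by simp
    ultimately show False by simp
  next
    case False
    then obtain R where R: "R \<in> xy.rels" "\<not> xx.val R dvd k" by blast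
    define d where "d = xx.val R"
    have RG: "R \<notin> G" using R by (auto simp: G_def)
    have bd: "card G * k \<le> (k - 1) * (d - 1)"
      using nondividing_valency[OF R] by (simp add: G_def d_def)
    have "d + (\<Sum>S\<in>G. xx.val S) = (\<Sum>S\<in>insert R G. xx.val S)" using RG fin by (simp add: d_def)
    also have "\<dots> \<le> 1 + k * m"
      unfolding sum_val_eq[symmetric] by (rule sum_mono2[OF xy.finite_rels]) (use R sub in auto)
    finally have dk: "d + card G * k \<le> 1 + k * m" by (simp add: G_def)
    have "card G * k + card H * (2 * k) + t \<le> 1 + k * m" using sums Hsum Sge by (simp add: t_def)
    then have c1: "card G * k + card H * (2 * k) \<le> k * m" using t2 by linarith
    \<comment> \<open>Eliminating \<open>card H\<close>: relations in \<open>H\<close> are at least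
      twice as heavy as those in \<open>G\<close>, so nearly all relations must lie in
      \<open>G\<close>. By \<open>dk\<close> this limits \<open>d\<close>, and then
      \<open>bd\<close> limits \<open>card G\<close>.\<close>
    have "(m + 1) * (2 * k) = (t + card G + card H) * (2 * k)" using cards by simp
    then have "k * (m + 2) \<le> k * (card G + 2 * t)" using c1 by (simp add: algebra_simps)
    then have c2: "m + 2 \<le> card G + 2 * t" by (subst (asm) nat_mult_le_cancel1) (use k_pos in simp_all)
    then have "m * k \<le> (card G + (2 * t - 2)) * k" using t2 by (intro mult_le_mono1) linarith
    then have "d - 1 \<le> (2 * t - 2) * k" using dk by (simp add: algebra_simps)
    then have "card G * k \<le> (k - 1) * ((2 * t - 2) * k)" using bd mult_le_mono2 order_trans by blast
    then have "card G * k \<le> ((k - 1) * (2 * t - 2)) * k" by (simp add: mult_ac)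
    then have "card G \<le> (k - 1) * (2 * t - 2)" using k_pos by simp
    then have "m \<le> (k - 1) * (2 * t - 2) + (2 * t - 2)" using c2 t2 by linarith
    also have "\<dots> = k * (2 * t - 2)" using k_pos by (cases k) auto
    also have "\<dots> \<le> k * (2 * e - 2)" using te by (intro mult_le_mono2) linarith
    finally have up: "m \<le> k * (2 * e - 2)" .
    have "e \<le> k + e - 2" using k2 by simp
    then have "2 * e \<le> k * (k + e - 2)" using k2 by (intro mult_le_mono)
    then have "k * (2 * e) \<le> k * (k * (k + e - 2))" by (rule mult_le_mono2)
    moreover have "k * (k * (k + e - 2)) \<le> m" using large by (simp add: e_def power2_eq_square mult.assoc)
    ultimately have "k * (2 * e) \<le> m" by (rule le_trans)
    then have "k * (2 * e) \<le> k * (2 * e - 2)" using up by linarith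
    then have "2 * e \<le> 2 * e - 2" using k_pos by simp
    then show False using te t2 by linarith
  qed
qed

lemma two_special:
  assumes k: "k = a * b" and cop: "coprime a b" and pp: "primepow a" "primepow b" and t: "card special = 2"
  obtains R1 R2 a' b' where "special_pair V RR X Y p k m R1 R2 a b a' b'"
proof -
  obtain R S where RS: "special = {R, S}" "R \<noteq> S" using t by (metis card_2_iff)
  have RS': "R \<in> xy.rels" "S \<in> xy.rels" "\<not> k dvd xx.val R" "\<not> k dvd xx.val S"
    using RS by (auto simp: special_def)
  have k2: "k \<ge> 2" by (rule k_ge_2) (use RS in auto)
  have sum: "xx.val R + xx.val S = a * b + 1"
  \<comment> \<open>A prime power dividing \<open>k\<close> will divide exactly one of the two
    valencies, because their sum is 1 modulo \<open>k\<close> and their product is 0.\<close>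
  proof -
    \<comment> \<open>The \<open>m - 1\<close> nonspecial valencies are positive multiples of
      \<open>k\<close> with total \<open>k * N\<close>. As \<open>N\<close> is below
      \<open>m\<close>, it equals \<open>m - 1\<close>, and the two special valencies share the
      remaining \<open>k + 1\<close>.\<close>
    define N where "N = (\<Sum>T\<in>xy.rels - special. xx.val T div k)"
    have "(\<Sum>T\<in>xy.rels - special. xx.val T) = k * N"
      unfolding N_def sum_distrib_left by (rule sum.cong) (auto simp: special_def)
    moreover have "(\<Sum>T\<in>xy.rels. xx.val T) = (\<Sum>T\<in>xy.rels - special. xx.val T) + (\<Sum>T\<in>special. xx.val T)"
      by (rule sum.subset_diff) (use xy.finite_rels in \<open>auto simp: special_def\<close>)
    ultimately have s: "k * N + (xx.val R + xx.val S) = 1 + k * m" using sum_val_eq RS by simp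
    have "card (xy.rels - special) = m - 1" using card_xy RS RS' by (simp add: card_Diff_subset)
    moreover have "(\<Sum>T\<in>xy.rels - special. 1) \<le> N" unfolding N_def
    proof (rule sum_mono)
      fix T assume "T \<in> xy.rels - special"
      then have "k \<le> xx.val T" using nonspecial_ge by blast
      then show "1 \<le> xx.val T div k" using k_pos by (simp add: Suc_le_eq div_greater_zero_iff)
    qed
    ultimately have "m - 1 \<le> N" by simp
    moreover have "k * N < k * m" using s xy.val_pos[OF RS'(1)] xy.val_pos[OF RS'(2)] by linarith
    ultimately have "N = m - 1" by auto
    then have "k * m = k * N + k" using m2 by (cases m) auto
    then show ?thesis using s k by simp
  qed
  have one: "n dvd xx.val R \<longleftrightarrow> \<not> n dvd xx.val S" if n: "primepow n" "n dvd k" for n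
  proof -
    have n1: "n \<noteq> 1" using n(1) by auto
    have "\<not> (n dvd xx.val R \<and> n dvd xx.val S)"
    proof
      assume "n dvd xx.val R \<and> n dvd xx.val S"
      then have "n dvd k + 1" using sum k by (metis dvd_add)
      then have "n dvd 1" using n(2) dvd_add_right_iff by blast
      then show False using n1 by simp
    qed
    moreover have "n dvd xx.val S" if "\<not> n dvd xx.val R"
    proof -
      have "n dvd xx.val R * (xx.val R - 1)" using val_idem[OF RS'(1)] n(2) dvd_trans by blast
      then have "n dvd xx.val R - 1" using primepow_dvd_consecutive n(1) that by blast
      then have "n dvd (xx.val R - 1) * xx.val S" by simp
      moreover have "n dvd xx.val R * xx.val S" using val_orth[OF RS'(1,2) RS(2)] n(2) dvd_trans by blast
      ultimately have "n dvd xx.val R * xx.val S - (xx.val R - 1) * xx.val S" by (rule dvd_diff_nat[rotated])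
      moreover have "xx.val R * xx.val S - (xx.val R - 1) * xx.val S = xx.val S"
        using xy.val_pos[OF RS'(1)] by (cases "xx.val R") auto
      ultimately show ?thesis by simp
    qed
    ultimately show ?thesis by blast
  qed
  have ab2: "a \<ge> 2" "b \<ge> 2" using pp[THEN primepow_gt_Suc_0] by auto
  have oa: "a dvd xx.val R \<longleftrightarrow> \<not> a dvd xx.val S" by (rule one[OF pp(1)]) (simp add: k)
  have ob: "b dvd xx.val R \<longleftrightarrow> \<not> b dvd xx.val S" by (rule one[OF pp(2)]) (simp add: k)
  have nR: "\<not> (a dvd xx.val R \<and> b dvd xx.val R)" using RS'(3) cop k by (auto dest: divides_mult)
  have nS: "\<not> (a dvd xx.val S \<and> b dvd xx.val S)" using RS'(4) cop k by (auto dest: divides_mult)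
  show ?thesis
  proof (cases "a dvd xx.val R")
    case True
    then have "b dvd xx.val S" using nR ob by blast
    then obtain a' b' where v: "xx.val R = a * a'" "xx.val S = b * b'" using True by (auto elim!: dvdE)
    have "special_pair V RR X Y p k m R S a b a' b'"
      by unfold_locales (use RS RS' v k sum ab2 in auto)
    then show ?thesis by (rule that)
  next
    case False
    then have "a dvd xx.val S" "b dvd xx.val R" using oa nS ob by auto
    then obtain a' b' where v: "xx.val S = a * a'" "xx.val R = b * b'" by (auto elim!: dvdE)
    have "special_pair V RR X Y p k m S R a b a' b'"
      by unfold_locales (use RS RS' v k sum ab2 in auto)
    then show ?thesis by (rule that)
  qed
qed

lemma small_multiple_of_primepow:
  assumes q: "primepow q" and k: "k = b * q" and b: "b \<in> {1, 2, 3, 4}" and b4: "b = 4 \<Longrightarrow> \<not> 3 dvd q + 1"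
  shows "card special \<le> 1"
proof (rule ccontr)
  assume t: "\<not> card special \<le> 1"
  obtain r i where r: "prime r" "q = r ^ i" using q by (auto simp: primepow_def)
  \<comment> \<open>The prime of which \<open>b\<close> is a power, with \<open>b = 1\<close> as the
    zeroth power; it lets all values of \<open>b\<close> be treated together.\<close>
  define c :: nat where "c = (if b = 3 then 3 else 2)"
  have c: "prime c" by (simp add: c_def)
  have pfq: "prime_factors q \<subseteq> {r}" using r by (simp add: prime_factorization_prime_power)
  have bc: "b = c ^ (if b = 1 then 0 else if b = 4 then 2 else 1)" using b by (auto simp: c_def)
  have pfb: "prime_factors b \<subseteq> {c}" using c by (subst bc) (simp add: prime_factorization_prime_power)
  have q0: "q \<noteq> 0" and b0: "b \<noteq> 0" using primepow_gt_Suc_0[OF q] b by auto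
  have pf: "prime_factors k = prime_factors b \<union> prime_factors q"
    unfolding k using q0 b0 by (simp add: prime_factors_product)
  have card2: "card (prime_factors k) \<ge> 2" using t card_special by linarith
  have b1: "b \<noteq> 1"
  proof
    assume "b = 1"
    then have "prime_factors k \<subseteq> {r}" using pf pfq by simp
    then show False using card2 card_mono[of "{r}" "prime_factors k"] by simp
  qed
  have rc: "r \<noteq> c"
  proof
    assume "r = c"
    then have "prime_factors k \<subseteq> {r}" using pf pfq pfb by auto
    then show False using card2 card_mono[of "{r}" "prime_factors k"] by simp
  qed
  have "prime_factors k \<subseteq> {r, c}" using pf pfq pfb by auto
  then have "card (prime_factors k) \<le> 2" using card_mono[of "{r, c}" "prime_factors k"] rc by simp
  then have t2: "card special = 2" using t card_special by linarith
  have "coprime r c" using primes_coprime[OF r(1) c rc] .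
  then have cop: "coprime q b" unfolding r(2) by (subst bc) simp
  have ppb: "primepow b"
    unfolding primepow_def
    by (intro exI[of _ c] exI[of _ "if b = 4 then 2 else 1 :: nat"]) (use b b1 c in \<open>auto simp: c_def\<close>)
  have kqb: "k = q * b" using k by simp
  obtain R1 R2 a' b' where sp: "special_pair V RR X Y p k m R1 R2 q b a' b'"
    by (rule two_special[OF kqb cop q ppb t2])
  interpret sp: special_pair V RR X Y p k m R1 R2 q b a' b' by (rule sp)
  have nc: "\<not> coprime a' b'" by (rule sp.no_coprime_special_pair)
  have a'1: "a' \<noteq> 1" using nc by auto
  have ls: "a' < b" "a' > 0" using sp.a'_less sp.a'_pos by auto
  have se: "q * a' + b * b' = q * b + 1" by (rule sp.sum_eq)
  \<comment> \<open>Since \<open>a' < b\<close> and \<open>a' \<noteq> 1\<close>, the value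
    \<open>b = 2\<close> is excluded.\<close>
  consider "b = 3" "a' = 2" | "b = 4" "a' = 2" | "b = 4" "a' = 3" using b ls a'1 by force
  then show False
  proof cases
    case 1
    then have "3 * b' = q + 1" using se by simp
    moreover have "even b'" using nc 1 by (metis coprime_left_2_iff_odd)
    ultimately have "odd q" by presburger
    then have "odd k" using k 1 by simp
    moreover have "sp.f = 1" unfolding sp.f_def using 1 by simp
    ultimately show False by (rule sp.parity[rotated])
  next
    case 2
    then have "q * 2 + 4 * b' = q * 4 + 1" using se by simp
    then show False by presburger
  next
    case 3
    have "3 dvd b'"
    proof -
      have "prime (3::nat)" by simp
      then show ?thesis using nc 3 prime_imp_coprime by blast
    qed
    moreover have "4 * b' = q + 1" using se 3 by simp
    ultimately have "3 dvd q + 1" by (metis dvd_mult)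
    then show False using b4 3 by simp
  qed
qed

end

theorem theorem1p2:
  fixes V :: "'a set" and RR :: "('a \<times> 'a) set set" and X Y :: "'a set" and k :: nat
  assumes cc: "coherent_configuration V RR"
    and two_fibers: "{F. fiber V RR F} = {X, Y}" "X \<noteq> Y"
    and eq_card: "card X = card Y"
    and prime_card: "prime (card X)"
    and rXX: "card (rels_between RR X X) > 2"
    and rXY: "card (rels_between RR X Y) > 1"
    and k_def: "card X - 1 = k * (card (rels_between RR X X) - 1)"
    and conds: "card (rels_between RR X X) > k^2 * (k + card (prime_factors k) - 2)
               \<or> (\<exists>q. primepow q \<and> k \<in> {q, 2*q, 3*q})
               \<or> (\<exists>q. primepow q \<and> k = 4*q \<and> \<not> (3 dvd q + 1))"
  shows "\<exists>S\<in>rels_between RR X Y. card S = card X \<and> card S = card Y"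
proof -
  define m where "m = card (rels_between RR X X) - 1"
  have fib: "fiber V RR X" "fiber V RR Y" using two_fibers(1) by auto
  interpret P: fiber_pair V RR X Y "card X"
    by unfold_locales (use cc fib eq_card prime_card in auto)
  interpret Q: fiber_pair V RR Y X "card X" by (rule P.flip)
  have xx: "card P.xx.rels = m + 1" using rXX by (simp add: P.xx.rels_def m_def)
  have "card P.xy.rels > 1" using rXY by (simp add: P.xy.rels_def)
  then have xy: "card P.xy.rels = m + 1" using P.card_rels_XY xx by simp
  \<comment> \<open>Counting from \<open>Y\<close> to \<open>X\<close> equates the numbers of
    relations on \<open>Y\<close> and on \<open>X\<close>.\<close>
  then have "card P.yx.rels = m + 1" by (simp add: P.card_yx)
  then have yy: "card P.yy.rels = m + 1" using Q.card_rels_XY rXX by (simp add: m_def)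
  have p: "card X = 1 + k * m" using k_def P.xx.p_gt_1 by (simp add: m_def)
  interpret E: equivalenced_pair V RR X Y "card X" k m
    by unfold_locales (use xx xy yy p rXX in \<open>auto simp: m_def\<close>)
  have "card E.special \<le> 1"
    using conds
  proof (elim disjE exE conjE)
    assume "card (rels_between RR X X) > k^2 * (k + card (prime_factors k) - 2)"
    then show ?thesis using E.large_rank rXX by (simp add: m_def)
  next
    fix q assume q: "primepow q" "k \<in> {q, 2*q, 3*q}"
    then obtain b where "k = b * q" "b \<in> {1, 2, 3}" by (metis insert_iff mult_1 singletonD)
    then show ?thesis using E.small_multiple_of_primepow[OF q(1), of b] by auto
  next
    fix q assume "primepow q" "k = 4 * q" "\<not> 3 dvd q + 1"
    then show ?thesis using E.small_multiple_of_primepow[of q 4] by auto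
  qed
  then obtain S where S: "S \<in> P.xy.rels" "P.xx.val S = 1" using E.few_special by blast
  then have "card S = card X" using P.xy.card_val[OF S(1)] by simp
  then show ?thesis using S(1) eq_card by (auto simp: P.xy.rels_def)
qed

end
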